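(* Let $(\epsilon_n)_{n \ge 1}$ be a decreasing sequence of positive numbers converging to $0$, and let $(a_n)_{n\ge 0}$ be a strictly increasing sequence of positive integers with $a_{n+m} \ge a_n a_m$ for all $n,m$, chosen such that $a_0 = 1$ and $$a_n \ \geq\ \max\Big\{ \frac{2^k}{\epsilon_{n-k}}\, a_k\, a_{n-k} : k = 1, \dots, n-1 \Big\}$$ for all $n \ge 2$. Let $\omega : [0,\infty) \to (0,\infty)$ be the associated staircase weight, $\omega(t) = 1/a_n$ for $t \in [n,n+1)$, $n = 0,1,2,\dots$. Then the operator algebra $\mathcal{A}(\omega)$ is not compact, but is weakly compact, and hence is an ideal in its bidual. Also, $\mathcal{A}(\omega)$ is a commutative approximately unital radical operator algebra, which is not reflexive as a Banach space, and which is topologically singly generated.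
   Context: An operator algebra is a norm closed algebra of operators on a complex Hilbert space; its bidual is an operator algebra with the Arens product. A weight is a measurable function $\omega : [0,\infty) \to (0,\infty)$ with $\omega(0)=1$ and $\omega(s+t) \le \omega(s)\omega(t)$ for all $s,t \ge 0$. For $1 \le p < \infty$, $L^p(\omega)$ is the Banach space of (classes of) measurable $f:[0,\infty)\to\mathbb{C}$ with $\|f\|_p = (\int_0^\infty |f(t)|^p \omega(t)^p\,dt)^{1/p} < \infty$. $L^1(\omega)$ is a Banach algebra under convolution $(f*g)(t)=\int_0^t f(t-s)g(s)\,ds$, and $f \mapsto M_f$, $M_f(g) = f*g$, is a contractive homomorphism from $L^1(\omega)$ into $B(L^2(\omega))$. $\mathcal{A}(\omega)$ denotes the operator-norm closure of $\{M_f : f \in L^1(\omega)\}$ in $B(L^2(\omega))$. A Banach algebra $A$ is compact (resp. weakly compact) if for every $a \in A$ the map $x \mapsto axa$ on $A$ is compact (resp. weakly compact). Approximately unital means having a contractive approximate identity. An algebra is radical if it equals its Jacobson radical. Topologically singly generated means that some single element generates $A$ as a norm closed algebra. *)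

theory Defs
  imports "HOL-Analysis.Analysis" "HOL-Library.Function_Algebras"
begin

section \<open>Complex vector spaces\<close>

class complex_vector = ab_group_add +
  fixes scaleC :: "complex \<Rightarrow> 'a \<Rightarrow> 'a"  (infixr \<open>*\<^sub>C\<close> 75)
  assumes scaleC_add_right: "c *\<^sub>C (x + y) = c *\<^sub>C x + c *\<^sub>C y"
    and scaleC_add_left: "(c + d) *\<^sub>C x = c *\<^sub>C x + d *\<^sub>C x"
    and scaleC_scaleC: "c *\<^sub>C d *\<^sub>C x = (c * d) *\<^sub>C x"
    and scaleC_one: "1 *\<^sub>C x = x"

global_interpretation complex_vector: vector_space "scaleC :: complex \<Rightarrow> 'a \<Rightarrow> 'a::complex_vector"
  defines csubspace = complex_vector.subspace
  by unfold_locales (rule scaleC_add_right scaleC_add_left scaleC_scaleC scaleC_one)+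

instantiation complex :: complex_vector
begin

definition scaleC_complex :: "complex \<Rightarrow> complex \<Rightarrow> complex"
  where "scaleC_complex c z = c * z"

instance
  by standard (simp_all add: scaleC_complex_def algebra_simps)

end

instantiation "fun" :: (type, complex_vector) complex_vector
begin

definition scaleC_fun :: "complex \<Rightarrow> ('a \<Rightarrow> 'b) \<Rightarrow> 'a \<Rightarrow> 'b"
  where "scaleC_fun c f = (\<lambda>x. c *\<^sub>C f x)"

instance
  by standard
    (simp_all add: scaleC_fun_def fun_eq_iff scaleC_add_right scaleC_add_left scaleC_scaleC scaleC_one)

end


section \<open>Normed spaces, bounded operators and duals\<close>

text \<open>
  A normed space is a subspace \<open>V\<close> of a complex vector space together with a function \<open>N\<close>
  of which only the values on \<open>V\<close> matter.
\<close>

definition normed_space_on :: "'a::complex_vector set \<Rightarrow> ('a \<Rightarrow> real) \<Rightarrow> bool"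
  where "normed_space_on V N \<longleftrightarrow> csubspace V \<and>
    (\<forall>x\<in>V. 0 \<le> N x \<and> (N x = 0 \<longleftrightarrow> x = 0)) \<and>
    (\<forall>x\<in>V. \<forall>y\<in>V. N (x + y) \<le> N x + N y) \<and>
    (\<forall>c. \<forall>x\<in>V. N (c *\<^sub>C x) = cmod c * N x)"

text \<open>
  The locale \<open>Metric_space\<close> asks for nonnegativity and symmetry on the whole type, hence the
  value 0 off the carrier.
\<close>

definition norm_dist :: "'a::complex_vector set \<Rightarrow> ('a \<Rightarrow> real) \<Rightarrow> 'a \<Rightarrow> 'a \<Rightarrow> real"
  where "norm_dist V N x y = (if x \<in> V \<and> y \<in> V then N (x - y) else 0)"

definition norm_topology :: "'a::complex_vector set \<Rightarrow> ('a \<Rightarrow> real) \<Rightarrow> 'a topology"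
  where "norm_topology V N = Metric_space.mtopology V (norm_dist V N)"

lemma Metric_space_norm_dist:
  assumes "normed_space_on V N"
  shows "Metric_space V (norm_dist V N)"
proof -
  have V: "csubspace V" and pos: "\<And>x. x \<in> V \<Longrightarrow> 0 \<le> N x"
    and zero: "\<And>x. x \<in> V \<Longrightarrow> N x = 0 \<longleftrightarrow> x = 0"
    and tri: "\<And>x y. x \<in> V \<Longrightarrow> y \<in> V \<Longrightarrow> N (x + y) \<le> N x + N y"
    and hom: "\<And>c x. x \<in> V \<Longrightarrow> N (c *\<^sub>C x) = cmod c * N x"
    using assms unfolding normed_space_on_def by blast+
  have sub: "x - y \<in> V" if "x \<in> V" "y \<in> V" for x y
    using V that by (rule complex_vector.subspace_diff)
  have sym: "N (x - y) = N (y - x)" if "x \<in> V" "y \<in> V" for x y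
    using hom[OF sub[OF that], of "- 1"] by simp
  show ?thesis
  proof
    show "0 \<le> norm_dist V N x y" for x y
      by (simp add: norm_dist_def pos sub)
    show "norm_dist V N x y = norm_dist V N y x" for x y
      unfolding norm_dist_def using sym[of x y] by presburger
    show "norm_dist V N x y = 0 \<longleftrightarrow> x = y" if "x \<in> V" "y \<in> V" for x y
      using zero[OF sub[OF that]] that by (simp add: norm_dist_def)
    show "norm_dist V N x z \<le> norm_dist V N x y + norm_dist V N y z"
      if "x \<in> V" "y \<in> V" "z \<in> V" for x y z
      using tri[OF sub[OF that(1,2)] sub[OF that(2,3)]] that by (simp add: norm_dist_def)
  qed
qed

definition banach_space_on :: "'a::complex_vector set \<Rightarrow> ('a \<Rightarrow> real) \<Rightarrow> bool"
  where "banach_space_on V N \<longleftrightarrow> normed_space_on V N \<and> Metric_space.mcomplete V (norm_dist V N)"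

definition inner_product_on :: "'a::complex_vector set \<Rightarrow> ('a \<Rightarrow> 'a \<Rightarrow> complex) \<Rightarrow> bool"
  where "inner_product_on H ip \<longleftrightarrow>
    (\<forall>x\<in>H. \<forall>y\<in>H. \<forall>z\<in>H. ip (x + y) z = ip x z + ip y z) \<and>
    (\<forall>c. \<forall>x\<in>H. \<forall>y\<in>H. ip (c *\<^sub>C x) y = c * ip x y) \<and>
    (\<forall>x\<in>H. \<forall>y\<in>H. ip y x = cnj (ip x y)) \<and>
    (\<forall>x\<in>H. 0 \<le> Re (ip x x) \<and> (ip x x = 0 \<longleftrightarrow> x = 0))"

definition hilbert_space_on :: "'a::complex_vector set \<Rightarrow> ('a \<Rightarrow> real) \<Rightarrow> bool"
  where "hilbert_space_on H N \<longleftrightarrow> banach_space_on H N \<and>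
    (\<exists>ip. inner_product_on H ip \<and> (\<forall>x\<in>H. N x = sqrt (Re (ip x x))))"

definition clinear_on :: "'a::complex_vector set \<Rightarrow> ('a \<Rightarrow> 'b::complex_vector) \<Rightarrow> bool"
  where "clinear_on V T \<longleftrightarrow>
    (\<forall>x\<in>V. \<forall>y\<in>V. T (x + y) = T x + T y) \<and> (\<forall>c. \<forall>x\<in>V. T (c *\<^sub>C x) = c *\<^sub>C T x)"

text \<open>
  Operators on \<open>V\<close> are extended by 0 off \<open>V\<close>, so that two of them are equal as functions iff
  they agree on \<open>V\<close>; sums, scalar multiples and compositions respect this convention.
\<close>

definition bounded_ops ::
    "'a::complex_vector set \<Rightarrow> ('a \<Rightarrow> real) \<Rightarrow> 'b::complex_vector set \<Rightarrow> ('b \<Rightarrow> real) \<Rightarrow> ('a \<Rightarrow> 'b) set"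
  where "bounded_ops V N W M = {T. (\<forall>x\<in>V. T x \<in> W) \<and> clinear_on V T \<and>
    (\<exists>C. \<forall>x\<in>V. M (T x) \<le> C * N x) \<and> (\<forall>x. x \<notin> V \<longrightarrow> T x = 0)}"

definition op_norm ::
    "'a::complex_vector set \<Rightarrow> ('a \<Rightarrow> real) \<Rightarrow> ('b \<Rightarrow> real) \<Rightarrow> ('a \<Rightarrow> 'b::complex_vector) \<Rightarrow> real"
  where "op_norm V N M T = (SUP x\<in>{x\<in>V. N x \<le> 1}. M (T x))"

definition dual :: "'a::complex_vector set \<Rightarrow> ('a \<Rightarrow> real) \<Rightarrow> ('a \<Rightarrow> complex) set"
  where "dual V N = bounded_ops V N UNIV cmod"

definition dual_norm :: "'a::complex_vector set \<Rightarrow> ('a \<Rightarrow> real) \<Rightarrow> ('a \<Rightarrow> complex) \<Rightarrow> real"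
  where "dual_norm V N = op_norm V N cmod"

definition bidual :: "'a::complex_vector set \<Rightarrow> ('a \<Rightarrow> real) \<Rightarrow> (('a \<Rightarrow> complex) \<Rightarrow> complex) set"
  where "bidual V N = dual (dual V N) (dual_norm V N)"

definition bidual_embedding ::
    "'a::complex_vector set \<Rightarrow> ('a \<Rightarrow> real) \<Rightarrow> 'a \<Rightarrow> ('a \<Rightarrow> complex) \<Rightarrow> complex"
  where "bidual_embedding V N x = (\<lambda>\<phi>. if \<phi> \<in> dual V N then \<phi> x else 0)"

definition reflexive_space :: "'a::complex_vector set \<Rightarrow> ('a \<Rightarrow> real) \<Rightarrow> bool"
  where "reflexive_space V N \<longleftrightarrow> bidual_embedding V N ` V = bidual V N"

definition weak_topology :: "'a::complex_vector set \<Rightarrow> ('a \<Rightarrow> real) \<Rightarrow> 'a topology"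
  where "weak_topology V N =
    topology_generated_by {{x\<in>V. \<phi> x \<in> U} |\<phi> U. \<phi> \<in> dual V N \<and> open U}"

definition compact_map_on :: "'a::complex_vector set \<Rightarrow> ('a \<Rightarrow> real) \<Rightarrow> ('a \<Rightarrow> 'a) \<Rightarrow> bool"
  where "compact_map_on V N T \<longleftrightarrow>
    compactin (norm_topology V N) (norm_topology V N closure_of (T ` {x\<in>V. N x \<le> 1}))"

definition weakly_compact_map_on :: "'a::complex_vector set \<Rightarrow> ('a \<Rightarrow> real) \<Rightarrow> ('a \<Rightarrow> 'a) \<Rightarrow> bool"
  where "weakly_compact_map_on V N T \<longleftrightarrow>
    compactin (weak_topology V N) (weak_topology V N closure_of (T ` {x\<in>V. N x \<le> 1}))"


section \<open>Normed algebras\<close>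

text \<open>
  A normed algebra is a normed space \<open>A\<close>, \<open>N\<close> as above with a product \<open>m\<close>; no unit is assumed.
\<close>

definition subalgebra_of :: "'a::complex_vector set \<Rightarrow> 'a set \<Rightarrow> ('a \<Rightarrow> 'a \<Rightarrow> 'a) \<Rightarrow> bool"
  where "subalgebra_of B A m \<longleftrightarrow> B \<subseteq> A \<and> csubspace B \<and> (\<forall>x\<in>B. \<forall>y\<in>B. m x y \<in> B)"

definition left_ideal_of :: "'a::complex_vector set \<Rightarrow> 'a set \<Rightarrow> ('a \<Rightarrow> 'a \<Rightarrow> 'a) \<Rightarrow> bool"
  where "left_ideal_of L A m \<longleftrightarrow> L \<subseteq> A \<and> csubspace L \<and> (\<forall>a\<in>A. \<forall>x\<in>L. m a x \<in> L)"

definition ideal_of :: "'a::complex_vector set \<Rightarrow> 'a set \<Rightarrow> ('a \<Rightarrow> 'a \<Rightarrow> 'a) \<Rightarrow> bool"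
  where "ideal_of I A m \<longleftrightarrow> left_ideal_of I A m \<and> (\<forall>a\<in>A. \<forall>x\<in>I. m x a \<in> I)"

definition modular_left_ideal :: "'a::complex_vector set \<Rightarrow> 'a set \<Rightarrow> ('a \<Rightarrow> 'a \<Rightarrow> 'a) \<Rightarrow> bool"
  where "modular_left_ideal L A m \<longleftrightarrow> left_ideal_of L A m \<and> (\<exists>u\<in>A. \<forall>a\<in>A. a - m a u \<in> L)"

definition maximal_modular_left_ideal ::
    "'a::complex_vector set \<Rightarrow> 'a set \<Rightarrow> ('a \<Rightarrow> 'a \<Rightarrow> 'a) \<Rightarrow> bool"
  where "maximal_modular_left_ideal L A m \<longleftrightarrow> modular_left_ideal L A m \<and> L \<noteq> A \<and>
    (\<forall>L'. left_ideal_of L' A m \<and> L \<subseteq> L' \<longrightarrow> L' = L \<or> L' = A)"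

definition jacobson_radical :: "'a::complex_vector set \<Rightarrow> ('a \<Rightarrow> 'a \<Rightarrow> 'a) \<Rightarrow> 'a set"
  where "jacobson_radical A m = {a\<in>A. \<forall>L. maximal_modular_left_ideal L A m \<longrightarrow> a \<in> L}"

definition radical_algebra :: "'a::complex_vector set \<Rightarrow> ('a \<Rightarrow> 'a \<Rightarrow> 'a) \<Rightarrow> bool"
  where "radical_algebra A m \<longleftrightarrow> jacobson_radical A m = A"

definition commutative_algebra :: "'a set \<Rightarrow> ('a \<Rightarrow> 'a \<Rightarrow> 'a) \<Rightarrow> bool"
  where "commutative_algebra A m \<longleftrightarrow> (\<forall>x\<in>A. \<forall>y\<in>A. m x y = m y x)"

definition compact_algebra :: "'a::complex_vector set \<Rightarrow> ('a \<Rightarrow> real) \<Rightarrow> ('a \<Rightarrow> 'a \<Rightarrow> 'a) \<Rightarrow> bool"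
  where "compact_algebra A N m \<longleftrightarrow> (\<forall>a\<in>A. compact_map_on A N (\<lambda>x. m (m a x) a))"

definition weakly_compact_algebra ::
    "'a::complex_vector set \<Rightarrow> ('a \<Rightarrow> real) \<Rightarrow> ('a \<Rightarrow> 'a \<Rightarrow> 'a) \<Rightarrow> bool"
  where "weakly_compact_algebra A N m \<longleftrightarrow> (\<forall>a\<in>A. weakly_compact_map_on A N (\<lambda>x. m (m a x) a))"

text \<open>The net is given by a proper filter on the algebra.\<close>

definition approximately_unital ::
    "'a::complex_vector set \<Rightarrow> ('a \<Rightarrow> real) \<Rightarrow> ('a \<Rightarrow> 'a \<Rightarrow> 'a) \<Rightarrow> bool"
  where "approximately_unital A N m \<longleftrightarrow> (\<exists>F. F \<noteq> bot \<and> (\<forall>\<^sub>F e in F. e \<in> A \<and> N e \<le> 1) \<and>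
    (\<forall>a\<in>A. ((\<lambda>e. N (m e a - a)) \<longlongrightarrow> 0) F \<and> ((\<lambda>e. N (m a e - a)) \<longlongrightarrow> 0) F))"

definition closed_subalgebra_generated ::
    "'a::complex_vector set \<Rightarrow> ('a \<Rightarrow> real) \<Rightarrow> ('a \<Rightarrow> 'a \<Rightarrow> 'a) \<Rightarrow> 'a set \<Rightarrow> 'a set"
  where "closed_subalgebra_generated A N m S =
    \<Inter> {B. subalgebra_of B A m \<and> closedin (norm_topology A N) B \<and> S \<subseteq> B}"

definition topologically_singly_generated ::
    "'a::complex_vector set \<Rightarrow> ('a \<Rightarrow> real) \<Rightarrow> ('a \<Rightarrow> 'a \<Rightarrow> 'a) \<Rightarrow> bool"
  where "topologically_singly_generated A N m \<longleftrightarrow>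
    (\<exists>x\<in>A. closed_subalgebra_generated A N m {x} = A)"

text \<open>
  The first Arens product: \<open>\<langle>\<mu> \<box> \<eta>, \<phi>\<rangle> = \<langle>\<mu>, \<eta> \<cdot> \<phi>\<rangle>\<close>, \<open>\<langle>\<eta> \<cdot> \<phi>, a\<rangle> = \<langle>\<eta>, \<phi> \<cdot> a\<rangle>\<close>,
  \<open>\<langle>\<phi> \<cdot> a, b\<rangle> = \<langle>\<phi>, a b\<rangle>\<close>.  It agrees with the second one on operator algebras.
\<close>

definition arens_product ::
    "'a::complex_vector set \<Rightarrow> ('a \<Rightarrow> real) \<Rightarrow> ('a \<Rightarrow> 'a \<Rightarrow> 'a) \<Rightarrow>
     (('a \<Rightarrow> complex) \<Rightarrow> complex) \<Rightarrow> (('a \<Rightarrow> complex) \<Rightarrow> complex) \<Rightarrow> (('a \<Rightarrow> complex) \<Rightarrow> complex)"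
  where "arens_product A N m \<mu> \<eta> =
    (\<lambda>\<phi>. if \<phi> \<in> dual A N
      then \<mu> (\<lambda>a. if a \<in> A then \<eta> (\<lambda>b. if b \<in> A then \<phi> (m a b) else 0) else 0) else 0)"

definition ideal_in_bidual :: "'a::complex_vector set \<Rightarrow> ('a \<Rightarrow> real) \<Rightarrow> ('a \<Rightarrow> 'a \<Rightarrow> 'a) \<Rightarrow> bool"
  where "ideal_in_bidual A N m \<longleftrightarrow>
    ideal_of (bidual_embedding A N ` A) (bidual A N) (arens_product A N m)"

definition operator_algebra_on ::
    "'a::complex_vector set \<Rightarrow> ('a \<Rightarrow> real) \<Rightarrow> ('a \<Rightarrow> 'a) set \<Rightarrow> bool"
  where "operator_algebra_on H N A \<longleftrightarrow> hilbert_space_on H N \<and>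
    subalgebra_of A (bounded_ops H N H N) (\<circ>) \<and>
    closedin (norm_topology (bounded_ops H N H N) (op_norm H N N)) A"


section \<open>Classes of measurable functions on the half-line\<close>

definition half_line :: "real measure"
  where "half_line = restrict_space lborel {0..}"

definition ae_eq :: "(real \<Rightarrow> complex) \<Rightarrow> (real \<Rightarrow> complex) \<Rightarrow> bool"
  where "ae_eq f g \<longleftrightarrow> f \<in> borel_measurable half_line \<and> g \<in> borel_measurable half_line \<and>
    (AE t in half_line. f t = g t)"

text \<open>
  The values of a representative on the negative reals are ignored.  Every class of Lebesgue
  measurable functions has a Borel representative, so Borel measurability loses nothing.
\<close>

quotient_type mfun = "real \<Rightarrow> complex" / partial: ae_eq
proof (rule part_equivpI)
  show "\<exists>f. ae_eq f f"
    by (rule exI[of _ "\<lambda>_. 0"]) (simp add: ae_eq_def)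
  show "symp ae_eq"
    by (rule sympI) (auto simp: ae_eq_def)
  show "transp ae_eq"
    by (rule transpI) (auto simp: ae_eq_def)
qed

instantiation mfun :: complex_vector
begin

lift_definition zero_mfun :: mfun is "\<lambda>_. 0"
  by (simp add: ae_eq_def)

lift_definition plus_mfun :: "mfun \<Rightarrow> mfun \<Rightarrow> mfun" is "\<lambda>f g t. f t + g t"
  by (auto simp: ae_eq_def)

lift_definition minus_mfun :: "mfun \<Rightarrow> mfun \<Rightarrow> mfun" is "\<lambda>f g t. f t - g t"
  by (auto simp: ae_eq_def)

lift_definition uminus_mfun :: "mfun \<Rightarrow> mfun" is "\<lambda>f t. - f t"
  by (auto simp: ae_eq_def)

lift_definition scaleC_mfun :: "complex \<Rightarrow> mfun \<Rightarrow> mfun" is "\<lambda>c f t. c * f t"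
  by (auto simp: ae_eq_def)

instance
  by standard (transfer, auto simp: ae_eq_def algebra_simps)+

end

lift_definition mfun_Lp_integral :: "(real \<Rightarrow> real) \<Rightarrow> real \<Rightarrow> mfun \<Rightarrow> ennreal"
  is "\<lambda>\<omega> p f. \<integral>\<^sup>+ t. ennreal (cmod (f t) powr p * \<omega> t powr p) \<partial>half_line"
  by (rule nn_integral_cong_AE) (auto simp: ae_eq_def)

definition Lp_space :: "(real \<Rightarrow> real) \<Rightarrow> real \<Rightarrow> mfun set"
  where "Lp_space \<omega> p = {f. mfun_Lp_integral \<omega> p f < \<infinity>}"

definition Lp_norm :: "(real \<Rightarrow> real) \<Rightarrow> real \<Rightarrow> mfun \<Rightarrow> real"
  where "Lp_norm \<omega> p f = enn2real (mfun_Lp_integral \<omega> p f) powr (1 / p)"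

lemma AE_half_line_iff: "(AE t in half_line. P t) \<longleftrightarrow> (AE t in lborel. 0 \<le> t \<longrightarrow> P t)"
  unfolding half_line_def by (subst AE_restrict_space_iff) auto

lemma measurable_half_line_iff:
  fixes f :: "real \<Rightarrow> complex"
  shows "f \<in> borel_measurable half_line \<longleftrightarrow> (\<lambda>t. indicator {0..} t *\<^sub>R f t) \<in> borel_measurable borel"
  unfolding half_line_def by (subst borel_measurable_restrict_space_iff) auto

text \<open>
  For \<open>f\<close> in \<open>L\<^sup>1(\<omega>)\<close> and \<open>g\<close> in \<open>L\<^sup>2(\<omega>)\<close>, with \<open>\<omega>\<close> a weight, the integral below exists for
  almost all \<open>t\<close>.
\<close>

lift_definition convolution :: "mfun \<Rightarrow> mfun \<Rightarrow> mfun"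
  is "\<lambda>f g t. LINT s:{0..t}|lborel. f (t - s) * g s"
proof -
  fix f f' g g' :: "real \<Rightarrow> complex"
  assume f: "ae_eq f f'" and g: "ae_eq g g'"
  have meas: "(\<lambda>t. LINT s:{0..t}|lborel. u (t - s) * v s) \<in> borel_measurable half_line"
    if u: "u \<in> borel_measurable half_line" and v: "v \<in> borel_measurable half_line"
    for u v :: "real \<Rightarrow> complex"
  proof -
    define U where "U t = indicator {0..} t *\<^sub>R u t" for t :: real
    define V where "V t = indicator {0..} t *\<^sub>R v t" for t :: real
    have [measurable]: "U \<in> borel_measurable borel" "V \<in> borel_measurable borel"
      using u v unfolding measurable_half_line_iff U_def V_def by auto
    have eq: "(\<lambda>t. LINT s:{0..t}|lborel. u (t - s) * v s) = (\<lambda>t. LINT s|lborel. U (t - s) * V s)"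
      unfolding set_lebesgue_integral_def U_def V_def
      by (intro ext Bochner_Integration.integral_cong) (auto simp: indicator_def)
    have "(\<lambda>t. LINT s|lborel. U (t - s) * V s) \<in> borel_measurable borel"
      by measurable
    then show ?thesis
      unfolding eq half_line_def by (intro measurable_restrict_space1) simp
  qed
  have "(LINT s:{0..t}|lborel. f (t - s) * g s) = (LINT s:{0..t}|lborel. f' (t - s) * g' s)" for t
  proof -
    define F where "F r = indicator {0..} r *\<^sub>R f r" for r :: real
    define F' where "F' r = indicator {0..} r *\<^sub>R f' r" for r :: real
    define G where "G r = indicator {0..} r *\<^sub>R g r" for r :: real
    define G' where "G' r = indicator {0..} r *\<^sub>R g' r" for r :: real
    have [measurable]: "F \<in> borel_measurable borel" "F' \<in> borel_measurable borel"
      "G \<in> borel_measurable borel" "G' \<in> borel_measurable borel"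
      using f g unfolding ae_eq_def measurable_half_line_iff F_def F'_def G_def G'_def by auto
    have FF: "AE r in lborel. F r = F' r"
      using f unfolding ae_eq_def AE_half_line_iff F_def F'_def
      by (auto simp: indicator_def elim: eventually_mono)
    have GG: "AE r in lborel. G r = G' r"
      using g unfolding ae_eq_def AE_half_line_iff G_def G'_def
      by (auto simp: indicator_def elim: eventually_mono)
    have "AE s in lborel. F (t - s) = F' (t - s)"
    proof -
      have "AE s in lborel. F (t + (- 1) * s) = F' (t + (- 1) * s)"
        by (rule AE_borel_affine[OF _ _ FF]) measurable
      then show ?thesis by simp
    qed
    then have "(LINT s|lborel. F (t - s) * G s) = (LINT s|lborel. F' (t - s) * G' s)"
      using GG by (intro integral_cong_AE) auto
    moreover have "(LINT s:{0..t}|lborel. f (t - s) * g s) = (LINT s|lborel. F (t - s) * G s)"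
      unfolding set_lebesgue_integral_def F_def G_def
      by (intro Bochner_Integration.integral_cong) (auto simp: indicator_def)
    moreover have "(LINT s:{0..t}|lborel. f' (t - s) * g' s) = (LINT s|lborel. F' (t - s) * G' s)"
      unfolding set_lebesgue_integral_def F'_def G'_def
      by (intro Bochner_Integration.integral_cong) (auto simp: indicator_def)
    ultimately show ?thesis by simp
  qed
  then show "ae_eq (\<lambda>t. LINT s:{0..t}|lborel. f (t - s) * g s)
      (\<lambda>t. LINT s:{0..t}|lborel. f' (t - s) * g' s)"
    using f g by (simp add: ae_eq_def meas)
qed


section \<open>The algebra \<open>\<A>(\<omega>)\<close>\<close>

definition conv_op :: "(real \<Rightarrow> real) \<Rightarrow> mfun \<Rightarrow> mfun \<Rightarrow> mfun"
  where "conv_op \<omega> f = (\<lambda>g. if g \<in> Lp_space \<omega> 2 then convolution f g else 0)"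

definition L2_ops :: "(real \<Rightarrow> real) \<Rightarrow> (mfun \<Rightarrow> mfun) set"
  where "L2_ops \<omega> = bounded_ops (Lp_space \<omega> 2) (Lp_norm \<omega> 2) (Lp_space \<omega> 2) (Lp_norm \<omega> 2)"

definition L2_op_norm :: "(real \<Rightarrow> real) \<Rightarrow> (mfun \<Rightarrow> mfun) \<Rightarrow> real"
  where "L2_op_norm \<omega> = op_norm (Lp_space \<omega> 2) (Lp_norm \<omega> 2) (Lp_norm \<omega> 2)"

definition conv_algebra :: "(real \<Rightarrow> real) \<Rightarrow> (mfun \<Rightarrow> mfun) set"
  where "conv_algebra \<omega> =
    norm_topology (L2_ops \<omega>) (L2_op_norm \<omega>) closure_of (conv_op \<omega> ` Lp_space \<omega> 1)"

end

theory Submission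
  imports Defs
begin

text \<open>
  The growth condition gives \<open>\<omega>(r + s) \<le> C (e\<^bsup>-r/2\<^esup> + e\<^bsup>-s/2\<^esup>) \<omega>(r) \<omega>(s)\<close>.  By Young's and the
  Cauchy--Schwarz inequality, convolution therefore maps \<open>L\<^sup>2(\<omega>) \<times> L\<^sup>2(\<omega>)\<close> boundedly into
  \<open>L\<^sup>2(\<omega>)\<close>, and \<open>\<A>(\<omega>)\<close> is the closure of the multiplication operators \<open>J h\<close> with \<open>h\<close> in the
  Hilbert space \<open>H = L\<^sup>2(\<omega>)\<close>.

  For \<open>x\<close> in \<open>\<A>(\<omega>)\<close> we have \<open>x \<circ> J h = J (x h)\<close>, so multiplication by \<open>J h\<close> factors through \<open>H\<close> and is
  weakly compact; by density its second adjoint maps the bidual into the algebra for every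
  multiplier, which gives the ideal property and, with the Banach--Alaoglu theorem, weak compactness.

  The functions \<open>p n = t\<^sup>n / n!\<close> satisfy \<open>p n * p m = p (n + m + 1)\<close> and span a dense subspace of \<open>H\<close>
  because \<open>\<omega>\<close> decays faster than every exponential.  Hence convolution is commutative and associative
  on \<open>H\<close>, \<open>J (p 0)\<close> generates the algebra, and the algebra is quasinilpotent since
  \<open>J (p 0)\<^sup>n = J (p (n - 1))\<close> is small.  A reflexive algebra would contain a cluster point of the
  approximate unit \<open>n 1\<^bsub>[0,1/n]\<^esub>\<close>, that is, a unit.  Compactness fails because \<open>\<omega>\<close> is constant on
  \<open>[n, n + 1)\<close>: the functions \<open>1\<^bsub>[n,n+1)\<^esub> / \<omega>(n)\<close> have norm 1 in \<open>L\<^sup>1(\<omega>)\<close>, while their products with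
  \<open>J (p 0)\<^sup>2\<close> stay uniformly apart.
\<close>

section \<open>Normed spaces given by a carrier\<close>

text \<open>Elements of the algebra are limits of operators and need not be functions, and a product
  of functions is an integral that exists only almost everywhere. Algebraic identities are therefore
  checked on the monomials, where convolution is a beta integral, and are carried on by continuity;
  limits enter only through the multiplier identity \<open>A_J\<close>.

  The weight inequality comes from a(n+k) >= (2^k / \<epsilon> 1) a(k) a(n) for n, k >= 1, with
  \<epsilon> n replaced by the larger \<epsilon> 1, and 2^k dominates exp(k/2). If one argument is
  below 1, only submultiplicativity is available; then one of the two exponentials is at least 1/2,
  which is why their sum appears. The function exp(-s/2) has norm 1 in L2 of the half-line, so
  damping by it turns an L2 function into an L1 function, and Young's inequality applies.

  Duality is reduced to the Hilbert space as well: functionals x -> <x z, y> compute norms and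
  separate points, and a second adjoint is found by applying the Riesz theorem once to an element of
  the bidual and once to a functional on the algebra.\<close>

locale cnormed =
  fixes V :: "'a::complex_vector set" and N :: "'a \<Rightarrow> real"
  assumes normed: "normed_space_on V N"
begin

lemma sub: "csubspace V"
  using normed unfolding normed_space_on_def by blast

lemma zero_mem [simp]: "0 \<in> V"
  using complex_vector.subspace_0[OF sub] .

lemma add_mem [simp]: "x \<in> V \<Longrightarrow> y \<in> V \<Longrightarrow> x + y \<in> V"
  using complex_vector.subspace_add[OF sub] .

lemma diff_mem [simp]: "x \<in> V \<Longrightarrow> y \<in> V \<Longrightarrow> x - y \<in> V"
  using complex_vector.subspace_diff[OF sub] .

lemma scale_mem [simp]: "x \<in> V \<Longrightarrow> c *\<^sub>C x \<in> V"
  using complex_vector.subspace_scale[OF sub] .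

lemma N_nonneg [simp]: "x \<in> V \<Longrightarrow> 0 \<le> N x"
  using normed unfolding normed_space_on_def by blast

lemma N_eq_0 [simp]: "x \<in> V \<Longrightarrow> N x = 0 \<longleftrightarrow> x = 0"
  using normed unfolding normed_space_on_def by blast

lemma N_0 [simp]: "N 0 = 0"
  by simp

lemma N_triangle: "x \<in> V \<Longrightarrow> y \<in> V \<Longrightarrow> N (x + y) \<le> N x + N y"
  using normed unfolding normed_space_on_def by blast

lemma N_scale [simp]: "x \<in> V \<Longrightarrow> N (c *\<^sub>C x) = cmod c * N x"
  using normed unfolding normed_space_on_def by blast

lemma N_diff_commute: "x \<in> V \<Longrightarrow> y \<in> V \<Longrightarrow> N (x - y) = N (y - x)"
  using N_scale[of "x - y" "- 1"] by simp

lemma N_diff_triangle: "x \<in> V \<Longrightarrow> y \<in> V \<Longrightarrow> z \<in> V \<Longrightarrow> N (x - z) \<le> N (x - y) + N (y - z)"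
  using N_triangle[of "x - y" "y - z"] by simp

lemma N_le_diff: "x \<in> V \<Longrightarrow> y \<in> V \<Longrightarrow> N x \<le> N (x - y) + N y"
  using N_triangle[of "x - y" y] by simp

lemma N_tendsto:
  assumes "\<And>n. x n \<in> V" "l \<in> V" "(\<lambda>n. N (x n - l)) \<longlonglongrightarrow> 0"
  shows "(\<lambda>n. N (x n)) \<longlonglongrightarrow> N l"
proof (rule LIM_zero_cancel, rule Lim_null_comparison[OF _ assms(3)])
  have "\<bar>N (x n) - N l\<bar> \<le> N (x n - l)" for n
    using N_le_diff[OF assms(1,2), of n] N_le_diff[OF assms(2,1), of n]
      N_diff_commute[OF assms(2,1), of n] by linarith
  then show "\<forall>\<^sub>F n in sequentially. norm (N (x n) - N l) \<le> N (x n - l)"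
    by simp
qed

lemma lim_unique:
  assumes "\<And>n. x n \<in> V" "l \<in> V" "l' \<in> V" "(\<lambda>n. N (x n - l)) \<longlonglongrightarrow> 0" "(\<lambda>n. N (x n - l')) \<longlonglongrightarrow> 0"
  shows "l = l'"
proof -
  have "(\<lambda>n. N (x n - l) + N (x n - l')) \<longlonglongrightarrow> 0"
    using tendsto_add[OF assms(4,5)] by simp
  then have "N (l - l') \<le> 0"
    by (rule LIMSEQ_le_const)
      (use N_diff_triangle[of l "x _" l'] N_diff_commute[of l "x _"] assms in \<open>intro exI allI impI, simp\<close>)
  then show ?thesis
    using N_nonneg[OF diff_mem[OF assms(2,3)]] N_eq_0[OF diff_mem[OF assms(2,3)]] by simp
qed

sublocale M: Metric_space V "norm_dist V N"
  by (rule Metric_space_norm_dist[OF normed])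

lemma topspace_norm [simp]: "topspace (norm_topology V N) = V"
  by (simp add: norm_topology_def)

lemma closure_iff:
  assumes "S \<subseteq> V"
  shows "x \<in> norm_topology V N closure_of S \<longleftrightarrow> x \<in> V \<and> (\<forall>e>0. \<exists>y\<in>S. N (x - y) < e)"
  using assms unfolding norm_topology_def M.metric_closure_of
  by (auto simp: norm_dist_def subset_iff)

lemma closure_seq:
  assumes "S \<subseteq> V" "x \<in> norm_topology V N closure_of S"
  obtains y where "\<And>n. y n \<in> S" "(\<lambda>n. N (y n - x)) \<longlonglongrightarrow> 0"
proof -
  have x: "x \<in> V" "\<And>e. e > 0 \<Longrightarrow> \<exists>y\<in>S. N (x - y) < e"
    using assms by (auto simp: closure_iff)
  have "\<forall>n. \<exists>y\<in>S. N (x - y) < 1 / real (Suc n)"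
    using x(2) by simp
  then obtain y where y: "\<And>n. y n \<in> S" "\<And>n. N (x - y n) < 1 / real (Suc n)"
    by metis
  have "(\<lambda>n. N (y n - x)) \<longlonglongrightarrow> 0"
  proof (rule Lim_null_comparison[OF _ LIMSEQ_inverse_real_of_nat])
    show "\<forall>\<^sub>F n in sequentially. norm (N (y n - x)) \<le> inverse (real (Suc n))"
      using y x assms(1) N_diff_commute[of x "y _"]
      by (intro always_eventually allI) (simp add: subset_iff less_imp_le inverse_eq_divide)
  qed
  then show ?thesis using that y by blast
qed

lemma closedin_iff:
  "closedin (norm_topology V N) S \<longleftrightarrow> S \<subseteq> V \<and> (\<forall>x\<in>V. (\<forall>e>0. \<exists>y\<in>S. N (x - y) < e) \<longrightarrow> x \<in> S)"
proof (cases "S \<subseteq> V")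
  case True
  have "closedin (norm_topology V N) S \<longleftrightarrow> norm_topology V N closure_of S \<subseteq> S"
    using closure_of_subset[of S "norm_topology V N"] True closure_of_eq[of "norm_topology V N" S]
    by (metis topspace_norm subset_antisym order_refl)
  then show ?thesis
    using True closure_iff[OF True] by auto
qed (metis closedin_subset topspace_norm)

lemma closed_lim:
  assumes "closedin (norm_topology V N) S" "\<And>n. x n \<in> S" "l \<in> V" "(\<lambda>n. N (x n - l)) \<longlonglongrightarrow> 0"
  shows "l \<in> S"
proof -
  have sub: "S \<subseteq> V" using assms(1) by (simp add: closedin_iff)
  have "\<exists>y\<in>S. N (l - y) < e" if "e > 0" for e
  proof -
    have "\<forall>\<^sub>F n in sequentially. N (x n - l) < e"
      using order_tendstoD(2)[OF assms(4) that] .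
    then obtain n where "N (x n - l) < e"
      by (auto simp: eventually_sequentially)
    moreover have "x n \<in> V" using assms(2) sub by blast
    ultimately show ?thesis
      using assms(2,3) N_diff_commute[of l "x n"] by (intro bexI[of _ "x n"]) simp_all
  qed
  then show ?thesis using assms(1,3) by (auto simp: closedin_iff)
qed

lemma closedinI_seq:
  assumes "S \<subseteq> V" "\<And>x l. (\<And>n. x n \<in> S) \<Longrightarrow> l \<in> V \<Longrightarrow> (\<lambda>n. N (x n - l)) \<longlonglongrightarrow> 0 \<Longrightarrow> l \<in> S"
  shows "closedin (norm_topology V N) S"
proof -
  have "norm_topology V N closure_of S \<subseteq> S"
  proof
    fix x assume x: "x \<in> norm_topology V N closure_of S"
    then obtain y where "\<And>n. y n \<in> S" "(\<lambda>n. N (y n - x)) \<longlonglongrightarrow> 0"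
      using closure_seq[OF assms(1)] by blast
    then show "x \<in> S" using assms(2)[of y x] x closure_iff[OF assms(1)] by blast
  qed
  then show ?thesis
    using closure_of_subset[of S "norm_topology V N"] assms(1)
    by (simp flip: closure_of_eq add: subset_antisym)
qed

text \<open>\<open>norm_dist\<close> is 0 off the carrier, so Cauchy sequences and limits have to
  carry membership in \<open>V\<close> explicitly. Completeness is proved and applied only in this
  form below.\<close>

lemma banach_iff:
  "banach_space_on V N \<longleftrightarrow> (\<forall>x. (\<forall>n. x n \<in> V) \<and> (\<forall>e>0. \<exists>k. \<forall>m\<ge>k. \<forall>n\<ge>k. N (x m - x n) < e) \<longrightarrow>
    (\<exists>l\<in>V. (\<lambda>n. N (x n - l)) \<longlonglongrightarrow> 0))"
proof -
  have C: "M.MCauchy x \<longleftrightarrow> (\<forall>n. x n \<in> V) \<and> (\<forall>e>0. \<exists>k. \<forall>m\<ge>k. \<forall>n\<ge>k. N (x m - x n) < e)"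
    for x :: "nat \<Rightarrow> 'a"
    unfolding M.MCauchy_def by (auto simp: norm_dist_def image_subset_iff)
  have L: "limitin M.mtopology x l sequentially \<longleftrightarrow> l \<in> V \<and> (\<lambda>n. N (x n - l)) \<longlonglongrightarrow> 0"
    if "\<forall>n. x n \<in> V" for x :: "nat \<Rightarrow> 'a" and l
    using that unfolding M.limitin_metric_dist_null by (auto simp: norm_dist_def)
  show ?thesis
  proof
    assume b: "banach_space_on V N"
    show "\<forall>x. (\<forall>n. x n \<in> V) \<and> (\<forall>e>0. \<exists>k. \<forall>m\<ge>k. \<forall>n\<ge>k. N (x m - x n) < e) \<longrightarrow>
        (\<exists>l\<in>V. (\<lambda>n. N (x n - l)) \<longlonglongrightarrow> 0)"
    proof (intro allI impI)
      fix x :: "nat \<Rightarrow> 'a" assume x: "(\<forall>n. x n \<in> V) \<and> (\<forall>e>0. \<exists>k. \<forall>m\<ge>k. \<forall>n\<ge>k. N (x m - x n) < e)"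
      then have "M.MCauchy x" unfolding C .
      then obtain l where "limitin M.mtopology x l sequentially"
        using b unfolding banach_space_on_def M.mcomplete_def by blast
      then show "\<exists>l\<in>V. (\<lambda>n. N (x n - l)) \<longlonglongrightarrow> 0"
        unfolding L[OF conjunct1[OF x]] by blast
    qed
  next
    assume *: "\<forall>x. (\<forall>n. x n \<in> V) \<and> (\<forall>e>0. \<exists>k. \<forall>m\<ge>k. \<forall>n\<ge>k. N (x m - x n) < e) \<longrightarrow>
        (\<exists>l\<in>V. (\<lambda>n. N (x n - l)) \<longlonglongrightarrow> 0)"
    have "\<exists>l. limitin M.mtopology x l sequentially" if "M.MCauchy x" for x
    proof -
      have x: "(\<forall>n. x n \<in> V) \<and> (\<forall>e>0. \<exists>k. \<forall>m\<ge>k. \<forall>n\<ge>k. N (x m - x n) < e)"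
        using that unfolding C .
      then have "\<exists>l\<in>V. (\<lambda>n. N (x n - l)) \<longlonglongrightarrow> 0" by (rule *[rule_format])
      then show ?thesis unfolding L[OF conjunct1[OF x]] by blast
    qed
    then show "banach_space_on V N"
      unfolding banach_space_on_def M.mcomplete_def using normed by blast
  qed
qed

text \<open>A compact set is totally bounded, so every sequence in it has a Cauchy subsequence;
  consecutive terms of that subsequence would come closer than \<open>d\<close>.\<close>

lemma not_compactin_separated:
  assumes "S \<subseteq> V" "\<And>n::nat. x n \<in> S" "d > 0" "\<And>m n. m < n \<Longrightarrow> d \<le> N (x m - x n)"
  shows "\<not> compactin (norm_topology V N) (norm_topology V N closure_of S)"
proof
  assume "compactin (norm_topology V N) (norm_topology V N closure_of S)"
  then have "M.mtotally_bounded (norm_topology V N closure_of S)"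
    unfolding norm_topology_def by (rule M.compactin_imp_mtotally_bounded)
  moreover have "range x \<subseteq> norm_topology V N closure_of S"
    using closure_of_subset[of S "norm_topology V N"] assms by auto
  ultimately obtain r where r: "strict_mono r" "M.MCauchy (x \<circ> r)"
    unfolding M.mtotally_bounded_sequentially by blast
  from r(2) have "\<forall>e>0. \<exists>k. \<forall>m n. k \<le> m \<longrightarrow> k \<le> n \<longrightarrow> norm_dist V N (x (r m)) (x (r n)) < e"
    unfolding M.MCauchy_def o_def by (rule conjunct2)
  then obtain k where "\<And>m n. k \<le> m \<Longrightarrow> k \<le> n \<Longrightarrow> norm_dist V N (x (r m)) (x (r n)) < d"
    using \<open>d > 0\<close> by blast
  from this[of k "Suc k"] have "norm_dist V N (x (r k)) (x (r (Suc k))) < d" by simp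
  moreover have "x n \<in> V" for n using assms(1,2) by blast
  ultimately have "N (x (r k) - x (r (Suc k))) < d"
    by (simp add: norm_dist_def)
  moreover have "r k < r (Suc k)" using r(1) by (simp add: strict_mono_def)
  then have "d \<le> N (x (r k) - x (r (Suc k)))" by (rule assms(4))
  ultimately show False by simp
qed

end

lemma banach_closed_subspace:
  assumes "banach_space_on V N" "closedin (norm_topology V N) S" "csubspace S"
  shows "banach_space_on S N"
proof -
  interpret cnormed V N
    using assms(1) by unfold_locales (simp add: banach_space_on_def)
  have SV: "S \<subseteq> V" using assms(2) by (simp add: closedin_iff)
  have ns: "normed_space_on S N"
    using normed assms(3) SV unfolding normed_space_on_def by (simp add: subset_iff)
  interpret S: cnormed S N by unfold_locales (rule ns)
  show ?thesis
    unfolding S.banach_iff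
  proof (intro allI impI)
    fix x :: "nat \<Rightarrow> _" assume x: "(\<forall>n. x n \<in> S) \<and> (\<forall>e>0. \<exists>k. \<forall>m\<ge>k. \<forall>n\<ge>k. N (x m - x n) < e)"
    from x have "\<forall>n. x n \<in> V" using SV by (simp add: subset_iff)
    from assms(1)[unfolded banach_iff, rule_format, OF conjI[OF this conjunct2[OF x]]]
    obtain l where l: "l \<in> V" "(\<lambda>n. N (x n - l)) \<longlonglongrightarrow> 0" by blast
    have "l \<in> S" by (rule closed_lim[OF assms(2) _ l]) (simp add: x)
    then show "\<exists>l\<in>S. (\<lambda>n. N (x n - l)) \<longlonglongrightarrow> 0"
      using l by blast
  qed
qed

section \<open>Bounded operators\<close>

locale cnormed_pair = A: cnormed V N + B: cnormed W M
  for V :: "'a::complex_vector set" and N and W :: "'b::complex_vector set" and M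
begin

lemma bounded_opsI:
  assumes "\<And>x. x \<in> V \<Longrightarrow> T x \<in> W" "\<And>x y. x \<in> V \<Longrightarrow> y \<in> V \<Longrightarrow> T (x + y) = T x + T y"
    "\<And>c x. x \<in> V \<Longrightarrow> T (c *\<^sub>C x) = c *\<^sub>C T x" "\<And>x. x \<in> V \<Longrightarrow> M (T x) \<le> C * N x"
    "\<And>x. x \<notin> V \<Longrightarrow> T x = 0"
  shows "T \<in> bounded_ops V N W M"
  using assms unfolding bounded_ops_def clinear_on_def mem_Collect_eq
  by (intro conjI ballI allI impI exI[of _ C]) simp_all

lemma op_mem: "T \<in> bounded_ops V N W M \<Longrightarrow> x \<in> V \<Longrightarrow> T x \<in> W"
  by (simp add: bounded_ops_def)

lemma op_add: "T \<in> bounded_ops V N W M \<Longrightarrow> x \<in> V \<Longrightarrow> y \<in> V \<Longrightarrow> T (x + y) = T x + T y"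
  by (simp add: bounded_ops_def clinear_on_def)

lemma op_scale: "T \<in> bounded_ops V N W M \<Longrightarrow> x \<in> V \<Longrightarrow> T (c *\<^sub>C x) = c *\<^sub>C T x"
  by (simp add: bounded_ops_def clinear_on_def)

lemma op_off: "T \<in> bounded_ops V N W M \<Longrightarrow> x \<notin> V \<Longrightarrow> T x = 0"
  by (simp add: bounded_ops_def)

lemma op_0: "T \<in> bounded_ops V N W M \<Longrightarrow> T 0 = 0"
  using op_scale[of T 0 0] by simp

lemma op_diff: "T \<in> bounded_ops V N W M \<Longrightarrow> x \<in> V \<Longrightarrow> y \<in> V \<Longrightarrow> T (x - y) = T x - T y"
  using op_add[of T "x - y" y] by simp

lemma op_bound_pos:
  assumes "T \<in> bounded_ops V N W M"
  obtains C where "C \<ge> 0" "\<And>x. x \<in> V \<Longrightarrow> M (T x) \<le> C * N x"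
proof -
  obtain C where C: "\<And>x. x \<in> V \<Longrightarrow> M (T x) \<le> C * N x"
    using assms unfolding bounded_ops_def by blast
  have "M (T x) \<le> \<bar>C\<bar> * N x" if "x \<in> V" for x
    using C[OF that] mult_right_mono[OF abs_ge_self A.N_nonneg[OF that], of C] by linarith
  then show ?thesis using that[of "\<bar>C\<bar>"] by simp
qed

lemma op_norm_bdd:
  assumes "T \<in> bounded_ops V N W M"
  shows "bdd_above ((\<lambda>x. M (T x)) ` {x\<in>V. N x \<le> 1})"
proof -
  obtain C where C: "C \<ge> 0" "\<And>x. x \<in> V \<Longrightarrow> M (T x) \<le> C * N x"
    using op_bound_pos[OF assms] by blast
  have "M (T x) \<le> C" if "x \<in> V" "N x \<le> 1" for x
    using C(2)[OF that(1)] mult_left_mono[OF that(2) C(1)] by simp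
  then show ?thesis by (intro bdd_aboveI[of _ C]) auto
qed

lemma op_norm_bound:
  assumes "T \<in> bounded_ops V N W M" "x \<in> V"
  shows "M (T x) \<le> op_norm V N M T * N x"
proof (cases "x = 0")
  case True then show ?thesis by (simp add: op_0[OF assms(1)])
next
  case False
  then have pos: "N x > 0" using assms(2) A.N_nonneg[of x] A.N_eq_0[of x] by linarith
  define y where "y = complex_of_real (1 / N x) *\<^sub>C x"
  have y: "y \<in> V" "N y \<le> 1" using assms(2) pos by (auto simp: y_def norm_divide)
  have "M (T y) \<le> op_norm V N M T"
    unfolding op_norm_def using y by (intro cSUP_upper op_norm_bdd[OF assms(1)]) simp
  moreover have "M (T y) = M (T x) / N x"
    unfolding y_def using op_scale[OF assms] op_mem[OF assms] pos by (simp add: norm_divide)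
  ultimately show ?thesis using pos by (simp add: field_simps)
qed

lemma op_norm_le:
  assumes "C \<ge> 0" "\<And>x. x \<in> V \<Longrightarrow> M (T x) \<le> C * N x"
  shows "op_norm V N M T \<le> C"
  unfolding op_norm_def
proof (rule cSUP_least)
  have "0 \<in> {x \<in> V. N x \<le> 1}" by simp
  then show "{x \<in> V. N x \<le> 1} \<noteq> {}" by blast
  show "M (T x) \<le> C" if "x \<in> {x \<in> V. N x \<le> 1}" for x
    using assms(2)[of x] mult_left_mono[of "N x" 1 C] assms(1) that by simp
qed

lemma op_norm_nonneg: "T \<in> bounded_ops V N W M \<Longrightarrow> 0 \<le> op_norm V N M T"
  unfolding op_norm_def
  by (rule cSUP_upper2[OF op_norm_bdd, of _ 0]) (simp_all add: op_0)

lemma subspace_ops: "csubspace (bounded_ops V N W M)"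
proof (rule complex_vector.subspaceI)
  show "0 \<in> bounded_ops V N W M"
    by (rule bounded_opsI[of _ 0]) simp_all
next
  fix S T assume S: "S \<in> bounded_ops V N W M" and T: "T \<in> bounded_ops V N W M"
  show "S + T \<in> bounded_ops V N W M"
  proof (rule bounded_opsI)
    fix x assume x: "x \<in> V"
    have "M ((S + T) x) \<le> M (S x) + M (T x)"
      using B.N_triangle op_mem x S T by simp
    also have "\<dots> \<le> (op_norm V N M S + op_norm V N M T) * N x"
      using op_norm_bound[OF S x] op_norm_bound[OF T x] by (simp add: algebra_simps)
    finally show "M ((S + T) x) \<le> (op_norm V N M S + op_norm V N M T) * N x" .
  qed (use S T in \<open>simp_all add: op_mem op_add op_scale op_off complex_vector.scale_right_distrib\<close>)
next
  fix c T assume T: "T \<in> bounded_ops V N W M"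
  show "c *\<^sub>C T \<in> bounded_ops V N W M"
  proof (rule bounded_opsI)
    fix x assume x: "x \<in> V"
    show "M ((c *\<^sub>C T) x) \<le> (cmod c * op_norm V N M T) * N x"
      using op_norm_bound[OF T x] x op_mem[OF T x]
      by (simp add: scaleC_fun_def mult.assoc mult_left_mono)
  qed (use T in \<open>simp_all add: scaleC_fun_def op_mem op_add op_scale op_off
      complex_vector.scale_right_distrib mult.commute\<close>)
qed

text \<open>Definiteness rests on the convention that operators vanish off \<open>V\<close>: norm 0
  alone forces \<open>T x = 0\<close> only for \<open>x\<close> in \<open>V\<close>.\<close>

lemma normed_ops: "normed_space_on (bounded_ops V N W M) (op_norm V N M)"
  unfolding normed_space_on_def
proof (intro conjI ballI allI)
  show "csubspace (bounded_ops V N W M)" by (rule subspace_ops)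
  fix T assume T: "T \<in> bounded_ops V N W M"
  show "0 \<le> op_norm V N M T" by (rule op_norm_nonneg[OF T])
  show "op_norm V N M T = 0 \<longleftrightarrow> T = 0"
  proof
    assume 0: "op_norm V N M T = 0"
    show "T = 0"
    proof
      fix x show "T x = 0 x"
      proof (cases "x \<in> V")
        case True
        then show ?thesis
          using op_norm_bound[OF T True] 0 B.N_nonneg[OF op_mem[OF T True]]
            B.N_eq_0[OF op_mem[OF T True]] by simp
      qed (simp add: op_off[OF T])
    qed
  next
    assume "T = 0" then show "op_norm V N M T = 0"
      using op_norm_nonneg[OF T] op_norm_le[of 0 T] by simp
  qed
  fix S assume S: "S \<in> bounded_ops V N W M"
  show "op_norm V N M (T + S) \<le> op_norm V N M T + op_norm V N M S"
  proof (rule op_norm_le)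
    fix x assume x: "x \<in> V"
    have "M ((T + S) x) \<le> M (T x) + M (S x)"
      using B.N_triangle op_mem x S T by simp
    also have "\<dots> \<le> (op_norm V N M T + op_norm V N M S) * N x"
      using op_norm_bound[OF S x] op_norm_bound[OF T x] by (simp add: algebra_simps)
    finally show "M ((T + S) x) \<le> (op_norm V N M T + op_norm V N M S) * N x" .
  qed (use S T op_norm_nonneg in auto)
next
  fix c T assume T: "T \<in> bounded_ops V N W M"
  have le: "op_norm V N M (c *\<^sub>C T) \<le> cmod c * op_norm V N M T"
    if T: "T \<in> bounded_ops V N W M" for c T
  proof (rule op_norm_le)
    show "0 \<le> cmod c * op_norm V N M T" using op_norm_nonneg[OF T] by simp
    show "M ((c *\<^sub>C T) x) \<le> (cmod c * op_norm V N M T) * N x" if "x \<in> V" for x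
      using op_norm_bound[OF T that] that op_mem[OF T that]
      by (simp add: scaleC_fun_def mult.assoc mult_left_mono)
  qed
  show "op_norm V N M (c *\<^sub>C T) = cmod c * op_norm V N M T"
  proof (cases "c = 0")
    case True
    then show ?thesis
      using le[OF T, of c] op_norm_nonneg[OF complex_vector.subspace_scale[OF subspace_ops T, of c]] by simp
  next
    case False
    \<comment> \<open>The reverse inequality is the inequality \<open>le\<close> for the scalar
      \<open>inverse c\<close> and the operator \<open>c *\<^sub>C T\<close>.\<close>
    have "op_norm V N M (inverse c *\<^sub>C c *\<^sub>C T) \<le> cmod (inverse c) * op_norm V N M (c *\<^sub>C T)"
      by (rule le[OF complex_vector.subspace_scale[OF subspace_ops T]])
    then have "cmod c * op_norm V N M T \<le> op_norm V N M (c *\<^sub>C T)"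
      using False by (simp add: norm_divide field_simps)
    then show ?thesis using le[OF T, of c] by simp
  qed
qed

sublocale ops: cnormed "bounded_ops V N W M" "op_norm V N M"
  by unfold_locales (rule normed_ops)

lemma op_norm_diff_bound:
  assumes "S \<in> bounded_ops V N W M" "T \<in> bounded_ops V N W M" "x \<in> V"
  shows "M (S x - T x) \<le> op_norm V N M (S - T) * N x"
  using op_norm_bound[OF ops.diff_mem[OF assms(1,2)] assms(3)] by simp

lemma op_lim:
  assumes "\<And>n. S n \<in> bounded_ops V N W M" "T \<in> bounded_ops V N W M"
    "(\<lambda>n. op_norm V N M (S n - T)) \<longlonglongrightarrow> 0" "x \<in> V"
  shows "(\<lambda>n. M (S n x - T x)) \<longlonglongrightarrow> 0"
proof (rule Lim_null_comparison)
  show "\<forall>\<^sub>F n in sequentially. norm (M (S n x - T x)) \<le> op_norm V N M (S n - T) * N x"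
    using op_norm_diff_bound[OF assms(1,2,4)] assms op_mem by (intro always_eventually) simp
  show "(\<lambda>n. op_norm V N M (S n - T) * N x) \<longlonglongrightarrow> 0"
    using tendsto_mult_right[OF assms(3), of "N x"] by simp
qed

lemma op_cont:
  assumes "T \<in> bounded_ops V N W M" "\<And>n. x n \<in> V" "l \<in> V" "(\<lambda>n. N (x n - l)) \<longlonglongrightarrow> 0"
  shows "(\<lambda>n. M (T (x n) - T l)) \<longlonglongrightarrow> 0"
proof (rule Lim_null_comparison)
  show "\<forall>\<^sub>F n in sequentially. norm (M (T (x n) - T l)) \<le> op_norm V N M T * N (x n - l)"
    using op_norm_bound[OF assms(1), of "x _ - l"] assms op_mem[OF assms(1)]
    by (intro always_eventually) (simp add: op_diff)
  show "(\<lambda>n. op_norm V N M T * N (x n - l)) \<longlonglongrightarrow> 0"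
    using tendsto_mult_left[OF assms(4)] by simp
qed

text \<open>The limit is formed pointwise in \<open>W\<close>. The estimate \<open>near\<close>,
  uniform on bounded sets, then yields both its boundedness and convergence in operator
  norm.\<close>

lemma banach_ops:
  assumes "banach_space_on W M"
  shows "banach_space_on (bounded_ops V N W M) (op_norm V N M)"
  unfolding ops.banach_iff
proof (intro allI impI)
  fix X :: "nat \<Rightarrow> 'a \<Rightarrow> 'b" assume "(\<forall>n. X n \<in> bounded_ops V N W M) \<and>
    (\<forall>e>0. \<exists>k. \<forall>m\<ge>k. \<forall>n\<ge>k. op_norm V N M (X m - X n) < e)"
  then have X: "\<And>n. X n \<in> bounded_ops V N W M"
    and C: "\<And>e. e > 0 \<Longrightarrow> \<exists>k. \<forall>m\<ge>k. \<forall>n\<ge>k. op_norm V N M (X m - X n) < e" by auto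
  have Xb: "M (X m x - X n x) \<le> op_norm V N M (X m - X n) * N x" if "x \<in> V" for m n x
    using op_norm_diff_bound[OF X X that] .
  have "\<exists>l\<in>W. (\<lambda>n. M (X n x - l)) \<longlonglongrightarrow> 0" if x: "x \<in> V" for x
  proof -
    have "\<exists>k. \<forall>m\<ge>k. \<forall>n\<ge>k. M (X m x - X n x) < e" if e: "e > 0" for e
    proof -
      \<comment> \<open>The summand 1 keeps the divisor positive when \<open>x = 0\<close>.\<close>
      obtain k where k: "\<forall>m\<ge>k. \<forall>n\<ge>k. op_norm V N M (X m - X n) < e / (N x + 1)"
        using C[of "e / (N x + 1)"] e x A.N_nonneg[OF x] by (auto simp: add_nonneg_pos)
      have "M (X m x - X n x) < e" if "m \<ge> k" "n \<ge> k" for m n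
      proof -
        have "M (X m x - X n x) \<le> op_norm V N M (X m - X n) * N x" by (rule Xb[OF x])
        also have "\<dots> \<le> e / (N x + 1) * N x"
          using k that x by (intro mult_right_mono) (auto simp: less_imp_le)
        also have "\<dots> < e" using e A.N_nonneg[OF x] by (simp add: field_simps)
        finally show ?thesis .
      qed
      then show ?thesis by blast
    qed
    then show ?thesis
      using assms[unfolded B.banach_iff, rule_format, of "\<lambda>n. X n x"] op_mem[OF X x] by blast
  qed
  then obtain L where L: "\<And>x. x \<in> V \<Longrightarrow> L x \<in> W" "\<And>x. x \<in> V \<Longrightarrow> (\<lambda>n. M (X n x - L x)) \<longlonglongrightarrow> 0"
    by metis
  define T where "T x = (if x \<in> V then L x else 0)" for x
  have Tm: "T x \<in> W" if "x \<in> V" for x using L that by (simp add: T_def)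
  have Tl: "(\<lambda>n. M (X n x - T x)) \<longlonglongrightarrow> 0" if "x \<in> V" for x using L that by (simp add: T_def)
  \<comment> \<open>Fix \<open>n\<close> and let \<open>m\<close> tend to infinity in the bound for
    \<open>X n x - X m x\<close>.\<close>
  have near: "M (X n x - T x) \<le> e * N x"
    if "x \<in> V" "\<And>m. m \<ge> k \<Longrightarrow> op_norm V N M (X n - X m) \<le> e" for n k e x
  proof -
    have l: "(\<lambda>m. M ((X n x - X m x) - (X n x - T x))) \<longlonglongrightarrow> 0"
      using Tl[OF that(1)] B.N_diff_commute[OF Tm[OF that(1)] op_mem[OF X that(1)]] by simp
    have "(\<lambda>m. M (X n x - X m x)) \<longlonglongrightarrow> M (X n x - T x)"
      by (rule B.N_tendsto[OF _ _ l]) (use X op_mem that Tm in auto)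
    then show ?thesis
    proof (rule LIMSEQ_le_const2)
      have "M (X n x - X m x) \<le> e * N x" if "m \<ge> k" for m
        using Xb[of x n m] \<open>x \<in> V\<close> that mult_right_mono[OF \<open>\<And>m. m \<ge> k \<Longrightarrow> op_norm V N M (X n - X m) \<le> e\<close>[OF that], of "N x"]
        by simp
      then show "\<exists>k. \<forall>m\<ge>k. M (X n x - X m x) \<le> e * N x" by blast
    qed
  qed
  obtain k1 where k1: "\<And>m. m \<ge> k1 \<Longrightarrow> op_norm V N M (X k1 - X m) \<le> 1"
    using C[of 1] by (meson less_imp_le order_refl zero_less_one)
  have T: "T \<in> bounded_ops V N W M"
  proof (rule bounded_opsI)
    fix x assume x: "x \<in> V"
    have "M (T x) \<le> M (T x - X k1 x) + M (X k1 x)"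
      using B.N_le_diff Tm X op_mem x by blast
    also have "\<dots> \<le> 1 * N x + op_norm V N M (X k1) * N x"
      using near[OF x k1, of k1] op_norm_bound[OF X x] B.N_diff_commute[OF Tm[OF x] op_mem[OF X x]] by (simp add: add_mono)
    finally show "M (T x) \<le> (1 + op_norm V N M (X k1)) * N x" by (simp add: algebra_simps)
  next
    fix x y assume x: "x \<in> V" and y: "y \<in> V"
    have "(\<lambda>n. M (X n (x + y) - (T x + T y))) \<longlonglongrightarrow> 0"
    proof (rule Lim_null_comparison)
      show "(\<lambda>n. M (X n x - T x) + M (X n y - T y)) \<longlonglongrightarrow> 0"
        using tendsto_add[OF Tl[OF x] Tl[OF y]] by simp
      have "M (X n (x + y) - (T x + T y)) \<le> M (X n x - T x) + M (X n y - T y)" for n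
        using B.N_triangle[of "X n x - T x" "X n y - T y"] x y Tm op_mem[OF X]
        by (simp add: op_add[OF X] algebra_simps)
      then show "\<forall>\<^sub>F n in sequentially. norm (M (X n (x + y) - (T x + T y))) \<le> M (X n x - T x) + M (X n y - T y)"
        using x y Tm op_mem[OF X] by (intro always_eventually) simp
    qed
    then show "T (x + y) = T x + T y"
      using B.lim_unique[OF _ _ _ Tl[of "x + y"]] x y Tm op_mem[OF X] by simp
  next
    fix c x assume x: "x \<in> V"
    have "(\<lambda>n. cmod c * M (X n x - T x)) \<longlonglongrightarrow> 0"
      using tendsto_mult_left[OF Tl[OF x]] by simp
    moreover have "M (X n (c *\<^sub>C x) - c *\<^sub>C T x) = cmod c * M (X n x - T x)" for n
      using B.N_scale[of "X n x - T x" c] x Tm op_mem[OF X]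
      by (simp add: op_scale[OF X] complex_vector.scale_right_diff_distrib)
    ultimately have "(\<lambda>n. M (X n (c *\<^sub>C x) - c *\<^sub>C T x)) \<longlonglongrightarrow> 0" by simp
    then show "T (c *\<^sub>C x) = c *\<^sub>C T x"
      using B.lim_unique[OF _ _ _ Tl[of "c *\<^sub>C x"]] x Tm op_mem[OF X] by simp
  qed (use Tm in \<open>simp_all add: T_def\<close>)
  have "(\<lambda>n. op_norm V N M (X n - T)) \<longlonglongrightarrow> 0"
  proof (rule LIMSEQ_I)
    fix e :: real assume e: "e > 0"
    obtain k where k: "\<forall>m\<ge>k. \<forall>n\<ge>k. op_norm V N M (X m - X n) < e / 2"
      using C[of "e / 2"] e by auto
    have "op_norm V N M (X n - T) \<le> e / 2" if "n \<ge> k" for n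
    proof (rule op_norm_le)
      show "M ((X n - T) x) \<le> e / 2 * N x" if "x \<in> V" for x
        using near[OF that, of k n "e / 2"] k \<open>n \<ge> k\<close> by (simp add: less_imp_le)
    qed (use e in simp)
    then have "norm (op_norm V N M (X n - T) - 0) < e" if "n \<ge> k" for n
      using that e ops.N_nonneg[OF ops.diff_mem[OF X T], of n] by (fastforce intro: le_less_trans)
    then show "\<exists>k. \<forall>n\<ge>k. norm (op_norm V N M (X n - T) - 0) < e" by blast
  qed
  then show "\<exists>l\<in>bounded_ops V N W M. (\<lambda>n. op_norm V N M (X n - l)) \<longlonglongrightarrow> 0"
    using T by blast
qed

end

lemma bounded_ops_comp:
  assumes "cnormed V N" "S \<in> bounded_ops V N V N" "T \<in> bounded_ops V N V N"
  shows "S \<circ> T \<in> bounded_ops V N V N"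
    and "op_norm V N N (S \<circ> T) \<le> op_norm V N N S * op_norm V N N T"
proof -
  interpret cnormed V N by fact
  interpret cnormed_pair V N V N ..
  have b: "N ((S \<circ> T) x) \<le> (op_norm V N N S * op_norm V N N T) * N x" if "x \<in> V" for x
    using op_norm_bound[OF assms(2) op_mem[OF assms(3) that]]
      mult_left_mono[OF op_norm_bound[OF assms(3) that] op_norm_nonneg[OF assms(2)]]
    by (simp add: mult.assoc)
  show "S \<circ> T \<in> bounded_ops V N V N"
    by (rule bounded_opsI[OF _ _ _ b])
      (use assms in \<open>simp_all add: op_mem op_add op_scale op_off op_0\<close>)
  show "op_norm V N N (S \<circ> T) \<le> op_norm V N N S * op_norm V N N T"
    by (rule op_norm_le[OF _ b]) (use assms op_norm_nonneg in auto)
qed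

lemma cnormed_complex: "cnormed (UNIV :: complex set) cmod"
proof
  have "csubspace (UNIV :: complex set)" by (rule complex_vector.subspace_UNIV)
  then show "normed_space_on (UNIV :: complex set) cmod"
    unfolding normed_space_on_def scaleC_complex_def
    by (intro conjI ballI allI) (simp_all add: norm_triangle_ineq norm_mult)
qed

section \<open>Hilbert spaces\<close>

locale chilbert = cnormed H N for H :: "'a::complex_vector set" and N +
  fixes ip :: "'a \<Rightarrow> 'a \<Rightarrow> complex"
  assumes banach: "banach_space_on H N" and inner: "inner_product_on H ip"
    and N_ip: "x \<in> H \<Longrightarrow> N x = sqrt (Re (ip x x))"
begin

lemma ip_add_left: "x \<in> H \<Longrightarrow> y \<in> H \<Longrightarrow> z \<in> H \<Longrightarrow> ip (x + y) z = ip x z + ip y z"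
  using conjunct1[OF inner[unfolded inner_product_on_def]] by simp

lemma ip_scale_left: "x \<in> H \<Longrightarrow> y \<in> H \<Longrightarrow> ip (c *\<^sub>C x) y = c * ip x y"
  using conjunct1[OF conjunct2[OF inner[unfolded inner_product_on_def]]] by simp

lemma ip_commute:
  assumes "x \<in> H" "y \<in> H"
  shows "ip y x = cnj (ip x y)"
proof -
  have "\<forall>x\<in>H. \<forall>y\<in>H. ip y x = cnj (ip x y)"
    using inner unfolding inner_product_on_def by (elim conjE)
  then show ?thesis using assms by metis
qed

lemma ip_add_right: "x \<in> H \<Longrightarrow> y \<in> H \<Longrightarrow> z \<in> H \<Longrightarrow> ip x (y + z) = ip x y + ip x z"
  using ip_commute[of "y + z" x] ip_commute[of y x] ip_commute[of z x] by (simp add: ip_add_left)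

lemma ip_scale_right: "x \<in> H \<Longrightarrow> y \<in> H \<Longrightarrow> ip x (c *\<^sub>C y) = cnj c * ip x y"
  using ip_commute[of "c *\<^sub>C y" x] ip_commute[of y x] by (simp add: ip_scale_left)

lemma ip_diff_left: "x \<in> H \<Longrightarrow> y \<in> H \<Longrightarrow> z \<in> H \<Longrightarrow> ip (x - y) z = ip x z - ip y z"
  using ip_add_left[of "x - y" y z] by simp

lemma N_sq:
  assumes "x \<in> H"
  shows "(N x)\<^sup>2 = Re (ip x x)"
proof -
  have "\<forall>x\<in>H. 0 \<le> Re (ip x x) \<and> (ip x x = 0 \<longleftrightarrow> x = 0)"
    using inner unfolding inner_product_on_def by (elim conjE)
  then show ?thesis using assms by (simp add: N_ip)
qed

lemma ip_self: "x \<in> H \<Longrightarrow> ip x x = complex_of_real ((N x)\<^sup>2)"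
  using ip_commute[of x x] by (simp add: N_sq complex_eq_iff)

lemma N_add_sq: "x \<in> H \<Longrightarrow> y \<in> H \<Longrightarrow> (N (x + y))\<^sup>2 = (N x)\<^sup>2 + (N y)\<^sup>2 + 2 * Re (ip x y)"
  using ip_commute[of x y] by (simp add: N_sq ip_add_left ip_add_right)

text \<open>The triangle inequality is already part of the normed structure, so squaring it and
  comparing with \<open>N_add_sq\<close> leaves exactly this.\<close>

lemma Re_ip_le: "x \<in> H \<Longrightarrow> y \<in> H \<Longrightarrow> Re (ip x y) \<le> N x * N y"
  using N_add_sq[of x y] power_mono[OF N_triangle[of x y], of 2] by (simp add: power2_sum)

lemma Cauchy_Schwarz: 
  assumes "x \<in> H" "y \<in> H"
  shows "cmod (ip x y) \<le> N x * N y"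
proof (cases "ip x y = 0")
  case False
  \<comment> \<open>A unimodular factor that rotates \<open>ip x y\<close> onto the positive axis,
    where modulus and real part agree.\<close>
  define c where "c = cnj (ip x y) / complex_of_real (cmod (ip x y))"
  have c: "cmod c = 1" using False by (simp add: c_def norm_divide)
  have "c * ip x y = cmod (ip x y)"
    using False complex_norm_square[of "ip x y"]
    by (simp add: c_def field_simps power2_eq_square)
  then have "Re (ip (c *\<^sub>C x) y) = cmod (ip x y)" using assms by (simp add: ip_scale_left)
  then show ?thesis using Re_ip_le[of "c *\<^sub>C x" y] assms c by simp
qed (use assms in simp)

lemma parallelogram:
  assumes "x \<in> H" "y \<in> H"
  shows "(N (x + y))\<^sup>2 + (N (x - y))\<^sup>2 = 2 * (N x)\<^sup>2 + 2 * (N y)\<^sup>2"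
proof -
  have "ip x (- 1 *\<^sub>C y) = - ip x y" using ip_scale_right[OF assms, of "- 1"] by simp
  then have "(N (x - y))\<^sup>2 = (N x)\<^sup>2 + (N y)\<^sup>2 - 2 * Re (ip x y)"
    using N_add_sq[of x "- 1 *\<^sub>C y"] N_scale[of y "- 1"] scale_mem[of y "- 1"] assms by simp
  then show ?thesis using N_add_sq[OF assms] by simp
qed

lemma ip_eqI:
  assumes "x \<in> H" "x' \<in> H" "\<And>y. y \<in> H \<Longrightarrow> ip x y = ip x' y"
  shows "x = x'"
  using assms(3)[of "x - x'"] assms(1,2) ip_diff_left[of x x' "x - x'"] ip_self[of "x - x'"] by simp

text \<open>The representing vector minimises \<open>N x\<^sup>2 - 2 Re (\<psi> x)\<close>.\<close>

lemma riesz: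
  assumes add: "\<And>x y. x \<in> H \<Longrightarrow> y \<in> H \<Longrightarrow> \<psi> (x + y) = \<psi> x + \<psi> y"
    and scale: "\<And>c x. x \<in> H \<Longrightarrow> \<psi> (c *\<^sub>C x) = c * \<psi> x"
    and bnd: "\<And>x. x \<in> H \<Longrightarrow> cmod (\<psi> x) \<le> C * N x"
  shows "\<exists>h\<in>H. \<forall>x\<in>H. \<psi> x = ip x h"
proof -
  define F where "F x = (N x)\<^sup>2 - 2 * Re (\<psi> x)" for x
  have F_ge: "F x \<ge> - C\<^sup>2" if "x \<in> H" for x
  proof -
    have "Re (\<psi> x) \<le> C * N x" using bnd[OF that] complex_Re_le_cmod[of "\<psi> x"] by linarith
    moreover have "0 \<le> (N x - C)\<^sup>2" by simp
    ultimately show ?thesis unfolding F_def by (simp add: power2_diff algebra_simps)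
  qed
  define m where "m = Inf (F ` H)"
  have bdd: "bdd_below (F ` H)" using F_ge by (intro bdd_belowI[of _ "- C\<^sup>2"]) auto
  have m_le: "m \<le> F x" if "x \<in> H" for x
    unfolding m_def using that bdd by (intro cInf_lower) auto
  have "\<exists>x\<in>H. F x < m + 1 / real (Suc n)" for n
  proof -
    have "Inf (F ` H) < m + 1 / real (Suc n)" unfolding m_def by simp
    moreover have "F ` H \<noteq> {}" using zero_mem by blast
    ultimately show ?thesis using bdd by (simp add: cInf_less_iff)
  qed
  then obtain x where x: "\<And>n. x n \<in> H" "\<And>n. F (x n) < m + 1 / real (Suc n)" by metis
  \<comment> \<open>The midpoint of \<open>u\<close> and \<open>v\<close> has \<open>F\<close> at
    least \<open>m\<close>; the parallelogram law turns this into a bound on their distance, so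
    minimising sequences are Cauchy.\<close>
  have dist: "(N (u - v))\<^sup>2 \<le> 2 * (F u - m) + 2 * (F v - m)" if "u \<in> H" "v \<in> H" for u v
  proof -
    define w where "w = (1/2) *\<^sub>C (u + v)"
    have "w \<in> H" using that by (simp add: w_def)
    have "(N w)\<^sup>2 = (N (u + v))\<^sup>2 / 4"
      using that by (simp add: w_def norm_divide power_mult_distrib power_divide)
    moreover have "Re (\<psi> w) = (Re (\<psi> u) + Re (\<psi> v)) / 2"
      using that by (simp add: w_def scale add)
    ultimately have "4 * F w = (N (u + v))\<^sup>2 - 4 * (Re (\<psi> u) + Re (\<psi> v))"
      by (simp add: F_def)
    moreover have "4 * m \<le> 4 * F w" using m_le[OF \<open>w \<in> H\<close>] by simp
    ultimately show ?thesis using parallelogram[OF that] by (simp add: F_def algebra_simps)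
  qed
  have "\<exists>k. \<forall>a\<ge>k. \<forall>b\<ge>k. N (x a - x b) < e" if "e > 0" for e
  proof -
    obtain k where k: "1 / real (Suc k) < e\<^sup>2 / 4"
      using reals_Archimedean[of "e\<^sup>2 / 4"] \<open>e > 0\<close> unfolding inverse_eq_divide by fastforce
    have "N (x a - x b) < e" if "a \<ge> k" "b \<ge> k" for a b
    proof (rule power2_less_imp_less)
      have mono: "1 / real (Suc a) \<le> 1 / real (Suc k)" if "a \<ge> k" for a
        using that by (intro divide_left_mono) auto
      have "(N (x a - x b))\<^sup>2 \<le> 2 * (F (x a) - m) + 2 * (F (x b) - m)" using dist x by blast
      also have "\<dots> < 4 / real (Suc k)"
        using x(2)[of a] x(2)[of b] mono[OF \<open>a \<ge> k\<close>] mono[OF \<open>b \<ge> k\<close>] by simp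
      also have "\<dots> < e\<^sup>2" using k by simp
      finally show "(N (x a - x b))\<^sup>2 < e\<^sup>2" .
    qed (use \<open>e > 0\<close> in simp)
    then show ?thesis by blast
  qed
  then obtain h where h: "h \<in> H" "(\<lambda>n. N (x n - h)) \<longlonglongrightarrow> 0"
    using banach[unfolded banach_iff, rule_format, of x] x(1) by blast
  have "(\<lambda>n. \<psi> (x n)) \<longlonglongrightarrow> \<psi> h"
  proof (rule LIM_zero_cancel, rule Lim_null_comparison)
    show "(\<lambda>n. C * N (x n - h)) \<longlonglongrightarrow> 0" using tendsto_mult_left[OF h(2)] by simp
    have "\<psi> (x n) - \<psi> h = \<psi> (x n - h)" for n
      using add[of "x n - h" h] x h by simp
    then show "\<forall>\<^sub>F n in sequentially. norm (\<psi> (x n) - \<psi> h) \<le> C * N (x n - h)"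
      using bnd[of "x _ - h"] x h by simp
  qed
  then have "(\<lambda>n. F (x n)) \<longlonglongrightarrow> F h"
    unfolding F_def by (intro tendsto_intros N_tendsto x h)
  moreover have "(\<lambda>n. m + 1 / real (Suc n)) \<longlonglongrightarrow> m + 0"
    by (intro tendsto_add tendsto_const) (use LIMSEQ_inverse_real_of_nat in \<open>simp add: inverse_eq_divide\<close>)
  ultimately have Fh: "F h \<le> m + 0"
    by (rule LIMSEQ_le) (use x(2) in \<open>auto intro!: exI[of _ 0] less_imp_le\<close>)
  have Re_eq: "Re (\<psi> y) = Re (ip y h)" if y: "y \<in> H" for y
  proof -
    define b where "b = Re (ip y h) - Re (\<psi> y)"
    define a where "a = (N y)\<^sup>2"
    \<comment> \<open>Minimality of \<open>h\<close> against \<open>h + t y\<close>: a quadratic in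
      \<open>t\<close> that vanishes at 0 and is never negative, so its linear coefficient
      \<open>b\<close> must be 0.\<close>
    have ineq: "0 \<le> t\<^sup>2 * a + 2 * t * b" for t :: real
    proof -
      define z where "z = complex_of_real t *\<^sub>C y"
      have z: "z \<in> H" using y by (simp add: z_def)
      have "F h \<le> F (z + h)" using Fh m_le[of "z + h"] z h by simp
      moreover have "F (z + h) = F h + (N z)\<^sup>2 + 2 * Re (ip z h) - 2 * Re (\<psi> z)"
        using N_add_sq[OF z h(1)] add[OF z h(1)] by (simp add: F_def)
      moreover have "(N z)\<^sup>2 = t\<^sup>2 * a" "Re (ip z h) = t * Re (ip y h)" "Re (\<psi> z) = t * Re (\<psi> y)"
        using y h by (simp_all add: z_def a_def power_mult_distrib ip_scale_left scale)
      ultimately show ?thesis by (simp add: b_def algebra_simps)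
    qed
    have a: "a \<ge> 0" by (simp add: a_def)
    \<comment> \<open>The minimiser of the quadratic would be \<open>- b / a\<close>; the
      denominator \<open>a + 1\<close> also covers \<open>a = 0\<close> and still makes the value
      negative unless \<open>b = 0\<close>.\<close>
    define t where "t = - b / (a + 1)"
    have b: "b = - t * (a + 1)" using a by (simp add: t_def)
    have "t\<^sup>2 * a + 2 * t * b = - (t\<^sup>2 * (a + 2))"
      unfolding b by (simp add: algebra_simps power2_eq_square)
    then have "t\<^sup>2 * (a + 2) \<le> 0" using ineq[of t] by simp
    then have "t = 0" using a by (simp add: mult_le_0_iff)
    then have "b = 0" by (simp add: b)
    then show ?thesis by (simp add: b_def)
  qed
  \<comment> \<open>Real parts at \<open>\<i> *\<^sub>C y\<close> are, up to sign, imaginary parts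
    at \<open>y\<close>.\<close>
  have "\<psi> y = ip y h" if y: "y \<in> H" for y
    using Re_eq[OF y] Re_eq[of "\<i> *\<^sub>C y"] y h by (simp add: ip_scale_left scale complex_eq_iff)
  then show ?thesis using h by blast
qed

end

section \<open>The Banach--Alaoglu theorem\<close>

text \<open>The function type carries the topology of pointwise convergence, which on the dual is
  the weak-star topology. The set is a product of discs, compact by Tychonoff, cut down by the
  closed conditions of linearity.\<close>

lemma (in cnormed) alaoglu:
  "compact {\<mu> \<in> dual V N. \<forall>x\<in>V. cmod (\<mu> x) \<le> N x}"
proof -
  interpret C: cnormed "UNIV :: complex set" cmod by (rule cnormed_complex)
  interpret P: cnormed_pair V N "UNIV :: complex set" cmod ..
  \<comment> \<open>The fibre \<open>{0}\<close> off \<open>V\<close> encodes the convention that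
    functionals vanish there.\<close>
  define K :: "'a \<Rightarrow> complex set" where "K x = (if x \<in> V then cball 0 (N x) else {0})" for x
  define S where "S = (\<Inter>x\<in>V. \<Inter>y\<in>V. {\<mu> :: 'a \<Rightarrow> complex. \<mu> (x + y) = \<mu> x + \<mu> y}) \<inter>
    (\<Inter>c. \<Inter>x\<in>V. {\<mu>. \<mu> (c *\<^sub>C x) = c * \<mu> x})"
  have "compactin (product_topology (\<lambda>i. euclidean) UNIV) (PiE UNIV K)"
    unfolding compactin_PiE by (simp add: K_def compact_cball)
  then have "compact (PiE UNIV K)" by (simp add: euclidean_product_topology)
  moreover have "closed S" unfolding S_def
    by (intro closed_Int closed_INT ballI closed_Collect_eq continuous_intros continuous_on_product_coordinates)
  ultimately have "compact (PiE UNIV K \<inter> S)" by (rule compact_Int_closed)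
  moreover have "PiE UNIV K \<inter> S = {\<mu> \<in> dual V N. \<forall>x\<in>V. cmod (\<mu> x) \<le> N x}"
  proof (intro set_eqI iffI)
    fix \<mu> assume mu: "\<mu> \<in> PiE UNIV K \<inter> S"
    then have K: "\<mu> x \<in> K x" for x by (auto simp: PiE_iff)
    have b: "cmod (\<mu> x) \<le> N x" if "x \<in> V" for x using K[of x] that by (simp add: K_def)
    have "\<mu> \<in> dual V N" unfolding dual_def
    proof (rule P.bounded_opsI)
      show "cmod (\<mu> x) \<le> 1 * N x" if "x \<in> V" for x using b[OF that] by simp
      show "\<mu> x = 0" if "x \<notin> V" for x using K[of x] that by (simp add: K_def)
    qed (use mu in \<open>auto simp: S_def scaleC_complex_def\<close>)
    then show "\<mu> \<in> {\<mu> \<in> dual V N. \<forall>x\<in>V. cmod (\<mu> x) \<le> N x}" using b by simp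
  next
    fix \<mu> assume "\<mu> \<in> {\<mu> \<in> dual V N. \<forall>x\<in>V. cmod (\<mu> x) \<le> N x}"
    then show "\<mu> \<in> PiE UNIV K \<inter> S"
      by (auto simp: dual_def S_def K_def P.op_add P.op_scale P.op_off scaleC_complex_def)
  qed
  ultimately show ?thesis by simp
qed

section \<open>The operator algebra of a commutative product on a Hilbert space\<close>

lemma (in cnormed) closure_subspace:
  assumes "csubspace S" "S \<subseteq> V"
  shows "csubspace (norm_topology V N closure_of S)"
proof (rule complex_vector.subspaceI)
  show "0 \<in> norm_topology V N closure_of S"
    using complex_vector.subspace_0[OF assms(1)] closure_of_subset[of S "norm_topology V N"] assms(2)
    by auto
next
  fix x y assume "x \<in> norm_topology V N closure_of S" "y \<in> norm_topology V N closure_of S"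
  then have x: "x \<in> V" "\<And>e. e > 0 \<Longrightarrow> \<exists>z\<in>S. N (x - z) < e"
    and y: "y \<in> V" "\<And>e. e > 0 \<Longrightarrow> \<exists>z\<in>S. N (y - z) < e"
    by (auto simp: closure_iff[OF assms(2)])
  have "\<exists>z\<in>S. N (x + y - z) < e" if "e > 0" for e
  proof -
    obtain u v where u: "u \<in> S" "N (x - u) < e / 2" and v: "v \<in> S" "N (y - v) < e / 2"
      using x(2)[of "e / 2"] y(2)[of "e / 2"] \<open>e > 0\<close> by auto
    have uv: "u \<in> V" "v \<in> V" using u v assms(2) by auto
    have "N (x + y - (u + v)) \<le> N (x - u) + N (y - v)"
      using N_triangle[of "x - u" "y - v"] x y uv by (simp add: algebra_simps)
    then show ?thesis
      using u v complex_vector.subspace_add[OF assms(1), of u v] by (intro bexI[of _ "u + v"]) auto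
  qed
  then show "x + y \<in> norm_topology V N closure_of S"
    using x y by (simp add: closure_iff[OF assms(2)])
next
  fix c x assume "x \<in> norm_topology V N closure_of S"
  then have x: "x \<in> V" "\<And>e. e > 0 \<Longrightarrow> \<exists>z\<in>S. N (x - z) < e"
    by (auto simp: closure_iff[OF assms(2)])
  have "\<exists>z\<in>S. N (c *\<^sub>C x - z) < e" if "e > 0" for e
  proof -
    obtain u where u: "u \<in> S" "N (x - u) < e / (cmod c + 1)"
      using x(2)[of "e / (cmod c + 1)"] \<open>e > 0\<close> by (auto simp: add_nonneg_pos)
    have "N (c *\<^sub>C x - c *\<^sub>C u) = cmod c * N (x - u)"
      using N_scale[of "x - u" c] x u assms(2) by (auto simp: complex_vector.scale_right_diff_distrib)
    also have "\<dots> \<le> cmod c * (e / (cmod c + 1))" using u by (intro mult_left_mono) auto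
    also have "\<dots> = e * (cmod c / (cmod c + 1))" by simp
    also have "\<dots> < e * 1"
      using \<open>e > 0\<close> by (intro mult_strict_left_mono) (simp_all add: divide_less_eq_1 add_nonneg_pos)
    finally show ?thesis
      using u complex_vector.subspace_scale[OF assms(1), of u c]
      by (intro bexI[of _ "c *\<^sub>C u"]) simp_all
  qed
  then show "c *\<^sub>C x \<in> norm_topology V N closure_of S"
    using x by (simp add: closure_iff[OF assms(2)])
qed

text \<open>\<open>J h k\<close> is the product of \<open>h\<close> and \<open>k\<close>.
  Commutativity and associativity are not put in as axioms: \<open>p_mult\<close> on monomials and
  the density principle \<open>p_dense\<close> produce them. \<open>p_small\<close> is the source of
  quasinilpotence, and \<open>C\<close> bounds the product on \<open>H\<close>.\<close>

locale hilbert_algebra = chilbert H N ip for H :: "'a::complex_vector set" and N ip +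
  fixes J :: "'a \<Rightarrow> 'a \<Rightarrow> 'a" and C :: real and p :: "nat \<Rightarrow> 'a"
  assumes J_mem: "h \<in> H \<Longrightarrow> J h \<in> bounded_ops H N H N"
    and J_add: "h \<in> H \<Longrightarrow> k \<in> H \<Longrightarrow> J (h + k) = J h + J k"
    and J_scale: "h \<in> H \<Longrightarrow> J (c *\<^sub>C h) = c *\<^sub>C J h"
    and J_bound: "h \<in> H \<Longrightarrow> op_norm H N N (J h) \<le> C * N h"
    and p_mem: "p n \<in> H"
    and p_mult: "J (p n) (p m) = p (n + m + 1)"
    and p_dense: "\<And>Z. csubspace Z \<Longrightarrow> closedin (norm_topology H N) Z \<Longrightarrow> range p \<subseteq> Z \<Longrightarrow> Z = H"
    and p_small: "d > 0 \<Longrightarrow> \<exists>K. \<forall>n. N (p n) \<le> K * d ^ n"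
begin

abbreviation Op :: "('a \<Rightarrow> 'a) set" where "Op \<equiv> bounded_ops H N H N"
abbreviation nrm :: "('a \<Rightarrow> 'a) \<Rightarrow> real" where "nrm \<equiv> op_norm H N N"

definition A :: "('a \<Rightarrow> 'a) set"
  where "A = norm_topology Op nrm closure_of (J ` H)"

sublocale P: cnormed_pair H N H N ..

lemma comp_mem: "S \<in> Op \<Longrightarrow> T \<in> Op \<Longrightarrow> S \<circ> T \<in> Op"
  using bounded_ops_comp(1)[OF cnormed_axioms] .

lemma comp_norm: "S \<in> Op \<Longrightarrow> T \<in> Op \<Longrightarrow> nrm (S \<circ> T) \<le> nrm S * nrm T"
  using bounded_ops_comp(2)[OF cnormed_axioms] .

lemma comp_diff_right:
  assumes "R \<in> Op" "S \<in> Op" "T \<in> Op"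
  shows "R \<circ> (S - T) = (R \<circ> S) - (R \<circ> T)"
proof
  fix z show "(R \<circ> (S - T)) z = ((R \<circ> S) - (R \<circ> T)) z"
    using assms by (cases "z \<in> H") (simp_all add: P.op_diff P.op_mem P.op_off P.op_0)
qed

lemma comp_diff_left: "(S - T) \<circ> R = (S \<circ> R) - (T \<circ> R)"
  by (rule ext) simp

lemma op_eqI:
  assumes "S \<in> Op" "T \<in> Op" "\<And>z. z \<in> H \<Longrightarrow> S z = T z"
  shows "S = T"
proof
  fix z show "S z = T z" using assms by (cases "z \<in> H") (simp_all add: P.op_off)
qed

lemma J_app_mem: "h \<in> H \<Longrightarrow> z \<in> H \<Longrightarrow> J h z \<in> H"
  using P.op_mem[OF J_mem] .

lemma J_app_bound: "h \<in> H \<Longrightarrow> z \<in> H \<Longrightarrow> N (J h z) \<le> C * N h * N z"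
  using P.op_norm_bound[OF J_mem[of h], of z] mult_right_mono[OF J_bound, of h "N z"] by simp

lemma J_diff: "h \<in> H \<Longrightarrow> k \<in> H \<Longrightarrow> J (h - k) = J h - J k"
  using J_add[of "h - k" k] by simp

lemma J_lim:
  assumes "\<And>n. x n \<in> H" "l \<in> H" "(\<lambda>n. N (x n - l)) \<longlonglongrightarrow> 0"
  shows "(\<lambda>n. nrm (J (x n) - J l)) \<longlonglongrightarrow> 0"
proof (rule Lim_null_comparison)
  show "(\<lambda>n. C * N (x n - l)) \<longlonglongrightarrow> 0" using tendsto_mult_left[OF assms(3)] by simp
  show "\<forall>\<^sub>F n in sequentially. norm (nrm (J (x n) - J l)) \<le> C * N (x n - l)"
    using J_bound[of "x _ - l"] P.op_norm_nonneg[OF J_mem[of "x _ - l"]] assms J_diff[of "x _" l]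
    by (intro always_eventually) simp
qed

text \<open>The vectors on which two bounded operators agree form a closed subspace, so
  \<open>p_dense\<close> applies.\<close>

lemma ext_p:
  assumes "S \<in> Op" "T \<in> Op" "\<And>n. S (p n) = T (p n)"
  shows "S = T"
proof (rule op_eqI[OF assms(1,2)])
  have "{z\<in>H. S z = T z} = H"
  proof (rule p_dense)
    show "csubspace {z\<in>H. S z = T z}"
      using assms by (intro complex_vector.subspaceI) (auto simp: P.op_0 P.op_add P.op_scale)
    show "closedin (norm_topology H N) {z\<in>H. S z = T z}"
    proof (rule closedinI_seq)
      fix x l assume x: "\<And>n. x n \<in> {z\<in>H. S z = T z}" and l: "l \<in> H" "(\<lambda>n. N (x n - l)) \<longlonglongrightarrow> 0"
      have "(\<lambda>n. N (S (x n) - S l)) \<longlonglongrightarrow> 0" "(\<lambda>n. N (T (x n) - T l)) \<longlonglongrightarrow> 0"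
        using P.op_cont[OF assms(1) _ l] P.op_cont[OF assms(2) _ l] x by auto
      moreover have "S (x n) = T (x n)" for n using x by simp
      ultimately have "S l = T l"
        using lim_unique[of "\<lambda>n. T (x n)" "S l" "T l"] x l assms P.op_mem by auto
      then show "l \<in> {z\<in>H. S z = T z}" using l by simp
    qed auto
    show "range p \<subseteq> {z\<in>H. S z = T z}" using assms p_mem by auto
  qed
  then show "S z = T z" if "z \<in> H" for z using that by auto
qed

text \<open>Right multiplication by \<open>k\<close> as an operator, so that \<open>ext_p\<close>
  can also act on the left factor of a product.\<close>

definition R :: "'a \<Rightarrow> 'a \<Rightarrow> 'a" where "R k = (\<lambda>h. if h \<in> H then J h k else 0)"

lemma R_mem: assumes "k \<in> H" shows "R k \<in> Op"
proof (rule P.bounded_opsI)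
  show "N (R k h) \<le> (C * N k) * N h" if "h \<in> H" for h
    using J_app_bound[OF that assms] that by (simp add: R_def mult_ac)
qed (use assms in \<open>auto simp: R_def J_app_mem J_add J_scale scaleC_fun_def\<close>)

text \<open>\<open>ext_p\<close> is used once per factor: two monomials commute by
  \<open>p_mult\<close>, hence a monomial commutes with every vector, hence any two vectors
  commute.\<close>

lemma J_commute:
  assumes "h \<in> H" "k \<in> H"
  shows "J h k = J k h"
proof -
  have "R (p m) = J (p m)" for m
    by (rule ext_p[OF R_mem J_mem]) (simp_all add: p_mem R_def p_mult add.commute)
  then have "J h (p m) = J (p m) h" if "h \<in> H" for h m
    using that by (metis R_def)
  then have "J h = R h"
    using assms by (intro ext_p[OF J_mem R_mem]) (simp_all add: p_mem R_def)
  then show ?thesis using assms by (simp add: R_def)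
qed

lemma J_p_comp: "J (p l) \<circ> J (p m) = J (p (l + m + 1))"
  by (rule ext_p) (simp_all add: comp_mem J_mem p_mem p_mult add.assoc)

text \<open>Each use of \<open>ext_p\<close> frees one factor: the last one in
  \<open>J_p_comp\<close>, the middle one in step \<open>1\<close>, and the first one at the
  end.\<close>

lemma J_assoc:
  assumes "h \<in> H" "k \<in> H"
  shows "J (J h k) = J h \<circ> J k"
proof (rule op_eqI)
  fix g assume g: "g \<in> H"
  have 1: "R g \<circ> J (p l) = J (p l) \<circ> R g" for l
  proof (rule ext_p)
    show "(R g \<circ> J (p l)) (p n) = (J (p l) \<circ> R g) (p n)" for n
      using J_p_comp[of l n] g by (simp add: R_def J_app_mem p_mem p_mult fun_eq_iff)
  qed (use g in \<open>simp_all add: comp_mem R_mem J_mem p_mem\<close>)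
  have "R g \<circ> R k = R (J k g)"
  proof (rule ext_p)
    show "(R g \<circ> R k) (p n) = R (J k g) (p n)" for n
      using fun_cong[OF 1[of n], of k] assms g by (simp add: R_def J_app_mem p_mem)
  qed (use assms g in \<open>simp_all add: comp_mem R_mem J_mem J_app_mem p_mem\<close>)
  from fun_cong[OF this, of h] show "J (J h k) g = (J h \<circ> J k) g"
    using assms g by (simp add: R_def J_app_mem)
qed (use assms in \<open>simp_all add: J_mem comp_mem J_app_mem\<close>)

section \<open>Elements of the algebra as multipliers of the Hilbert space\<close>

lemma J_image_sub: "J ` H \<subseteq> Op"
  using J_mem by auto

lemma J_image_subspace: "csubspace (J ` H)"
proof (rule complex_vector.subspaceI)
  show "0 \<in> J ` H" using J_scale[of 0 0] by (auto intro!: image_eqI[of _ _ 0])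
  show "x + y \<in> J ` H" if "x \<in> J ` H" "y \<in> J ` H" for x y
    using that J_add by (metis (no_types, lifting) add_mem image_iff)
  show "c *\<^sub>C x \<in> J ` H" if "x \<in> J ` H" for c x
    using that J_scale by (metis (no_types, lifting) scale_mem image_iff)
qed

lemma A_closed: "closedin (norm_topology Op nrm) A"
  by (simp add: A_def)

lemma A_sub: "A \<subseteq> Op"
  using A_closed closedin_subset[of "norm_topology Op nrm" A] by simp

lemma A_op: "x \<in> A \<Longrightarrow> x \<in> Op"
  using A_sub by blast

lemma A_app: "x \<in> A \<Longrightarrow> z \<in> H \<Longrightarrow> x z \<in> H"
  using A_op P.op_mem by blast

lemma A_subspace: "csubspace A"
  unfolding A_def by (rule P.ops.closure_subspace[OF J_image_subspace J_image_sub])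

lemma J_A: "h \<in> H \<Longrightarrow> J h \<in> A"
  unfolding A_def using closure_of_subset[of "J ` H" "norm_topology Op nrm"] J_image_sub by auto

lemma A_seq:
  assumes "x \<in> A"
  obtains h where "\<And>n. h n \<in> H" "(\<lambda>n. nrm (J (h n) - x)) \<longlonglongrightarrow> 0"
proof -
  obtain y where y: "\<And>n. y n \<in> J ` H" "(\<lambda>n. nrm (y n - x)) \<longlonglongrightarrow> 0"
    using P.ops.closure_seq[OF J_image_sub] assms unfolding A_def by blast
  then have "\<forall>n. \<exists>h\<in>H. y n = J h" by blast
  then obtain h where "\<And>n. h n \<in> H" "\<And>n. y n = J (h n)" by metis
  then show ?thesis using that[of h] y by simp
qed

text \<open>This is associativity when \<open>x = J k\<close>, and both sides survive norm limits in
  \<open>x\<close>. It makes the image of \<open>J\<close> an ideal of \<open>A\<close> and is the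
  only access to elements of \<open>A\<close> that do not come from a vector.\<close>

lemma A_J:
  assumes "x \<in> A" "h \<in> H"
  shows "x \<circ> J h = J (x h)"
proof (rule op_eqI)
  fix g assume g: "g \<in> H"
  obtain k where k: "\<And>n. k n \<in> H" "(\<lambda>n. nrm (J (k n) - x)) \<longlonglongrightarrow> 0"
    using A_seq[OF assms(1)] by blast
  have 1: "(\<lambda>n. N (J (k n) (J h g) - x (J h g))) \<longlonglongrightarrow> 0"
    by (rule P.op_lim[OF _ _ k(2)]) (use k assms g in \<open>auto simp: J_mem A_op J_app_mem\<close>)
  have 3: "(\<lambda>n. N (J (k n) h - x h)) \<longlonglongrightarrow> 0"
    by (rule P.op_lim[OF _ _ k(2)]) (use k assms g in \<open>auto simp: J_mem A_op\<close>)
  \<comment> \<open>Multiplication by \<open>g\<close> is continuous, so convergence of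
    \<open>J (k n) h\<close> to \<open>x h\<close> passes to the products with
    \<open>g\<close>.\<close>
  have "(\<lambda>n. N (R g (J (k n) h) - R g (x h))) \<longlonglongrightarrow> 0"
    by (rule P.op_cont[OF R_mem[OF g] _ _ 3]) (use k assms g in \<open>auto simp: J_app_mem A_app\<close>)
  moreover have "R g (J (k n) h) = J (k n) (J h g)" for n
    using k assms g by (simp add: R_def J_app_mem J_assoc)
  ultimately have 2: "(\<lambda>n. N (J (k n) (J h g) - J (x h) g)) \<longlonglongrightarrow> 0"
    using assms by (simp add: R_def A_app)
  show "(x \<circ> J h) g = J (x h) g"
    using lim_unique[OF _ _ _ 1 2] k assms g by (simp add: J_app_mem A_app)
qed (use assms in \<open>simp_all add: J_mem comp_mem A_app A_op\<close>)

lemma J_A_commute: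
  assumes "x \<in> A" "h \<in> H"
  shows "J h \<circ> x = x \<circ> J h"
proof (rule op_eqI)
  fix z assume z: "z \<in> H"
  \<comment> \<open>Once \<open>x z\<close> stands on the left, \<open>A_J\<close> with
    \<open>z\<close> in the role of the vector pulls \<open>x\<close> out.\<close>
  have "J h (x z) = J (x z) h" using assms z by (simp add: J_commute A_app)
  also have "\<dots> = x (J z h)" using fun_cong[OF A_J[OF assms(1) z], of h] by simp
  finally show "(J h \<circ> x) z = (x \<circ> J h) z" using J_commute[OF z assms(2)] by simp
qed (use assms in \<open>simp_all add: J_mem comp_mem A_op\<close>)

lemma A_commute:
  assumes "x \<in> A" "y \<in> A"
  shows "x \<circ> y = y \<circ> x"
proof (rule op_eqI)
  fix z assume z: "z \<in> H"
  obtain k where k: "\<And>n. k n \<in> H" "(\<lambda>n. nrm (J (k n) - y)) \<longlonglongrightarrow> 0"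
    using A_seq[OF assms(2)] by blast
  have 1: "(\<lambda>n. N (J (k n) (x z) - y (x z))) \<longlonglongrightarrow> 0"
    by (rule P.op_lim[OF _ _ k(2)]) (use k assms z in \<open>auto simp: J_mem A_op A_app\<close>)
  have 3: "(\<lambda>n. N (J (k n) z - y z)) \<longlonglongrightarrow> 0"
    by (rule P.op_lim[OF _ _ k(2)]) (use k assms z in \<open>auto simp: J_mem A_op\<close>)
  have "(\<lambda>n. N (x (J (k n) z) - x (y z))) \<longlonglongrightarrow> 0"
    by (rule P.op_cont[OF A_op[OF assms(1)] _ _ 3]) (use k assms z in \<open>auto simp: J_app_mem A_app\<close>)
  moreover have "x (J (k n) z) = J (k n) (x z)" for n
    using fun_cong[OF J_A_commute[OF assms(1) k(1)], of n z] by simp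
  ultimately have 2: "(\<lambda>n. N (J (k n) (x z) - x (y z))) \<longlonglongrightarrow> 0" by simp
  show "(x \<circ> y) z = (y \<circ> x) z"
    using lim_unique[OF _ _ _ 1 2] k assms z by (simp add: J_app_mem A_app)
qed (use assms in \<open>simp_all add: comp_mem A_op\<close>)

lemma A_comp:
  assumes "x \<in> A" "y \<in> A"
  shows "x \<circ> y \<in> A"
proof -
  obtain k where k: "\<And>n. k n \<in> H" "(\<lambda>n. nrm (J (k n) - y)) \<longlonglongrightarrow> 0"
    using A_seq[OF assms(2)] by blast
  show ?thesis
  proof (rule P.ops.closed_lim[OF A_closed])
    show "x \<circ> J (k n) \<in> A" for n using A_J[OF assms(1) k(1)] J_A A_app[OF assms(1) k(1)] by simp
    show "x \<circ> y \<in> Op" using assms by (simp add: comp_mem A_op)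
    show "(\<lambda>n. nrm ((x \<circ> J (k n)) - (x \<circ> y))) \<longlonglongrightarrow> 0"
    proof (rule Lim_null_comparison)
      show "(\<lambda>n. nrm x * nrm (J (k n) - y)) \<longlonglongrightarrow> 0" using tendsto_mult_left[OF k(2)] by simp
      have "(x \<circ> J (k n)) - (x \<circ> y) = x \<circ> (J (k n) - y)" for n
        using assms k by (simp add: comp_diff_right A_op J_mem)
      then show "\<forall>\<^sub>F n in sequentially. norm (nrm ((x \<circ> J (k n)) - (x \<circ> y))) \<le> nrm x * nrm (J (k n) - y)"
        using comp_norm[of x "J (k _) - y"] assms k
        by (intro always_eventually) (simp add: A_op J_mem comp_mem)
    qed
  qed
qed

lemma A_banach: "banach_space_on A nrm"
  by (rule banach_closed_subspace[OF P.banach_ops[OF banach] A_closed A_subspace])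

sublocale A: cnormed A nrm
  using A_banach by unfold_locales (simp add: banach_space_on_def)

lemma operator_algebra: "operator_algebra_on H N A"
proof -
  have "hilbert_space_on H N"
    unfolding hilbert_space_on_def using banach inner N_ip by blast
  then show ?thesis
    unfolding operator_algebra_on_def subalgebra_of_def
    using A_sub A_subspace A_closed by (simp add: A_comp)
qed

lemma commutative: "commutative_algebra A (\<circ>)"
  unfolding commutative_algebra_def using A_commute by blast

lemma A_norm_app: "x \<in> A \<Longrightarrow> z \<in> H \<Longrightarrow> N (x z) \<le> nrm x * N z"
  using P.op_norm_bound A_op by blast

subsection \<open>Single generation\<close>

text \<open>Two density steps: \<open>J\<close> is continuous, so the vectors sent into
  \<open>B\<close> form a closed subspace containing the monomials; and the image of
  \<open>J\<close> is dense in \<open>A\<close>. Closed linear properties of \<open>A\<close> can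
  thus be tested on \<open>J (p k)\<close>.\<close>

lemma closed_subspace_eq_A:
  assumes B: "csubspace B" "closedin (norm_topology A nrm) B" "\<And>k. J (p k) \<in> B"
  shows "B = A"
proof -
  have BA: "B \<subseteq> A" using B(2) by (simp add: A.closedin_iff)
  have Z: "{h\<in>H. J h \<in> B} = H"
  proof (rule p_dense)
    show "csubspace {h\<in>H. J h \<in> B}"
      using J_scale[of 0 0] complex_vector.subspace_0[OF B(1)]
      by (intro complex_vector.subspaceI) (auto simp: J_add J_scale
          intro: complex_vector.subspace_add[OF B(1)] complex_vector.subspace_scale[OF B(1)])
    show "closedin (norm_topology H N) {h\<in>H. J h \<in> B}"
    proof (rule closedinI_seq)
      fix x l assume x: "\<And>n. x n \<in> {h\<in>H. J h \<in> B}" and l: "l \<in> H" "(\<lambda>n. N (x n - l)) \<longlonglongrightarrow> 0"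
      have "J l \<in> B"
        by (rule A.closed_lim[OF B(2) _ _ J_lim[OF _ l]]) (use x l in \<open>auto simp: J_A\<close>)
      then show "l \<in> {h\<in>H. J h \<in> B}" using l by simp
    qed auto
    show "range p \<subseteq> {h\<in>H. J h \<in> B}" using p_mem B(3) by auto
  qed
  have "A \<subseteq> B"
  proof
    fix x assume x: "x \<in> A"
    obtain k where k: "\<And>n. k n \<in> H" "(\<lambda>n. nrm (J (k n) - x)) \<longlonglongrightarrow> 0"
      using A_seq[OF x] by blast
    show "x \<in> B"
      by (rule A.closed_lim[OF B(2) _ x k(2)]) (use k(1) Z in blast)
  qed
  then show ?thesis using BA by blast
qed

lemma generated_A:
  assumes B: "csubspace B" "\<And>x y. x \<in> B \<Longrightarrow> y \<in> B \<Longrightarrow> x \<circ> y \<in> B"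
    "closedin (norm_topology A nrm) B" "J (p 0) \<in> B"
  shows "B = A"
proof (rule closed_subspace_eq_A[OF B(1,3)])
  show "J (p n) \<in> B" for n
  proof (induction n)
    case (Suc n)
    then show ?case using B(2)[OF B(4) Suc] by (simp add: J_p_comp)
  qed (rule B(4))
qed

lemma singly_generated: "topologically_singly_generated A nrm (\<circ>)"
proof -
  have "B = A" if "subalgebra_of B A (\<circ>)" "closedin (norm_topology A nrm) B" "{J (p 0)} \<subseteq> B" for B
    using generated_A[of B] that unfolding subalgebra_of_def by auto
  moreover have "subalgebra_of A A (\<circ>)" "closedin (norm_topology A nrm) A" "{J (p 0)} \<subseteq> A"
    using A_subspace A_comp J_A[OF p_mem] closedin_topspace[of "norm_topology A nrm"]
    by (auto simp: subalgebra_of_def)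
  ultimately have "closed_subalgebra_generated A nrm (\<circ>) {J (p 0)} = A"
    unfolding closed_subalgebra_generated_def by blast
  then show ?thesis
    unfolding topologically_singly_generated_def using J_A[OF p_mem] by blast
qed

end

context hilbert_algebra
begin

subsection \<open>Quasinilpotence\<close>

text \<open>Spectral radius 0 as a family of geometric bounds. They are stated on vectors because
  \<open>x ^^ 0\<close> is the identity, which does not vanish off \<open>H\<close> and so lies
  outside \<open>Op\<close>. Values \<open>d > 1\<close> are covered by the bound for
  \<open>d = 1\<close>.\<close>

definition quasinilpotents :: "('a \<Rightarrow> 'a) set"
  where "quasinilpotents = {x\<in>A. \<forall>d. 0 < d \<and> d \<le> 1 \<longrightarrow> (\<exists>K\<ge>0. \<forall>n. \<forall>z\<in>H. N ((x ^^ n) z) \<le> K * d ^ n * N z)}"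

lemma pow_mem: "x \<in> A \<Longrightarrow> z \<in> H \<Longrightarrow> (x ^^ n) z \<in> H"
  by (induction n) (simp_all add: A_app)

lemma pow_add:
  assumes "x \<in> A" "u \<in> H" "v \<in> H"
  shows "(x ^^ n) (u + v) = (x ^^ n) u + (x ^^ n) v"
  by (induction n) (simp_all add: assms P.op_add[OF A_op] pow_mem)

lemma pow_commute:
  assumes "x \<in> A" "y \<in> A"
  shows "y ((x ^^ n) z) = (x ^^ n) (y z)"
proof (induction n)
  case (Suc n)
  then show ?case using fun_cong[OF A_commute[OF assms], of "(x ^^ n) z"] by simp
qed simp

text \<open>The binomial expansion in inductive form: each factor \<open>x + y\<close> splits a term
  in two, so 2^n terms of size d^n arise. The exponents \<open>i\<close> and \<open>j\<close> record
  the factors already expanded.\<close>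

lemma power_sum_bound:
  assumes x: "x \<in> A" and y: "y \<in> A" and K: "0 \<le> K1" "0 \<le> K2" and d: "0 \<le> d"
    and bx: "\<And>n z. z \<in> H \<Longrightarrow> N ((x ^^ n) z) \<le> K1 * d ^ n * N z"
    and by': "\<And>n z. z \<in> H \<Longrightarrow> N ((y ^^ n) z) \<le> K2 * d ^ n * N z"
    and z: "z \<in> H"
  shows "N (((x + y) ^^ n) ((x ^^ i) ((y ^^ j) z))) \<le> K1 * K2 * d ^ (i + j) * (2 * d) ^ n * N z"
proof (induction n arbitrary: i j)
  case 0
  have "N ((x ^^ i) ((y ^^ j) z)) \<le> K1 * d ^ i * N ((y ^^ j) z)"
    using bx pow_mem[OF y z] by blast
  also have "\<dots> \<le> K1 * d ^ i * (K2 * d ^ j * N z)"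
    using by'[OF z] K d by (intro mult_left_mono) auto
  finally show ?case by (simp add: power_add mult_ac)
next
  case (Suc n)
  define w where "w = (x ^^ i) ((y ^^ j) z)"
  have w: "w \<in> H" using x y z by (simp add: w_def pow_mem)
  have xy: "x + y \<in> A" using x y by simp
  \<comment> \<open>The innermost factor is peeled off, so that commuting \<open>y\<close> past
    \<open>x ^^ i\<close> is all that is needed to restore the shape of the induction
    hypothesis.\<close>
  have "((x + y) ^^ Suc n) w = ((x + y) ^^ n) ((x + y) w)"
    by (metis funpow_swap1 funpow.simps(2) o_apply)
  also have "(x + y) w = (x ^^ Suc i) ((y ^^ j) z) + (x ^^ i) ((y ^^ Suc j) z)"
    using pow_commute[OF x y] by (simp add: w_def)
  also have "((x + y) ^^ n) \<dots> = ((x + y) ^^ n) ((x ^^ Suc i) ((y ^^ j) z)) + ((x + y) ^^ n) ((x ^^ i) ((y ^^ Suc j) z))"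
    by (rule pow_add[OF xy]) (use pow_mem x y z in blast)+
  finally have "N (((x + y) ^^ Suc n) w) \<le>
      N (((x + y) ^^ n) ((x ^^ Suc i) ((y ^^ j) z))) + N (((x + y) ^^ n) ((x ^^ i) ((y ^^ Suc j) z)))"
    using N_triangle pow_mem x y z xy by metis
  also have "\<dots> \<le> K1 * K2 * d ^ (Suc i + j) * (2 * d) ^ n * N z + K1 * K2 * d ^ (i + Suc j) * (2 * d) ^ n * N z"
    by (intro add_mono Suc)
  also have "\<dots> = K1 * K2 * d ^ (i + j) * (2 * d) ^ Suc n * N z" by (simp add: algebra_simps)
  finally show ?case unfolding w_def .
qed

lemma pow_norm: "x \<in> A \<Longrightarrow> z \<in> H \<Longrightarrow> N ((x ^^ n) z) \<le> nrm x ^ n * N z"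
proof (induction n)
  case (Suc n)
  have "N ((x ^^ Suc n) z) \<le> nrm x * N ((x ^^ n) z)"
    using A_norm_app[OF Suc.prems(1) pow_mem[OF Suc.prems]] by simp
  also have "\<dots> \<le> nrm x * (nrm x ^ n * N z)"
    using Suc by (intro mult_left_mono) auto
  finally show ?case by (simp add: mult_ac)
qed simp

text \<open>Split \<open>x\<close> as \<open>(x - y) + y\<close>. The powers of \<open>x - y\<close>
  are controlled by its norm at rate \<open>d / 2\<close>, those of \<open>y\<close> by
  quasinilpotence, and \<open>power_sum_bound\<close> doubles the rate to \<open>d\<close>.\<close>

lemma quasinilpotents_add_small:
  assumes x: "x \<in> A" and d: "0 < d" "d \<le> 1" and y: "y \<in> quasinilpotents" and r: "nrm (x - y) \<le> d / 2"
  shows "\<exists>K\<ge>0. \<forall>n. \<forall>z\<in>H. N ((x ^^ n) z) \<le> K * d ^ n * N z"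
proof -
  have yA: "y \<in> A" using y by (simp add: quasinilpotents_def)
  then obtain K where K: "K \<ge> 0" "\<forall>n. \<forall>z\<in>H. N ((y ^^ n) z) \<le> K * (d / 2) ^ n * N z"
    using y d unfolding quasinilpotents_def by (force elim: allE[of _ "d / 2"])
  have "N (((x - y) ^^ n) z) \<le> 1 * (d / 2) ^ n * N z" if "z \<in> H" for n z
    using pow_norm[of "x - y" z n] that x yA
      mult_right_mono[OF power_mono[OF r], of "N z" n] by simp
  from power_sum_bound[of "x - y" y 1 K "d / 2" _ _ 0 0, OF _ yA _ K(1) _ this] K(2) d x yA
  have "N (((x - y + y) ^^ n) z) \<le> K * d ^ n * N z" if "z \<in> H" for z n
    using that by simp
  then show ?thesis using K(1) by auto
qed

lemma quasinilpotents_closed: "closedin (norm_topology A nrm) quasinilpotents"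
  unfolding A.closedin_iff
proof (intro conjI ballI impI)
  show "quasinilpotents \<subseteq> A" by (auto simp: quasinilpotents_def)
  fix x assume x: "x \<in> A" and *: "\<forall>e>0. \<exists>y\<in>quasinilpotents. nrm (x - y) < e"
  have "\<exists>K\<ge>0. \<forall>n. \<forall>z\<in>H. N ((x ^^ n) z) \<le> K * d ^ n * N z" if d: "0 < d" "d \<le> 1" for d
  proof -
    obtain y where "y \<in> quasinilpotents" "nrm (x - y) < d / 2" using * d by (meson half_gt_zero)
    then show ?thesis using quasinilpotents_add_small[OF x d, of y] by simp
  qed
  then show "x \<in> quasinilpotents" using x by (simp add: quasinilpotents_def)
qed

lemma quasinilpotents_subspace: "csubspace quasinilpotents"
proof (rule complex_vector.subspaceI)
  \<comment> \<open>Here \<open>0\<close> is the zero map, whose iterate of order 0 is still the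
    identity; hence the constant 1 below.\<close>
  have "(0 ^^ n) z = (if n = 0 then z else 0)" for n :: nat and z :: 'a
    by (cases n) simp_all
  then have "N ((0 ^^ n) z) \<le> 1 * d ^ n * N z" if "0 < d" "z \<in> H" for n :: nat and z and d :: real
    using that by simp
  then show "0 \<in> quasinilpotents" using A.zero_mem by (auto simp: quasinilpotents_def intro!: exI[of _ 1])
next
  fix x y assume x: "x \<in> quasinilpotents" and y: "y \<in> quasinilpotents"
  then have xy: "x \<in> A" "y \<in> A" by (auto simp: quasinilpotents_def)
  have "\<exists>K\<ge>0. \<forall>n. \<forall>z\<in>H. N (((x + y) ^^ n) z) \<le> K * d ^ n * N z" if d: "0 < d" "d \<le> 1" for d
  proof -
    obtain K1 where K1: "K1 \<ge> 0" "\<forall>n. \<forall>z\<in>H. N ((x ^^ n) z) \<le> K1 * (d / 2) ^ n * N z"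
      using x d unfolding quasinilpotents_def by (force elim: allE[of _ "d / 2"])
    obtain K2 where K2: "K2 \<ge> 0" "\<forall>n. \<forall>z\<in>H. N ((y ^^ n) z) \<le> K2 * (d / 2) ^ n * N z"
      using y d unfolding quasinilpotents_def by (force elim: allE[of _ "d / 2"])
    have "N (((x + y) ^^ n) z) \<le> (K1 * K2) * d ^ n * N z" if "z \<in> H" for z n
      using power_sum_bound[OF xy K1(1) K2(1), of "d / 2" z n 0 0] K1(2) K2(2) d that by simp
    then show ?thesis using K1(1) K2(1) by (intro exI[of _ "K1 * K2"]) auto
  qed
  then show "x + y \<in> quasinilpotents" using xy by (simp add: quasinilpotents_def)
next
  fix c x assume x: "x \<in> quasinilpotents"
  then have xA: "x \<in> A" by (simp add: quasinilpotents_def)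
  have pw: "((c *\<^sub>C x) ^^ n) z = c ^ n *\<^sub>C (x ^^ n) z" if "z \<in> H" for n z
    by (induction n) (simp_all add: that scaleC_fun_def P.op_scale[OF A_op[OF xA]] pow_mem[OF xA])
  have "\<exists>K\<ge>0. \<forall>n. \<forall>z\<in>H. N (((c *\<^sub>C x) ^^ n) z) \<le> K * d ^ n * N z" if d: "0 < d" "d \<le> 1" for d
  proof -
    \<comment> \<open>Since \<open>q >= 1\<close>, the rate \<open>d / q\<close> is again an
      admissible value, and \<open>c = 0\<close> needs no separate treatment.\<close>
    define q where "q = cmod c + 1"
    have q: "q \<ge> 1" "cmod c \<le> q" by (simp_all add: q_def)
    have dq: "0 < d / q" "d / q \<le> 1" using d q by (auto simp: divide_le_eq_1)
    then obtain K where K: "K \<ge> 0" "\<forall>n. \<forall>z\<in>H. N ((x ^^ n) z) \<le> K * (d / q) ^ n * N z"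
      using x unfolding quasinilpotents_def by (force elim: allE[of _ "d / q"])
    have "N (((c *\<^sub>C x) ^^ n) z) \<le> K * d ^ n * N z" if "z \<in> H" for z n
    proof -
      have "N (((c *\<^sub>C x) ^^ n) z) = cmod c ^ n * N ((x ^^ n) z)"
        using that by (simp add: pw pow_mem[OF xA] norm_power)
      also have "\<dots> \<le> q ^ n * (K * (d / q) ^ n * N z)"
        using K(2) that q by (intro mult_mono power_mono) (auto simp: pow_mem[OF xA])
      also have "\<dots> = K * d ^ n * N z" using q by (simp add: power_divide)
      finally show ?thesis .
    qed
    then show ?thesis using K(1) by auto
  qed
  then show "c *\<^sub>C x \<in> quasinilpotents" using xA by (simp add: quasinilpotents_def)
qed

text \<open>The shifted index \<open>k + 1\<close> is additive under convolution; the power n + 1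
  has shifted index (n + 1)(k + 1).\<close>

lemma J_p_pow: "(J (p k) ^^ Suc n) z = J (p (n * Suc k + k)) z"
proof (induction n arbitrary: z)
  case (Suc n)
  have "(J (p k) ^^ Suc (Suc n)) z = J (p k) (J (p (n * Suc k + k)) z)"
    using Suc by simp
  also have "\<dots> = J (p (k + (n * Suc k + k) + 1)) z"
    using fun_cong[OF J_p_comp[of k "n * Suc k + k"], of z] by simp
  finally show ?case by (simp add: algebra_simps)
qed simp

lemma J_p_quasinilpotent: "J (p k) \<in> quasinilpotents"
  unfolding quasinilpotents_def
proof (intro CollectI conjI allI impI)
  show "J (p k) \<in> A" by (simp add: J_A p_mem)
  fix d :: real assume d: "0 < d \<and> d \<le> 1"
  then obtain K where K: "\<And>n. N (p n) \<le> K * d ^ n" using p_small by blast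
  have K0: "K \<ge> 0" using K[of 0] N_nonneg[OF p_mem[of 0]] by simp
  \<comment> \<open>The entry 1 serves the iterate of order 0, and the division by \<open>d\<close>
    serves \<open>n = Suc m\<close>, where only d^m is gained. The modulus of \<open>C\<close>
    appears because its sign is not fixed.\<close>
  define K' where "K' = max 1 (\<bar>C\<bar> * K / d)"
  have "N ((J (p k) ^^ n) z) \<le> K' * d ^ n * N z" if z: "z \<in> H" for n z
  proof (cases n)
    case 0
    then show ?thesis using mult_right_mono[of 1 K' "N z"] z by (simp add: K'_def)
  next
    case (Suc m)
    define l where "l = m * Suc k + k"
    have "m \<le> l" by (simp add: l_def)
    have "N ((J (p k) ^^ n) z) \<le> C * N (p l) * N z"
      unfolding Suc J_p_pow using J_app_bound[OF p_mem z] by (simp add: l_def)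
    also have "\<dots> \<le> \<bar>C\<bar> * (K * d ^ m) * N z"
    proof (intro mult_right_mono mult_mono)
      have "N (p l) \<le> K * d ^ l" by (rule K)
      also have "\<dots> \<le> K * d ^ m" using d K0 \<open>m \<le> l\<close> by (intro mult_left_mono power_decreasing) auto
      finally show "N (p l) \<le> K * d ^ m" .
    qed (use z p_mem in auto)
    also have "\<dots> = \<bar>C\<bar> * K / d * d ^ n * N z" using d by (simp add: Suc)
    also have "\<dots> \<le> K' * d ^ n * N z"
      using d z by (intro mult_right_mono) (auto simp: K'_def)
    finally show ?thesis .
  qed
  moreover have "K' \<ge> 0" by (simp add: K'_def)
  ultimately show "\<exists>K\<ge>0. \<forall>n. \<forall>z\<in>H. N ((J (p k) ^^ n) z) \<le> K * d ^ n * N z" by blast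
qed

lemma A_quasinilpotent: "A \<subseteq> quasinilpotents"
  using closed_subspace_eq_A[OF quasinilpotents_subspace quasinilpotents_closed J_p_quasinilpotent] by simp

text \<open>The Neumann series u + u^2 + ..., summed without a unit. Quasinilpotence at rate 1/2
  makes it converge geometrically, whatever the norm of \<open>u\<close>.\<close>

lemma quasi_inverse:
  assumes u: "u \<in> A"
  shows "\<exists>v\<in>A. v = u + (v \<circ> u)"
proof -
  obtain K where K: "K \<ge> 0" "\<forall>n. \<forall>z\<in>H. N ((u ^^ n) z) \<le> K * (1 / 2) ^ n * N z"
    using subsetD[OF A_quasinilpotent u] unfolding quasinilpotents_def by (force elim: allE[of _ "1 / 2"])
  define s where "s n = rec_nat 0 (\<lambda>_ t. u + (t \<circ> u)) n" for n :: nat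
  have s0: "s 0 = 0" and sS: "s (Suc n) = u + (s n \<circ> u)" for n by (simp_all add: s_def)
  have sA: "s n \<in> A" for n
  proof (induction n)
    case (Suc n)
    show ?case unfolding sS by (rule A.add_mem[OF u A_comp[OF Suc u]])
  qed (simp only: s0 A.zero_mem)
  have diff: "s (Suc n) z - s n z = (u ^^ Suc n) z" for n z
  proof (induction n arbitrary: z)
    case (Suc n)
    have "s (Suc (Suc n)) z - s (Suc n) z = s (Suc n) (u z) - s n (u z)"
      by (simp add: sS[of "Suc n"] sS[of n])
    also have "\<dots> = (u ^^ Suc n) (u z)" by (rule Suc)
    finally show ?case by (simp add: funpow_swap1)
  qed (simp add: s0 sS)
  have step: "nrm (s (Suc n) - s n) \<le> K * (1 / 2) ^ Suc n" for n
    using K by (intro P.op_norm_le) (simp_all add: diff del: funpow.simps power_Suc)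
  \<comment> \<open>The right-hand side is \<open>K\<close> times the sum of (1/2)^i over n < i <= n
    + j.\<close>
  have tele: "nrm (s (n + j) - s n) \<le> K * ((1 / 2) ^ n - (1 / 2) ^ (n + j))" for n j
  proof (induction j)
    case (Suc j)
    have "nrm (s (n + Suc j) - s n) \<le> nrm (s (Suc (n + j)) - s (n + j)) + nrm (s (n + j) - s n)"
      using A.N_diff_triangle[OF sA sA sA, of "Suc (n + j)" n "n + j"] by (simp only: add_Suc_right)
    moreover have "K * (1 / 2) ^ Suc (n + j) + K * ((1 / 2) ^ n - (1 / 2) ^ (n + j)) =
        K * ((1 / 2) ^ n - (1 / 2) ^ (n + Suc j))"
      by (simp add: algebra_simps)
    ultimately show ?case using step[of "n + j"] Suc by linarith
  qed (simp only: add_0_right diff_self mult_zero_right A.N_0 order_refl)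
  have bnd: "nrm (s m - s n) \<le> K * (1 / 2) ^ k" if "m \<ge> k" "n \<ge> k" for m n k
  proof -
    have le: "nrm (s m - s n) \<le> K * (1 / 2) ^ k" if "n \<ge> k" "m \<ge> n" for m n
    proof -
      have "nrm (s m - s n) \<le> K * ((1 / 2) ^ n - (1 / 2) ^ m)"
        using tele[of n "m - n"] that by (simp only: le_add_diff_inverse)
      moreover have "(1 / 2) ^ n - (1 / 2) ^ m \<le> (1 / 2 :: real) ^ k"
        using that power_decreasing[of k n "1 / 2 :: real"]
        by (smt (verit) zero_le_divide_1_iff zero_le_numeral zero_le_power half_gt_zero divide_le_eq_1)
      ultimately show ?thesis using mult_left_mono[OF _ K(1)] by (meson order_trans)
    qed
    then show ?thesis
      using le[of n m] le[of m n] that A.N_diff_commute[OF sA sA, of m n] by (cases "n \<le> m") auto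
  qed
  have null: "(\<lambda>k. K * (1 / 2) ^ k) \<longlonglongrightarrow> 0"
    by (rule tendsto_mult_right_zero) (rule LIMSEQ_power_zero, simp)
  have "\<exists>k. \<forall>m\<ge>k. \<forall>n\<ge>k. nrm (s m - s n) < e" if "e > 0" for e
  proof -
    obtain k where "K * (1 / 2) ^ k < e"
      using order_tendstoD(2)[OF null \<open>e > 0\<close>] by (auto simp: eventually_sequentially)
    then show ?thesis using bnd by (intro exI[of _ k]) (auto intro: le_less_trans)
  qed
  then obtain v where v: "v \<in> A" "(\<lambda>n. nrm (s n - v)) \<longlonglongrightarrow> 0"
    using A_banach[unfolded A.banach_iff, rule_format, of s] sA by blast
  have vu: "u + (v \<circ> u) \<in> A" using u v by (simp add: A_comp)
  have "(\<lambda>n. nrm (s (Suc n) - (u + (v \<circ> u)))) \<longlonglongrightarrow> 0"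
  proof (rule Lim_null_comparison)
    show "(\<lambda>n. nrm (s n - v) * nrm u) \<longlonglongrightarrow> 0"
      using tendsto_mult_right[OF v(2), of "nrm u"] by simp
    have "s (Suc n) - (u + (v \<circ> u)) = (s n - v) \<circ> u" for n
      by (simp add: sS comp_diff_left)
    then show "\<forall>\<^sub>F n in sequentially. norm (nrm (s (Suc n) - (u + (v \<circ> u)))) \<le> nrm (s n - v) * nrm u"
      using comp_norm[OF A_op A_op] u v sA A.diff_mem[OF sA v(1)]
      by (intro always_eventually) (simp add: A_comp)
  qed
  then have "v = u + (v \<circ> u)"
    using A.lim_unique[OF _ v(1) vu LIMSEQ_Suc[OF v(2)]] sA by blast
  then show ?thesis using v by blast
qed

text \<open>No maximal modular left ideal exists. If \<open>u\<close> is a right unit modulo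
  \<open>L\<close>, its quasi-inverse gives u = v - v u in \<open>L\<close>; then a = (a - a u) + a
  u lies in \<open>L\<close> for every \<open>a\<close>.\<close>

lemma radical: "radical_algebra A (\<circ>)"
proof -
  have False if "maximal_modular_left_ideal L A (\<circ>)" for L
  proof -
    have L: "left_ideal_of L A (\<circ>)" "L \<noteq> A"
      and "\<exists>u\<in>A. \<forall>a\<in>A. a - (a \<circ> u) \<in> L"
      using that unfolding maximal_modular_left_ideal_def modular_left_ideal_def by blast+
    then obtain u where u: "u \<in> A" "\<And>a. a \<in> A \<Longrightarrow> a - (a \<circ> u) \<in> L" by blast
    have sub: "L \<subseteq> A" "csubspace L" and mult: "\<And>a x. a \<in> A \<Longrightarrow> x \<in> L \<Longrightarrow> a \<circ> x \<in> L"
      using L unfolding left_ideal_of_def by auto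
    obtain v where v: "v \<in> A" "v = u + (v \<circ> u)" using quasi_inverse[OF u(1)] by blast
    then have "v - (v \<circ> u) = u" by (metis add_diff_cancel_right')
    then have "u \<in> L" using u(2)[OF v(1)] by simp
    have "a \<in> L" if "a \<in> A" for a
      using complex_vector.subspace_add[OF sub(2) u(2)[OF that] mult[OF that \<open>u \<in> L\<close>]] by simp
    then show False using L(2) sub(1) by blast
  qed
  then show ?thesis unfolding radical_algebra_def jacobson_radical_def by blast
qed

text \<open>A left unit fixes every vector \<open>x z\<close> under all its iterates, while the
  iterates of a quasinilpotent element tend to 0.\<close>

lemma no_unit:
  assumes "e \<in> A" "\<And>x. x \<in> A \<Longrightarrow> e \<circ> x = x" "x \<in> A"
  shows "x = 0"
proof -
  obtain K where K: "K \<ge> 0" "\<forall>n. \<forall>z\<in>H. N ((e ^^ n) z) \<le> K * (1 / 2) ^ n * N z"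
    using subsetD[OF A_quasinilpotent assms(1)] unfolding quasinilpotents_def by (force elim: allE[of _ "1 / 2"])
  have "x z = 0" if "z \<in> H" for z
  proof -
    have "e (x z) = x z" using fun_cong[OF assms(2)[OF assms(3)], of z] by simp
    then have "(e ^^ n) (x z) = x z" for n by (induction n) simp_all
    then have le: "N (x z) \<le> K * (1 / 2) ^ n * N (x z)" for n
      using K(2) A_app[OF assms(3) that] by metis
    have "(\<lambda>n. K * (1 / 2) ^ n * N (x z)) \<longlonglongrightarrow> 0"
      by (intro tendsto_mult_left_zero tendsto_mult_right_zero LIMSEQ_power_zero) simp
    then have "N (x z) \<le> 0" by (rule LIMSEQ_le_const) (use le in blast)
    then show ?thesis
      using N_nonneg[OF A_app[OF assms(3) that]] N_eq_0[OF A_app[OF assms(3) that]] by simp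
  qed
  then show ?thesis using P.op_off[OF A_op[OF assms(3)]] by (metis ext zero_fun_apply)
qed

subsection \<open>Approximate units and failure of compactness\<close>

text \<open>The elements on which the sequence acts as an approximate unit form a closed subalgebra;
  closedness uses the uniform norm bound 1. It is enough to contain \<open>J (p 0)\<close>, where
  \<open>J_assoc\<close> and the continuity of \<open>J\<close> reduce the claim to convergence in
  \<open>H\<close>.\<close>

lemma approx_unit_tendsto:
  assumes e: "\<And>n. e n \<in> H" "\<And>n. nrm (J (e n)) \<le> 1" "(\<lambda>n. N (J (e n) (p 0) - p 0)) \<longlonglongrightarrow> 0"
    and x: "x \<in> A"
  shows "(\<lambda>n. nrm ((J (e n) \<circ> x) - x)) \<longlonglongrightarrow> 0"
proof -
  define B where "B = {x\<in>A. (\<lambda>n. nrm ((J (e n) \<circ> x) - x)) \<longlonglongrightarrow> 0}"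
  have E: "J (e n) \<in> A" for n using e J_A by blast
  have EA: "(J (e n) \<circ> x) - x \<in> A" if "x \<in> A" for x n using that E A_comp by simp
  have "B = A"
  proof (rule generated_A)
    show "csubspace B"
    proof (rule complex_vector.subspaceI)
      have "J (e n) \<circ> (0 :: 'a \<Rightarrow> 'a) = 0" for n
        by (rule ext) (simp add: P.op_0[OF J_mem[OF e(1)]])
      then show "0 \<in> B" by (simp add: B_def)
    next
      fix x y assume x: "x \<in> B" and y: "y \<in> B"
      have eq: "(J (e n) \<circ> (x + y)) - (x + y) = ((J (e n) \<circ> x) - x) + ((J (e n) \<circ> y) - y)" for n
      proof
        fix z
        show "((J (e n) \<circ> (x + y)) - (x + y)) z = (((J (e n) \<circ> x) - x) + ((J (e n) \<circ> y) - y)) z"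
          using x y by (cases "z \<in> H") (simp_all add: B_def P.op_add[OF J_mem[OF e(1)]] A_app P.op_off[OF A_op] P.op_0[OF J_mem[OF e(1)]])
      qed
      have "(\<lambda>n. nrm ((J (e n) \<circ> (x + y)) - (x + y))) \<longlonglongrightarrow> 0"
      proof (rule Lim_null_comparison)
        show "(\<lambda>n. nrm ((J (e n) \<circ> x) - x) + nrm ((J (e n) \<circ> y) - y)) \<longlonglongrightarrow> 0"
          using x y tendsto_add[of "\<lambda>n. nrm ((J (e n) \<circ> x) - x)" 0 sequentially "\<lambda>n. nrm ((J (e n) \<circ> y) - y)" 0]
          by (simp add: B_def)
        show "\<forall>\<^sub>F n in sequentially. norm (nrm ((J (e n) \<circ> (x + y)) - (x + y))) \<le>
            nrm ((J (e n) \<circ> x) - x) + nrm ((J (e n) \<circ> y) - y)"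
          using A.N_triangle[OF EA[of x] EA[of y]] EA[of "x + y"] x y
          by (intro always_eventually) (simp add: B_def eq)
      qed
      then show "x + y \<in> B" using x y by (simp add: B_def)
    next
      fix c x assume x: "x \<in> B"
      have eq: "(J (e n) \<circ> (c *\<^sub>C x)) - (c *\<^sub>C x) = c *\<^sub>C ((J (e n) \<circ> x) - x)" for n
      proof
        fix z
        show "((J (e n) \<circ> (c *\<^sub>C x)) - (c *\<^sub>C x)) z = (c *\<^sub>C ((J (e n) \<circ> x) - x)) z"
          using x by (cases "z \<in> H") (simp_all add: B_def scaleC_fun_def P.op_scale[OF J_mem[OF e(1)]]
            A_app P.op_off[OF A_op] P.op_0[OF J_mem[OF e(1)]] complex_vector.scale_right_diff_distrib)
      qed
      have "(\<lambda>n. cmod c * nrm ((J (e n) \<circ> x) - x)) \<longlonglongrightarrow> 0"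
        using x by (intro tendsto_mult_right_zero) (simp add: B_def)
      then show "c *\<^sub>C x \<in> B" using x EA[of x] unfolding B_def by (simp add: eq)
    qed
    show "x \<circ> y \<in> B" if x: "x \<in> B" and y: "y \<in> B" for x y
    proof -
      \<comment> \<open>For a product, convergence at the left factor is already enough.\<close>
      have eq: "(J (e n) \<circ> (x \<circ> y)) - (x \<circ> y) = ((J (e n) \<circ> x) - x) \<circ> y" for n
        by (rule ext) simp
      have "(\<lambda>n. nrm ((J (e n) \<circ> (x \<circ> y)) - (x \<circ> y))) \<longlonglongrightarrow> 0"
      proof (rule Lim_null_comparison)
        show "(\<lambda>n. nrm ((J (e n) \<circ> x) - x) * nrm y) \<longlonglongrightarrow> 0"
          using x by (intro tendsto_mult_left_zero) (simp add: B_def)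
        show "\<forall>\<^sub>F n in sequentially. norm (nrm ((J (e n) \<circ> (x \<circ> y)) - (x \<circ> y))) \<le> nrm ((J (e n) \<circ> x) - x) * nrm y"
          using comp_norm[OF A_op[OF EA] A_op] EA[of "x \<circ> y"] x y
          unfolding eq by (intro always_eventually) (simp add: B_def A_comp EA)
      qed
      then show ?thesis using x y by (simp add: B_def A_comp)
    qed
    show "closedin (norm_topology A nrm) B"
      unfolding A.closedin_iff
    proof (intro conjI ballI impI)
      show "B \<subseteq> A" by (auto simp: B_def)
      fix x assume x: "x \<in> A" and *: "\<forall>d>0. \<exists>y\<in>B. nrm (x - y) < d"
      have "(\<lambda>n. nrm ((J (e n) \<circ> x) - x)) \<longlonglongrightarrow> 0"
      proof (rule LIMSEQ_I)
        fix d :: real assume d: "d > 0"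
        obtain y where y: "y \<in> B" "nrm (x - y) < d / 3" using * d by (meson zero_less_divide_iff zero_less_numeral)
        have yA: "y \<in> A" using y by (simp add: B_def)
        have "(\<lambda>n. nrm ((J (e n) \<circ> y) - y)) \<longlonglongrightarrow> 0" using y by (simp add: B_def)
        from order_tendstoD(2)[OF this, of "d / 3"] d
        obtain k where k: "\<And>n. n \<ge> k \<Longrightarrow> nrm ((J (e n) \<circ> y) - y) < d / 3"
          by (auto simp: eventually_sequentially)
        have "nrm ((J (e n) \<circ> x) - x) < d" if "n \<ge> k" for n
        proof -
          have "nrm ((J (e n) \<circ> x) - x) \<le> nrm ((J (e n) \<circ> x) - (J (e n) \<circ> y)) + nrm ((J (e n) \<circ> y) - x)"
            by (rule A.N_diff_triangle) (use E x yA A_comp in auto)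
          moreover have "nrm ((J (e n) \<circ> y) - x) \<le> nrm ((J (e n) \<circ> y) - y) + nrm (y - x)"
            by (rule A.N_diff_triangle) (use E x yA A_comp in auto)
          moreover have "nrm ((J (e n) \<circ> x) - (J (e n) \<circ> y)) \<le> nrm (J (e n)) * nrm (x - y)"
            using comp_norm[OF J_mem[OF e(1)] A_op[OF A.diff_mem[OF x yA]], of n]
              comp_diff_right[OF J_mem[OF e(1)] A_op[OF x] A_op[OF yA]] by simp
          moreover have "nrm (J (e n)) * nrm (x - y) \<le> 1 * nrm (x - y)"
            using e(2) x yA by (intro mult_right_mono) auto
          ultimately show ?thesis
            using k[OF that] y(2) A.N_diff_commute[OF x yA] by linarith
        qed
        then show "\<exists>k. \<forall>n\<ge>k. norm (nrm ((J (e n) \<circ> x) - x) - 0) < d"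
          using EA[OF x] by auto
      qed
      then show "x \<in> B" using x by (simp add: B_def)
    qed
    have eq: "(J (e n) \<circ> J (p 0)) - J (p 0) = J (J (e n) (p 0)) - J (p 0)" for n
      using J_assoc[OF e(1) p_mem] by simp
    have "(\<lambda>n. nrm ((J (e n) \<circ> J (p 0)) - J (p 0))) \<longlonglongrightarrow> 0"
      unfolding eq by (rule J_lim[OF _ p_mem e(3)]) (simp add: e(1) J_app_mem p_mem)
    then show "J (p 0) \<in> B" by (simp add: B_def J_A p_mem)
  qed
  then show ?thesis using x unfolding B_def by blast
qed

lemma approx_unital:
  assumes e: "\<And>n. e n \<in> H" "\<And>n. nrm (J (e n)) \<le> 1" "(\<lambda>n. N (J (e n) (p 0) - p 0)) \<longlonglongrightarrow> 0"
  shows "approximately_unital A nrm (\<circ>)"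
  unfolding approximately_unital_def
proof (intro exI conjI ballI)
  let ?F = "filtermap (\<lambda>n. J (e n)) sequentially"
  show "?F \<noteq> bot" by (simp add: filtermap_bot_iff)
  show "\<forall>\<^sub>F x in ?F. x \<in> A \<and> nrm x \<le> 1"
    using e by (simp_all add: eventually_filtermap J_A)
  fix x assume x: "x \<in> A"
  then have l: "(\<lambda>n. nrm ((J (e n) \<circ> x) - x)) \<longlonglongrightarrow> 0" by (rule approx_unit_tendsto[OF e])
  then show "((\<lambda>y. nrm ((y \<circ> x) - x)) \<longlongrightarrow> 0) ?F" by (simp add: filterlim_filtermap)
  have "J (e n) \<circ> x = x \<circ> J (e n)" for n using J_A_commute[OF x e(1)] .
  then show "((\<lambda>y. nrm ((x \<circ> y) - x)) \<longlongrightarrow> 0) ?F" using l by (simp add: filterlim_filtermap)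
qed

text \<open>The witness is multiplication by \<open>J (p 0)\<close> from both sides. Evaluation at
  the vector \<open>p 0\<close> contributes a third factor, and the triple product of
  \<open>p 0\<close> is \<open>p 2\<close>; this is why the separation is asked for
  \<open>J (p 2)\<close>.\<close>

lemma not_compact:
  assumes g: "\<And>n. g n \<in> H" "\<And>n. nrm (J (g n)) \<le> 1" "d > 0"
    "\<And>m n :: nat. m < n \<Longrightarrow> d \<le> N (J (p 2) (g m) - J (p 2) (g n))"
  shows "\<not> compact_algebra A nrm (\<circ>)"
proof
  assume "compact_algebra A nrm (\<circ>)"
  then have *: "compact_map_on A nrm (\<lambda>x. (J (p 0) \<circ> x) \<circ> J (p 0))"
    unfolding compact_algebra_def using J_A[OF p_mem] by blast
  define T where "T x = (J (p 0) \<circ> x) \<circ> J (p 0)" for x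
  have TA: "T x \<in> A" if "x \<in> A" for x
    unfolding T_def using that J_A[OF p_mem] A_comp by simp
  have app: "T (J (g n)) (p 0) = J (p 2) (g n)" for n
  proof -
    have "T (J (g n)) (p 0) = J (p 0) (J (g n) (p 1))" by (simp add: T_def p_mult)
    also have "\<dots> = J (p 0) (J (p 1) (g n))" using J_commute[OF g(1) p_mem] by simp
    also have "\<dots> = J (p 2) (g n)"
      using fun_cong[OF J_p_comp[of 0 1], of "g n"] by (simp add: numeral_2_eq_2)
    finally show ?thesis .
  qed
  have sep: "d \<le> nrm (T (J (g m)) - T (J (g n))) * N (p 0)" if "m < n" for m n
    using g(4)[OF that] P.op_norm_diff_bound[OF A_op[OF TA[OF J_A[OF g(1)]]] A_op[OF TA[OF J_A[OF g(1)]]] p_mem[of 0], of m n]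
    by (simp add: app)
  \<comment> \<open>The separation itself rules out \<open>p 0 = 0\<close>, since it bounds a
    multiple of \<open>N (p 0)\<close> below by \<open>d > 0\<close>.\<close>
  have pos: "N (p 0) > 0"
  proof (rule ccontr)
    assume "\<not> N (p 0) > 0"
    then have "N (p 0) = 0" using N_nonneg[OF p_mem[of 0]] by linarith
    then show False using sep[of 0 1] g(3) by simp
  qed
  have "\<not> compactin (norm_topology A nrm) (norm_topology A nrm closure_of (T ` {x\<in>A. nrm x \<le> 1}))"
  proof (rule A.not_compactin_separated[where d = "d / N (p 0)"])
    show "T ` {x\<in>A. nrm x \<le> 1} \<subseteq> A" using TA by auto
    show "T (J (g n)) \<in> T ` {x\<in>A. nrm x \<le> 1}" for n using g J_A by blast
    show "0 < d / N (p 0)" using g pos by simp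
    show "d / N (p 0) \<le> nrm (T (J (g m)) - T (J (g n)))" if "m < n" for m n
      using sep[OF that] pos by (simp add: divide_le_eq)
  qed
  then show False using * unfolding compact_map_on_def T_def by blast
qed

end

context hilbert_algebra
begin

subsection \<open>The bidual\<close>

abbreviation Ad :: "(('a \<Rightarrow> 'a) \<Rightarrow> complex) set" where "Ad \<equiv> bounded_ops A nrm UNIV cmod"
abbreviation adn :: "(('a \<Rightarrow> 'a) \<Rightarrow> complex) \<Rightarrow> real" where "adn \<equiv> op_norm A nrm cmod"
abbreviation Add :: "((('a \<Rightarrow> 'a) \<Rightarrow> complex) \<Rightarrow> complex) set" where "Add \<equiv> bounded_ops Ad adn UNIV cmod"

sublocale Cx: cnormed "UNIV :: complex set" cmod
  by (rule cnormed_complex)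

sublocale D: cnormed_pair A nrm "UNIV :: complex set" cmod ..

sublocale E: cnormed_pair Ad adn "UNIV :: complex set" cmod ..

lemma dual_A: "dual A nrm = Ad" and dual_norm_A: "dual_norm A nrm = adn"
  and bidual_A: "bidual A nrm = Add"
  by (simp_all add: dual_def dual_norm_def bidual_def)

lemma scaleC_apply: "(c *\<^sub>C f) x = c *\<^sub>C f x"
  by (simp add: scaleC_fun_def)

text \<open>The vector functional x -> <x z, y>. Those functionals supply all the elements of the
  dual that are needed: \<open>norming\<close> recovers the operator norm from them, and
  \<open>A_eqI\<close> separates points.\<close>

definition vec_functional :: "'a \<Rightarrow> 'a \<Rightarrow> ('a \<Rightarrow> 'a) \<Rightarrow> complex"
  where "vec_functional z y = (\<lambda>x. if x \<in> A then ip (x z) y else 0)"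

lemma vec_functional_bounded:
  assumes "z \<in> H" "y \<in> H"
  shows "vec_functional z y \<in> Ad" "adn (vec_functional z y) \<le> N z * N y"
proof -
  have b: "cmod (vec_functional z y x) \<le> (N z * N y) * nrm x" if "x \<in> A" for x
  proof -
    have "cmod (vec_functional z y x) \<le> N (x z) * N y"
      using Cauchy_Schwarz[OF A_app[OF that assms(1)] assms(2)] that by (simp add: vec_functional_def)
    also have "\<dots> \<le> nrm x * N z * N y"
      using A_norm_app[OF that assms(1)] assms by (intro mult_right_mono) auto
    finally show ?thesis by (simp add: mult_ac)
  qed
  show "vec_functional z y \<in> Ad"
    by (rule D.bounded_opsI[OF _ _ _ b])
      (use assms in \<open>simp_all add: vec_functional_def ip_add_left ip_scale_left A_app scaleC_apply scaleC_complex_def\<close>)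
  show "adn (vec_functional z y) \<le> N z * N y"
    by (rule D.op_norm_le[OF _ b]) (use assms in auto)
qed

text \<open>Testing against \<open>y = c z\<close> turns the pairing into the square of
  \<open>N (c z)\<close>.\<close>

lemma norming:
  assumes "c \<in> A" "K \<ge> 0" "\<And>z y. z \<in> H \<Longrightarrow> y \<in> H \<Longrightarrow> cmod (vec_functional z y c) \<le> K * (N z * N y)"
  shows "nrm c \<le> K"
proof (rule P.op_norm_le[OF assms(2)])
  fix z assume z: "z \<in> H"
  have cz: "c z \<in> H" using A_app[OF assms(1) z] .
  have "cmod (ip (c z) (c z)) = (N (c z))\<^sup>2" using cz by (simp add: ip_self norm_power)
  then have "N (c z) * N (c z) \<le> (K * N z) * N (c z)"
    using assms(3)[OF z cz] assms(1) by (simp add: vec_functional_def power2_eq_square mult_ac)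
  then show "N (c z) \<le> K * N z"
    using N_nonneg[OF cz] N_nonneg[OF z] assms(2) by (cases "N (c z) = 0") auto
qed

lemma A_eqI:
  assumes "c \<in> A" "c' \<in> A" "\<And>\<phi>. \<phi> \<in> Ad \<Longrightarrow> \<phi> c = \<phi> c'"
  shows "c = c'"
proof (rule op_eqI)
  fix z assume z: "z \<in> H"
  show "c z = c' z"
  proof (rule ip_eqI)
    fix y assume "y \<in> H"
    then show "ip (c z) y = ip (c' z) y"
      using assms(3)[OF vec_functional_bounded(1)[OF z]] assms(1,2) by (auto simp: vec_functional_def)
  qed (use z assms A_app in auto)
qed (use assms A_op in auto)

text \<open>The action of the algebra on its dual that occurs in the Arens product. As a function of
  the functional, it is the adjoint of multiplication by \<open>b\<close>.\<close>

definition translate :: "(('a \<Rightarrow> 'a) \<Rightarrow> complex) \<Rightarrow> ('a \<Rightarrow> 'a) \<Rightarrow> ('a \<Rightarrow> 'a) \<Rightarrow> complex"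
  where "translate \<phi> b = (\<lambda>x. if x \<in> A then \<phi> (b \<circ> x) else 0)"

lemma comp_add_right: "b \<in> A \<Longrightarrow> x \<in> A \<Longrightarrow> y \<in> A \<Longrightarrow> b \<circ> (x + y) = (b \<circ> x) + (b \<circ> y)"
proof
  fix z assume "b \<in> A" "x \<in> A" "y \<in> A"
  then show "(b \<circ> (x + y)) z = ((b \<circ> x) + (b \<circ> y)) z"
    by (cases "z \<in> H") (simp_all add: P.op_add[OF A_op] A_app P.op_off[OF A_op] P.op_0[OF A_op])
qed

lemma comp_scale_right: "b \<in> A \<Longrightarrow> x \<in> A \<Longrightarrow> b \<circ> (c *\<^sub>C x) = c *\<^sub>C (b \<circ> x)"
proof
  fix z assume "b \<in> A" "x \<in> A"
  then show "(b \<circ> (c *\<^sub>C x)) z = (c *\<^sub>C (b \<circ> x)) z"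
    by (cases "z \<in> H") (simp_all add: scaleC_fun_def P.op_scale[OF A_op] A_app P.op_off[OF A_op] P.op_0[OF A_op])
qed

lemma translate_bounded:
  assumes "\<phi> \<in> Ad" "b \<in> A"
  shows "translate \<phi> b \<in> Ad" "adn (translate \<phi> b) \<le> adn \<phi> * nrm b"
proof -
  have b: "cmod (translate \<phi> b x) \<le> (adn \<phi> * nrm b) * nrm x" if "x \<in> A" for x
  proof -
    have "cmod (translate \<phi> b x) \<le> adn \<phi> * nrm (b \<circ> x)"
      using D.op_norm_bound[OF assms(1) A_comp[OF assms(2) that]] that by (simp add: translate_def)
    also have "\<dots> \<le> adn \<phi> * (nrm b * nrm x)"
      using comp_norm[OF A_op A_op] assms that D.op_norm_nonneg by (intro mult_left_mono) auto
    finally show ?thesis by (simp add: mult_ac)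
  qed
  show "translate \<phi> b \<in> Ad"
    by (rule D.bounded_opsI[OF _ _ _ b])
      (use assms in \<open>auto simp: translate_def comp_add_right comp_scale_right A_comp D.op_add D.op_scale\<close>)
  show "adn (translate \<phi> b) \<le> adn \<phi> * nrm b"
    by (rule D.op_norm_le[OF _ b]) (use assms D.op_norm_nonneg in auto)
qed

lemma translate_diff:
  assumes "\<phi> \<in> Ad" "b \<in> A" "c \<in> A"
  shows "translate \<phi> (b - c) = translate \<phi> b - translate \<phi> c"
proof
  fix x show "translate \<phi> (b - c) x = (translate \<phi> b - translate \<phi> c) x"
    using D.op_diff[OF assms(1), of "b \<circ> x" "c \<circ> x"] assms by (simp add: translate_def A_comp comp_diff_left)
qed

text \<open>
  For \<open>b = J h\<close> the map \<open>x \<mapsto> b x = J (x h)\<close> factors through the Hilbert space, so its second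
  adjoint takes values in the algebra; these \<open>b\<close> are dense.
\<close>

lemma second_adjoint_J:
  assumes mu: "\<mu> \<in> Add" and h: "h \<in> H"
  shows "\<exists>c\<in>A. \<forall>\<phi>\<in>Ad. \<mu> (translate \<phi> (J h)) = \<phi> c"
proof -
  have add: "vec_functional h (y + y') = vec_functional h y + vec_functional h y'" if "y \<in> H" "y' \<in> H" for y y'
    using that h by (auto simp: vec_functional_def fun_eq_iff ip_add_right A_app)
  have scale: "vec_functional h (c *\<^sub>C y) = cnj c *\<^sub>C vec_functional h y" if "y \<in> H" for c y
    using that h by (auto simp: vec_functional_def fun_eq_iff ip_scale_right A_app scaleC_fun_def scaleC_complex_def)

  let ?K = "op_norm Ad adn cmod \<mu>"
  have K: "?K \<ge> 0" by (rule E.op_norm_nonneg[OF mu])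
  \<comment> \<open>A vector functional is conjugate-linear in its second vector, so the conjugate
    has to be taken before the Riesz theorem applies.\<close>
  have "\<exists>k\<in>H. \<forall>y\<in>H. cnj (\<mu> (vec_functional h y)) = ip y k"
  proof (rule riesz)
    fix y assume y: "y \<in> H"
    have "cmod (\<mu> (vec_functional h y)) \<le> ?K * adn (vec_functional h y)" by (rule E.op_norm_bound[OF mu vec_functional_bounded(1)[OF h y]])
    also have "\<dots> \<le> ?K * (N h * N y)" by (intro mult_left_mono vec_functional_bounded(2) h y K)
    finally show "cmod (cnj (\<mu> (vec_functional h y))) \<le> (?K * N h) * N y" by (simp add: mult_ac)
  qed (simp_all add: add scale E.op_add[OF mu] E.op_scale[OF mu] vec_functional_bounded(1)[OF h] scaleC_complex_def)
  then obtain k where k: "k \<in> H" "\<And>y. y \<in> H \<Longrightarrow> cnj (\<mu> (vec_functional h y)) = ip y k" by blast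
  have "\<mu> (translate \<phi> (J h)) = \<phi> (J k)" if phi: "\<phi> \<in> Ad" for \<phi>
  proof -
    \<comment> \<open>With \<open>q\<close> representing the functional along \<open>J\<close>,
      multiplier identity and commutativity give \<phi> (J h x) = \<phi> (J (x h)) = <x h, q>, a
      vector functional at \<open>h\<close>.\<close>
    have "\<exists>q\<in>H. \<forall>y\<in>H. \<phi> (J y) = ip y q"
    proof (rule riesz)
      fix y assume y: "y \<in> H"
      have "cmod (\<phi> (J y)) \<le> adn \<phi> * nrm (J y)" by (rule D.op_norm_bound[OF phi J_A[OF y]])
      also have "\<dots> \<le> adn \<phi> * (C * N y)"
        by (intro mult_left_mono J_bound y D.op_norm_nonneg[OF phi])
      finally show "cmod (\<phi> (J y)) \<le> (adn \<phi> * C) * N y" by (simp add: mult_ac)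
    qed (simp_all add: J_add J_scale D.op_add[OF phi] D.op_scale[OF phi] J_A scaleC_complex_def)
    then obtain q where q: "q \<in> H" "\<And>y. y \<in> H \<Longrightarrow> \<phi> (J y) = ip y q" by blast
    have "translate \<phi> (J h) = vec_functional h q"
    proof
      fix x show "translate \<phi> (J h) x = vec_functional h q x"
        using A_J[of x h] J_A_commute[of x h] h q A_app[of x h] by (simp add: translate_def vec_functional_def)
    qed
    then have "\<mu> (translate \<phi> (J h)) = cnj (ip q k)" using k(2)[OF q(1)] by (metis complex_cnj_cnj)
    then show ?thesis using ip_commute[OF q(1) k(1)] q(2)[OF k(1)] by simp
  qed
  then show ?thesis using J_A[OF k(1)] by blast
qed

text \<open>Approximate \<open>b\<close> by operators \<open>J (h n)\<close> and let
  \<open>c n\<close> represent them. By \<open>norming\<close>, the distances of the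
  \<open>c n\<close> are at most the norm of \<open>\<mu>\<close> times those of the
  \<open>J (h n)\<close>, so completeness of \<open>A\<close> supplies the element for
  \<open>b\<close>.\<close>

lemma second_adjoint:
  assumes mu: "\<mu> \<in> Add" and b: "b \<in> A"
  shows "\<exists>c\<in>A. \<forall>\<phi>\<in>Ad. \<mu> (translate \<phi> b) = \<phi> c"
proof -
  let ?K = "op_norm Ad adn cmod \<mu>"
  have K: "?K \<ge> 0" by (rule E.op_norm_nonneg[OF mu])
  obtain h where h: "\<And>n. h n \<in> H" "(\<lambda>n. nrm (J (h n) - b)) \<longlonglongrightarrow> 0"
    using A_seq[OF b] by blast
  have JA: "J (h n) \<in> A" for n using h J_A by blast
  have "\<forall>n. \<exists>c\<in>A. \<forall>\<phi>\<in>Ad. \<mu> (translate \<phi> (J (h n))) = \<phi> c"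
    using second_adjoint_J[OF mu h(1)] by blast
  then obtain c where c: "\<And>n. c n \<in> A" "\<And>n \<phi>. \<phi> \<in> Ad \<Longrightarrow> \<mu> (translate \<phi> (J (h n))) = \<phi> (c n)"
    by metis
  have mu_le: "cmod (\<mu> (translate \<phi> x)) \<le> ?K * (adn \<phi> * nrm x)" if "\<phi> \<in> Ad" "x \<in> A" for \<phi> x
    using E.op_norm_bound[OF mu translate_bounded(1)[OF that]] mult_left_mono[OF translate_bounded(2)[OF that] K] by simp
  have mu_diff: "\<mu> (translate \<phi> (x - y)) = \<mu> (translate \<phi> x) - \<mu> (translate \<phi> y)" if "\<phi> \<in> Ad" "x \<in> A" "y \<in> A" for \<phi> x y
    using E.op_diff[OF mu translate_bounded(1) translate_bounded(1), of \<phi> x \<phi> y] that by (simp add: translate_diff)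
  have dist: "nrm (c m - c n) \<le> ?K * nrm (J (h m) - J (h n))" for m n
  proof (rule norming)
    fix z y assume zy: "z \<in> H" "y \<in> H"
    have eq: "vec_functional z y (c m - c n) = \<mu> (translate (vec_functional z y) (J (h m) - J (h n)))"
      using mu_diff[OF vec_functional_bounded(1)[OF zy] JA JA] c(2)[OF vec_functional_bounded(1)[OF zy]] D.op_diff[OF vec_functional_bounded(1)[OF zy] c(1) c(1)] by simp
    have le: "cmod (\<mu> (translate (vec_functional z y) (J (h m) - J (h n)))) \<le> ?K * (adn (vec_functional z y) * nrm (J (h m) - J (h n)))"
      by (rule mu_le[OF vec_functional_bounded(1)[OF zy] A.diff_mem[OF JA JA]])
    have "?K * (adn (vec_functional z y) * nrm (J (h m) - J (h n))) \<le> ?K * ((N z * N y) * nrm (J (h m) - J (h n)))"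
      by (rule mult_left_mono[OF mult_right_mono[OF vec_functional_bounded(2)[OF zy] A.N_nonneg[OF A.diff_mem[OF JA JA]]] K])
    with le show "cmod (vec_functional z y (c m - c n)) \<le> ?K * nrm (J (h m) - J (h n)) * (N z * N y)"
      unfolding eq by (simp only: mult_ac)
  qed (use K JA c in auto)
  have "\<exists>k. \<forall>m\<ge>k. \<forall>n\<ge>k. nrm (c m - c n) < e" if e: "e > 0" for e
  proof -
    \<comment> \<open>The norm of \<open>\<mu>\<close> plus 1, so that division is possible also
      when \<open>\<mu>\<close> is 0.\<close>
    define q where "q = ?K + 1"
    have q: "q > 0" "?K < q" using K by (simp_all add: q_def)
    define d where "d = e / q / 2"
    have d: "d > 0" using e q by (simp add: d_def)
    obtain k where k: "\<And>n. n \<ge> k \<Longrightarrow> nrm (J (h n) - b) < d"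
      using order_tendstoD(2)[OF h(2) d] by (auto simp: eventually_sequentially)
    have "nrm (c m - c n) < e" if "m \<ge> k" "n \<ge> k" for m n
    proof -
      have "nrm (J (h m) - J (h n)) \<le> nrm (J (h m) - b) + nrm (b - J (h n))"
        by (rule A.N_diff_triangle[OF JA b JA])
      then have "nrm (J (h m) - J (h n)) \<le> 2 * d"
        using k[OF that(1)] k[OF that(2)] A.N_diff_commute[OF b JA, of n] by linarith
      then have "nrm (c m - c n) \<le> ?K * (2 * d)"
        using dist[of m n] mult_left_mono[OF _ K] by (meson order_trans)
      also have "\<dots> < q * (2 * d)" using d q by simp
      also have "\<dots> = e" using q by (simp add: d_def)
      finally show ?thesis .
    qed
    then show ?thesis by blast
  qed
  then obtain l where l: "l \<in> A" "(\<lambda>n. nrm (c n - l)) \<longlonglongrightarrow> 0"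
    using A_banach[unfolded A.banach_iff, rule_format, of c] c(1) by blast
  have "\<mu> (translate \<phi> b) = \<phi> l" if phi: "\<phi> \<in> Ad" for \<phi>
  proof -
    have 1: "(\<lambda>n. \<phi> (c n) - \<phi> l) \<longlonglongrightarrow> 0"
      using D.op_cont[OF phi c(1) l] by (simp add: tendsto_norm_zero_iff)
    have 2: "(\<lambda>n. \<phi> (c n) - \<mu> (translate \<phi> b)) \<longlonglongrightarrow> 0"
    proof (rule Lim_null_comparison)
      show "(\<lambda>n. ?K * (adn \<phi> * nrm (J (h n) - b))) \<longlonglongrightarrow> 0"
        by (intro tendsto_mult_right_zero h(2))
      show "\<forall>\<^sub>F n in sequentially. norm (\<phi> (c n) - \<mu> (translate \<phi> b)) \<le> ?K * (adn \<phi> * nrm (J (h n) - b))"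
        using mu_le[OF phi A.diff_mem[OF JA b]] mu_diff[OF phi JA b] c(2)[OF phi] by simp
    qed
    show ?thesis by (rule LIMSEQ_unique[OF LIM_zero_cancel[OF 2] LIM_zero_cancel[OF 1]])
  qed
  then show ?thesis using l by blast
qed

lemma embedding:
  assumes "x \<in> A"
  shows "bidual_embedding A nrm x \<in> Add" and "\<phi> \<in> Ad \<Longrightarrow> bidual_embedding A nrm x \<phi> = \<phi> x"
proof -
  have b: "cmod (bidual_embedding A nrm x \<phi>) \<le> nrm x * adn \<phi>" if "\<phi> \<in> Ad" for \<phi>
    using D.op_norm_bound[OF that assms] that by (simp add: bidual_embedding_def dual_A mult.commute)
  show "bidual_embedding A nrm x \<in> Add"
    by (rule E.bounded_opsI[OF _ _ _ b])
      (use D.ops.add_mem D.ops.scale_mem in \<open>simp_all add: bidual_embedding_def dual_A scaleC_fun_def\<close>)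
qed (simp add: bidual_embedding_def dual_A)

lemma embedding_subspace: "csubspace (bidual_embedding A nrm ` A)"
proof (rule complex_vector.subspaceI)
  have "bidual_embedding A nrm 0 = 0"
    by (rule ext) (simp add: bidual_embedding_def dual_A D.op_0)
  then show "0 \<in> bidual_embedding A nrm ` A" using A.zero_mem by (metis imageI)
next
  fix \<mu> \<nu> assume "\<mu> \<in> bidual_embedding A nrm ` A" "\<nu> \<in> bidual_embedding A nrm ` A"
  then obtain x y where xy: "x \<in> A" "y \<in> A" "\<mu> = bidual_embedding A nrm x" "\<nu> = bidual_embedding A nrm y" by blast
  have "\<mu> + \<nu> = bidual_embedding A nrm (x + y)"
    using xy by (intro ext) (simp add: bidual_embedding_def dual_A D.op_add)
  then show "\<mu> + \<nu> \<in> bidual_embedding A nrm ` A" using xy A.add_mem by (metis imageI)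
next
  fix c \<mu> assume "\<mu> \<in> bidual_embedding A nrm ` A"
  then obtain x where x: "x \<in> A" "\<mu> = bidual_embedding A nrm x" by blast
  have "c *\<^sub>C \<mu> = bidual_embedding A nrm (c *\<^sub>C x)"
    using x by (intro ext) (simp add: bidual_embedding_def dual_A D.op_scale scaleC_apply scaleC_complex_def)
  then show "c *\<^sub>C \<mu> \<in> bidual_embedding A nrm ` A" using x A.scale_mem by (metis imageI)
qed

text \<open>With one factor in the embedded algebra, both orders of the product collapse to the
  second adjoint of multiplication by \<open>b\<close>, so a single application of
  \<open>second_adjoint\<close> settles the left and the right ideal property.\<close>

lemma arens:
  assumes "\<mu> \<in> Add" "b \<in> A"
  shows "arens_product A nrm (\<circ>) \<mu> (bidual_embedding A nrm b) = (\<lambda>\<phi>. if \<phi> \<in> Ad then \<mu> (translate \<phi> b) else 0)"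
    and "arens_product A nrm (\<circ>) (bidual_embedding A nrm b) \<mu> = (\<lambda>\<phi>. if \<phi> \<in> Ad then \<mu> (translate \<phi> b) else 0)"
proof -
  have 0: "(\<lambda>y. if y \<in> A then \<phi> (x \<circ> y) else 0) = translate \<phi> x" for \<phi> x
    by (simp add: translate_def)
  \<comment> \<open>Commutativity enters here: the definition yields multiplication by
    \<open>b\<close> from the right.\<close>
  have 1: "(\<lambda>x. if x \<in> A then bidual_embedding A nrm b (translate \<phi> x) else 0) = translate \<phi> b" if "\<phi> \<in> Ad" for \<phi>
  proof
    fix x show "(if x \<in> A then bidual_embedding A nrm b (translate \<phi> x) else 0) = translate \<phi> b x"
      using embedding(2)[OF assms(2) translate_bounded(1)[OF that, of x]] A_commute[of x b] assms by (simp add: translate_def)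
  qed
  show "arens_product A nrm (\<circ>) \<mu> (bidual_embedding A nrm b) = (\<lambda>\<phi>. if \<phi> \<in> Ad then \<mu> (translate \<phi> b) else 0)"
    unfolding arens_product_def dual_A 0 using 1 by (intro ext) simp
  \<comment> \<open>The embedding of \<open>b\<close> is evaluation at \<open>b\<close> only on the
    dual and 0 elsewhere, so the inner functional must be shown to be bounded and linear.\<close>
  have 2: "(\<lambda>x. if x \<in> A then \<mu> (translate \<phi> x) else 0) \<in> Ad" if phi: "\<phi> \<in> Ad" for \<phi>
  proof (rule D.bounded_opsI)
    fix x assume x: "x \<in> A"
    show "cmod (if x \<in> A then \<mu> (translate \<phi> x) else 0) \<le> (op_norm Ad adn cmod \<mu> * adn \<phi>) * nrm x"
      using E.op_norm_bound[OF assms(1) translate_bounded(1)[OF phi x]]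
        mult_left_mono[OF translate_bounded(2)[OF phi x] E.op_norm_nonneg[OF assms(1)]] x by (simp add: mult.assoc)
  next
    fix x y assume xy: "x \<in> A" "y \<in> A"
    have "translate \<phi> (x + y) = translate \<phi> x + translate \<phi> y"
    proof
      fix z show "translate \<phi> (x + y) z = (translate \<phi> x + translate \<phi> y) z"
        using D.op_add[OF phi A_comp[OF xy(1)] A_comp[OF xy(2)], of z z] xy
        by (simp add: translate_def plus_fun_def o_def)
    qed
    then show "(if x + y \<in> A then \<mu> (translate \<phi> (x + y)) else 0) =
        (if x \<in> A then \<mu> (translate \<phi> x) else 0) + (if y \<in> A then \<mu> (translate \<phi> y) else 0)"
      using xy E.op_add[OF assms(1) translate_bounded(1)[OF phi xy(1)] translate_bounded(1)[OF phi xy(2)]] by simp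
  next
    fix c x assume x: "x \<in> A"
    have "translate \<phi> (c *\<^sub>C x) = c *\<^sub>C translate \<phi> x"
    proof
      fix z show "translate \<phi> (c *\<^sub>C x) z = (c *\<^sub>C translate \<phi> x) z"
        using D.op_scale[OF phi A_comp[OF x], of z c] x
        by (simp add: translate_def scaleC_fun_def o_def)
    qed
    then show "(if c *\<^sub>C x \<in> A then \<mu> (translate \<phi> (c *\<^sub>C x)) else 0) = c *\<^sub>C (if x \<in> A then \<mu> (translate \<phi> x) else 0)"
      using x E.op_scale[OF assms(1) translate_bounded(1)[OF phi x]] by simp
  qed simp_all
  show "arens_product A nrm (\<circ>) (bidual_embedding A nrm b) \<mu> = (\<lambda>\<phi>. if \<phi> \<in> Ad then \<mu> (translate \<phi> b) else 0)"
    unfolding arens_product_def dual_A 0 using embedding(2)[OF assms(2) 2] assms(2) by (intro ext) simp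
qed

lemma ideal_in_bidual: "ideal_in_bidual A nrm (\<circ>)"
proof -
  have *: "(\<lambda>\<phi>. if \<phi> \<in> Ad then \<mu> (translate \<phi> b) else 0) \<in> bidual_embedding A nrm ` A"
    if mu: "\<mu> \<in> Add" and b: "b \<in> A" for \<mu> b
  proof -
    obtain c where c: "c \<in> A" "\<And>\<phi>. \<phi> \<in> Ad \<Longrightarrow> \<mu> (translate \<phi> b) = \<phi> c"
      using second_adjoint[OF mu b] by blast
    have "(\<lambda>\<phi>. if \<phi> \<in> Ad then \<mu> (translate \<phi> b) else 0) = bidual_embedding A nrm c"
      using c by (intro ext) (simp add: bidual_embedding_def dual_A)
    then show ?thesis using c(1) by blast
  qed
  show ?thesis
    unfolding ideal_in_bidual_def ideal_of_def left_ideal_of_def bidual_A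
    using embedding(1) embedding_subspace * arens by auto
qed

subsection \<open>Weak compactness\<close>

lemma topspace_weak: "topspace (weak_topology A nrm) = A"
proof -
  have "(\<lambda>_. 0) \<in> Ad" using D.ops.zero_mem by (simp add: zero_fun_def)
  then have "A \<in> {{x \<in> A. \<phi> x \<in> U} |\<phi> U. \<phi> \<in> Ad \<and> open U}"
    by (intro CollectI exI[of _ "\<lambda>_. 0"] exI[of _ UNIV]) auto
  then have "\<Union> {{x \<in> A. \<phi> x \<in> U} |\<phi> U. \<phi> \<in> Ad \<and> open U} = A" by blast
  then show ?thesis unfolding weak_topology_def dual_A topology_generated_by_topspace .
qed

lemma openin_weak: "\<phi> \<in> Ad \<Longrightarrow> open U \<Longrightarrow> openin (weak_topology A nrm) {x \<in> A. \<phi> x \<in> U}"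
  unfolding weak_topology_def dual_A by (rule topology_generated_by_Basis) blast

text \<open>It makes compact sets weakly closed, so that the weak closure of a set stays inside a
  compact set containing it.\<close>

lemma Hausdorff_weak: "Hausdorff_space (weak_topology A nrm)"
  unfolding Hausdorff_space_def topspace_weak
proof (intro allI impI, elim conjE)
  fix x y assume xy: "x \<in> A" "y \<in> A" "x \<noteq> y"
  then obtain \<phi> where phi: "\<phi> \<in> Ad" "\<phi> x \<noteq> \<phi> y" using A_eqI by blast
  then obtain U V where UV: "open U" "open V" "\<phi> x \<in> U" "\<phi> y \<in> V" "U \<inter> V = {}"
    using hausdorff[OF phi(2)] by blast
  show "\<exists>U V. openin (weak_topology A nrm) U \<and> openin (weak_topology A nrm) V \<and> x \<in> U \<and> y \<in> V \<and> disjnt U V"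
    using xy phi UV openin_weak
    by (intro exI[of _ "{x \<in> A. \<phi> x \<in> U}"] exI[of _ "{x \<in> A. \<phi> x \<in> V}"]) (auto simp: disjnt_def)
qed

text \<open>The closed unit ball of the bidual. As a set of functions on the dual it carries the
  weak-star topology, and \<open>alaoglu\<close> applies with the dual as the normed space.\<close>

definition Ball :: "((('a \<Rightarrow> 'a) \<Rightarrow> complex) \<Rightarrow> complex) set"
  where "Ball = {\<mu> \<in> Add. \<forall>\<phi>\<in>Ad. cmod (\<mu> \<phi>) \<le> adn \<phi>}"

lemma Ball_compact: "compact Ball"
  using D.ops.alaoglu unfolding Ball_def dual_def .

lemma embedding_Ball: "x \<in> A \<Longrightarrow> nrm x \<le> 1 \<Longrightarrow> bidual_embedding A nrm x \<in> Ball"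
proof -
  assume x: "x \<in> A" "nrm x \<le> 1"
  have "cmod (\<phi> x) \<le> adn \<phi>" if "\<phi> \<in> Ad" for \<phi>
    using D.op_norm_bound[OF that x(1)] mult_left_mono[OF x(2) D.op_norm_nonneg[OF that]] by simp
  then show ?thesis using embedding[OF x(1)] by (simp add: Ball_def)
qed

text \<open>By commutativity, a x a equals b x with b = a a. The map \<open>T\<close>, the second
  adjoint of multiplication by \<open>b\<close>, lands in \<open>A\<close>; it is continuous from
  the weak-star to the weak topology, and the image of \<open>Ball\<close> is a weakly compact set
  containing all b x with \<open>x\<close> in the unit ball.\<close>

lemma weakly_compact: "weakly_compact_algebra A nrm (\<circ>)"
  unfolding weakly_compact_algebra_def
proof
  fix a assume a: "a \<in> A"
  define b where "b = a \<circ> a"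
  have b: "b \<in> A" using a by (simp add: b_def A_comp)
  have "\<forall>\<mu>\<in>Add. \<exists>c. c \<in> A \<and> (\<forall>\<phi>\<in>Ad. \<mu> (translate \<phi> b) = \<phi> c)" using second_adjoint b by blast
  then obtain T where T: "\<And>\<mu>. \<mu> \<in> Add \<Longrightarrow> T \<mu> \<in> A" "\<And>\<mu> \<phi>. \<mu> \<in> Add \<Longrightarrow> \<phi> \<in> Ad \<Longrightarrow> \<mu> (translate \<phi> b) = \<phi> (T \<mu>)"
    by metis
  have sub: "Ball \<subseteq> Add" by (auto simp: Ball_def)
  have "continuous_map (top_of_set Ball) (weak_topology A nrm) T"
    unfolding weak_topology_def dual_A
  proof (rule continuous_on_generated_topo)
    fix U assume "U \<in> {{x \<in> A. \<phi> x \<in> U} |\<phi> U. \<phi> \<in> Ad \<and> open U}"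
    then obtain \<phi> W where W: "\<phi> \<in> Ad" "open W" "U = {x \<in> A. \<phi> x \<in> W}" by blast
    \<comment> \<open>Preimages of subbasic weak sets are given by evaluation at the fixed
      functional \<open>translate \<phi> b\<close>, a coordinate projection.\<close>
    have "T \<mu> \<in> U \<longleftrightarrow> \<mu> (translate \<phi> b) \<in> W" if "\<mu> \<in> Ball" for \<mu>
      using T(1)[OF subsetD[OF sub that]] T(2)[OF subsetD[OF sub that] W(1)] by (simp add: W(3))
    then have "T -` U \<inter> topspace (top_of_set Ball) = Ball \<inter> (\<lambda>\<mu>. \<mu> (translate \<phi> b)) -` W"
      by auto
    moreover have "open ((\<lambda>\<mu>. \<mu> (translate \<phi> b)) -` W)"
      by (rule open_vimage[OF W(2) continuous_on_product_coordinates])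
    ultimately show "openin (top_of_set Ball) (T -` U \<inter> topspace (top_of_set Ball))"
      by (simp add: openin_open_Int)
  next
    show "T ` topspace (top_of_set Ball) \<subseteq> \<Union> {{x \<in> A. \<phi> x \<in> U} |\<phi> U. \<phi> \<in> Ad \<and> open U}"
      using topspace_weak T(1)[OF subsetD[OF sub]]
      unfolding weak_topology_def dual_A topology_generated_by_topspace by (simp add: image_subsetI)
  qed
  moreover have "compactin (top_of_set Ball) Ball"
    using Ball_compact by (simp add: compactin_subtopology)
  ultimately have K: "compactin (weak_topology A nrm) (T ` Ball)"
    by (rule image_compactin[rotated])
  have img: "(\<lambda>x. (a \<circ> x) \<circ> a) ` {x \<in> A. nrm x \<le> 1} \<subseteq> T ` Ball"
  proof clarify
    fix x assume x: "x \<in> A" "nrm x \<le> 1"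
    let ?e = "bidual_embedding A nrm x"
    have eB: "?e \<in> Ball" by (rule embedding_Ball[OF x])
    have "T ?e = b \<circ> x"
    proof (rule A_eqI)
      fix \<phi> assume phi: "\<phi> \<in> Ad"
      have "?e (translate \<phi> b) = \<phi> (T ?e)" using T(2)[OF _ phi] eB sub by blast
      moreover have "?e (translate \<phi> b) = \<phi> (b \<circ> x)"
        using embedding(2)[OF x(1) translate_bounded(1)[OF phi b]] x by (simp add: translate_def)
      ultimately show "\<phi> (T ?e) = \<phi> (b \<circ> x)" by simp
    qed (use T(1) eB sub b x A_comp in auto)
    also have "b \<circ> x = (a \<circ> x) \<circ> a"
      unfolding b_def using A_commute[OF x(1) a] by (simp add: o_assoc[symmetric])
    finally show "(a \<circ> x) \<circ> a \<in> T ` Ball" using eB by (metis imageI)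
  qed
  have "weak_topology A nrm closure_of ((\<lambda>x. (a \<circ> x) \<circ> a) ` {x \<in> A. nrm x \<le> 1}) \<subseteq> T ` Ball"
    by (rule closure_of_minimal[OF img compactin_imp_closedin[OF Hausdorff_weak K]])
  then show "weakly_compact_map_on A nrm (\<lambda>x. (a \<circ> x) \<circ> a)"
    unfolding weakly_compact_map_on_def using closed_compactin[OF K] closedin_closure_of by blast
qed

lemma not_reflexive:
  assumes e: "\<And>n. e n \<in> H" "\<And>n. nrm (J (e n)) \<le> 1" "(\<lambda>n. N (J (e n) (p 0) - p 0)) \<longlonglongrightarrow> 0"
    and nz: "p 0 \<noteq> 0"
  shows "\<not> reflexive_space A nrm"
proof
  assume "reflexive_space A nrm"
  then have refl: "bidual_embedding A nrm ` A = Add" by (simp add: reflexive_space_def bidual_A)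
  have E: "J (e n) \<in> A" for n using e J_A by blast
  let ?F = "filtermap (\<lambda>n. bidual_embedding A nrm (J (e n))) sequentially"
  have "?F \<noteq> bot" by (simp add: filtermap_bot_iff)
  moreover have "\<forall>\<^sub>F \<mu> in ?F. \<mu> \<in> Ball"
    using embedding_Ball[OF E e(2)] by (simp add: eventually_filtermap)
  ultimately obtain \<mu> where mu: "\<mu> \<in> Ball" "inf (nhds \<mu>) ?F \<noteq> bot"
    using Ball_compact unfolding compact_filter by blast
  then have "\<mu> \<in> bidual_embedding A nrm ` A" by (auto simp: refl Ball_def)
  then obtain u where u: "u \<in> A" "\<mu> = bidual_embedding A nrm u" by blast
  \<comment> \<open>The point \<open>u\<close> is only a cluster point, but evaluation at a
    functional is continuous, so whenever the scalar sequence does converge, its limit is the value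
    at \<open>u\<close>.\<close>
  have lim: "\<phi> u = L" if phi: "\<phi> \<in> Ad" and L: "(\<lambda>n. \<phi> (J (e n))) \<longlonglongrightarrow> L" for \<phi> L
  proof -
    have "continuous_on UNIV (\<lambda>\<nu> :: (('a \<Rightarrow> 'a) \<Rightarrow> complex) \<Rightarrow> complex. \<nu> \<phi>)"
      by (rule continuous_on_product_coordinates)
    then have "((\<lambda>\<nu>. \<nu> \<phi>) \<longlongrightarrow> \<mu> \<phi>) (at \<mu>)"
      by (simp add: continuous_on_def)
    then have "((\<lambda>\<nu>. \<nu> \<phi>) \<longlongrightarrow> \<mu> \<phi>) (nhds \<mu>)"
      using tendsto_at_iff_tendsto_nhds[of "\<lambda>\<nu>. \<nu> \<phi>" \<mu>] by blast
    then have "((\<lambda>\<nu>. \<nu> \<phi>) \<longlongrightarrow> \<mu> \<phi>) (inf (nhds \<mu>) ?F)"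
      by (rule tendsto_mono[rotated]) simp
    moreover have "((\<lambda>\<nu>. \<nu> \<phi>) \<longlongrightarrow> L) ?F"
      unfolding filterlim_filtermap using L embedding(2)[OF E phi] by simp
    then have "((\<lambda>\<nu>. \<nu> \<phi>) \<longlongrightarrow> L) (inf (nhds \<mu>) ?F)"
      by (rule tendsto_mono[rotated]) simp
    ultimately have "\<mu> \<phi> = L" using tendsto_unique mu(2) by blast
    then show ?thesis using u embedding(2)[OF u(1) phi] by simp
  qed
  have "u \<circ> x = x" if x: "x \<in> A" for x
  proof (rule A_eqI)
    fix \<phi> assume phi: "\<phi> \<in> Ad"
    have "(\<lambda>n. \<phi> (J (e n) \<circ> x) - \<phi> x) \<longlonglongrightarrow> 0"
      using D.op_cont[OF phi _ x approx_unit_tendsto[OF e x]] A_comp[OF E x] by (simp add: tendsto_norm_zero_iff)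
    then have "(\<lambda>n. \<phi> (J (e n) \<circ> x)) \<longlonglongrightarrow> \<phi> x" by (rule LIM_zero_cancel)
    moreover have "\<phi> (J (e n) \<circ> x) = translate \<phi> x (J (e n))" for n
      using A_commute[OF E x, of n] E by (simp add: translate_def)
    ultimately have "(\<lambda>n. translate \<phi> x (J (e n))) \<longlonglongrightarrow> \<phi> x" by simp
    from lim[OF translate_bounded(1)[OF phi x] this] show "\<phi> (u \<circ> x) = \<phi> x"
      using u(1) A_commute[OF u(1) x] by (simp add: translate_def)
  qed (use x u A_comp in auto)
  \<comment> \<open>A unit makes the algebra trivial; then every \<open>J (e n)\<close> is 0, which
    contradicts its convergence to \<open>p 0\<close> at the nonzero vector
    \<open>p 0\<close>.\<close>
  then have "x = 0" if "x \<in> A" for x using no_unit[OF u(1) _ that] by blast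
  then have "J (e n) = 0" for n using E by blast
  then have "J (e n) (p 0) = 0" for n by simp
  then have "(\<lambda>n::nat. N (0 - p 0)) \<longlonglongrightarrow> 0" using e(3) by simp
  then have "N (0 - p 0) = 0" by (simp add: LIMSEQ_const_iff)
  then show False using N_eq_0[of "0 - p 0"] p_mem[of 0] nz diff_mem[OF zero_mem p_mem] by simp
qed

end

section \<open>Classes of functions and their representatives\<close>

lemma abs_mfun_eq_iff:
  assumes "F \<in> borel_measurable borel" "G \<in> borel_measurable borel"
  shows "abs_mfun F = abs_mfun G \<longleftrightarrow> (AE t in lborel. 0 \<le> t \<longrightarrow> F t = G t)"
proof -
  have m: "F \<in> borel_measurable half_line" "G \<in> borel_measurable half_line"
    unfolding half_line_def using assms by (auto intro: measurable_restrict_space1)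
  then have "ae_eq F F" "ae_eq G G" by (auto simp: ae_eq_def)
  then have "abs_mfun F = abs_mfun G \<longleftrightarrow> ae_eq F G"
    using Quotient_rel_abs2[OF Quotient_mfun] Quotient_rel[OF Quotient_mfun, of F G] by blast
  then show ?thesis using m by (simp add: ae_eq_def AE_half_line_iff)
qed

lemma ae_eq_refl: "F \<in> borel_measurable borel \<Longrightarrow> ae_eq F F"
  unfolding ae_eq_def half_line_def by (auto intro: measurable_restrict_space1)

text \<open>A representative defined on the whole line and vanishing on the negatives, so that
  integrals over the half-line become integrals over \<open>lborel\<close>, where translation and
  reflection are available.\<close>

definition fn :: "mfun \<Rightarrow> real \<Rightarrow> complex"
  where "fn f t = indicator {0..} t *\<^sub>R rep_mfun f t"

lemma fn_measurable [measurable]: "fn f \<in> borel_measurable borel"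
proof -
  have "ae_eq (rep_mfun f) (rep_mfun f)"
    using Quotient_rep_reflp[OF Quotient_mfun] .
  then show ?thesis
    unfolding ae_eq_def measurable_half_line_iff by (simp add: fn_def[abs_def])
qed

lemma fn_neg: "t < 0 \<Longrightarrow> fn f t = 0"
  by (simp add: fn_def)

lemma abs_fn: "abs_mfun (fn f) = f"
proof -
  have r: "ae_eq (rep_mfun f) (rep_mfun f)"
    using Quotient_rep_reflp[OF Quotient_mfun] .
  have "ae_eq (fn f) (rep_mfun f)"
    using r ae_eq_refl[OF fn_measurable] by (auto simp: ae_eq_def AE_half_line_iff fn_def)
  then have "abs_mfun (fn f) = abs_mfun (rep_mfun f)"
    using Quotient_rel_abs[OF Quotient_mfun] by blast
  then show ?thesis using Quotient_abs_rep[OF Quotient_mfun] by simp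
qed

lemma fn_abs:
  assumes "F \<in> borel_measurable borel"
  shows "AE t in lborel. 0 \<le> t \<longrightarrow> fn (abs_mfun F) t = F t"
  using abs_mfun_eq_iff[OF fn_measurable assms] abs_fn by blast

lemma abs_mfun_add:
  "F \<in> borel_measurable borel \<Longrightarrow> G \<in> borel_measurable borel \<Longrightarrow>
    abs_mfun F + abs_mfun G = abs_mfun (\<lambda>t. F t + G t)"
  by (rule plus_mfun.abs_eq) (auto intro: ae_eq_refl)

lemma abs_mfun_diff:
  "F \<in> borel_measurable borel \<Longrightarrow> G \<in> borel_measurable borel \<Longrightarrow>
    abs_mfun F - abs_mfun G = abs_mfun (\<lambda>t. F t - G t)"
  by (rule minus_mfun.abs_eq) (auto intro: ae_eq_refl)

lemma abs_mfun_scale: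
  "F \<in> borel_measurable borel \<Longrightarrow> c *\<^sub>C abs_mfun F = abs_mfun (\<lambda>t. c * F t)"
  by (rule scaleC_mfun.abs_eq) (auto intro: ae_eq_refl)

lemma abs_mfun_0: "abs_mfun (\<lambda>_. 0) = 0"
  by (simp add: zero_mfun.abs_eq)

lemma abs_mfun_sum:
  assumes "finite I" "\<And>i. i \<in> I \<Longrightarrow> F i \<in> borel_measurable borel"
  shows "(\<Sum>i\<in>I. abs_mfun (F i)) = abs_mfun (\<lambda>t. \<Sum>i\<in>I. F i t)"
  using assms by (induction I) (simp_all add: abs_mfun_0 abs_mfun_add)

lemma abs_mfun_conv:
  "F \<in> borel_measurable borel \<Longrightarrow> G \<in> borel_measurable borel \<Longrightarrow>
    convolution (abs_mfun F) (abs_mfun G) = abs_mfun (\<lambda>t. LINT s:{0..t}|lborel. F (t - s) * G s)"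
  by (rule convolution.abs_eq) (auto intro: ae_eq_refl)

definition cv :: "(real \<Rightarrow> complex) \<Rightarrow> (real \<Rightarrow> complex) \<Rightarrow> real \<Rightarrow> complex"
  where "cv F G t = (LINT s|lborel. F (t - s) * G s)"

lemma cv_measurable [measurable]:
  assumes [measurable]: "F \<in> borel_measurable borel" "G \<in> borel_measurable borel"
  shows "cv F G \<in> borel_measurable borel"
  unfolding cv_def[abs_def] by measurable

text \<open>Outside \<open>{0..t}\<close> one of the arguments \<open>t - s\<close> and
  \<open>s\<close> is negative, so the integrand vanishes there.\<close>

lemma abs_mfun_cv:
  assumes "F \<in> borel_measurable borel" "G \<in> borel_measurable borel"
    "\<And>t. t < 0 \<Longrightarrow> F t = 0" "\<And>t. t < 0 \<Longrightarrow> G t = 0"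
  shows "convolution (abs_mfun F) (abs_mfun G) = abs_mfun (cv F G)"
proof -
  have "(LINT s:{0..t}|lborel. F (t - s) * G s) = cv F G t" for t
    unfolding cv_def set_lebesgue_integral_def
    by (intro Bochner_Integration.integral_cong) (auto simp: indicator_def assms(3,4))
  then show ?thesis using abs_mfun_conv[OF assms(1,2)] by simp
qed

text \<open>The quotient speaks only about almost all t >= 0; for negative \<open>t\<close> all
  values are 0 by the choice of representative.\<close>

lemma fn_add: "AE t in lborel. fn (f + g) t = fn f t + fn g t"
proof -
  have "f + g = abs_mfun (\<lambda>t. fn f t + fn g t)"
    using abs_mfun_add[of "fn f" "fn g"] by (simp add: abs_fn)
  then have "AE t in lborel. 0 \<le> t \<longrightarrow> fn (f + g) t = fn f t + fn g t"
    using fn_abs[of "\<lambda>t. fn f t + fn g t"] by simp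
  then show ?thesis by eventually_elim (metis add_0 fn_neg not_le)
qed

lemma fn_diff: "AE t in lborel. fn (f - g) t = fn f t - fn g t"
proof -
  have "f - g = abs_mfun (\<lambda>t. fn f t - fn g t)"
    using abs_mfun_diff[of "fn f" "fn g"] by (simp add: abs_fn)
  then have "AE t in lborel. 0 \<le> t \<longrightarrow> fn (f - g) t = fn f t - fn g t"
    using fn_abs[of "\<lambda>t. fn f t - fn g t"] by simp
  then show ?thesis by eventually_elim (metis diff_0_right fn_neg not_le)
qed

lemma fn_scale: "AE t in lborel. fn (c *\<^sub>C f) t = c * fn f t"
proof -
  have "c *\<^sub>C f = abs_mfun (\<lambda>t. c * fn f t)"
    using abs_mfun_scale[of "fn f"] by (simp add: abs_fn)
  then have "AE t in lborel. 0 \<le> t \<longrightarrow> fn (c *\<^sub>C f) t = c * fn f t"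
    using fn_abs[of "\<lambda>t. c * fn f t"] by simp
  then show ?thesis by eventually_elim (metis mult_zero_right fn_neg not_le)
qed

section \<open>Convolution inequalities\<close>

lemma nn_integral_reflect:
  fixes F :: "real \<Rightarrow> ennreal"
  assumes [measurable]: "F \<in> borel_measurable borel"
  shows "(\<integral>\<^sup>+ s. F (t - s) \<partial>lborel) = (\<integral>\<^sup>+ s. F s \<partial>lborel)"
  using nn_integral_real_affine[OF assms, of "- 1" t] by simp

lemma nn_integral_shift:
  fixes F :: "real \<Rightarrow> ennreal"
  assumes [measurable]: "F \<in> borel_measurable borel"
  shows "(\<integral>\<^sup>+ t. F (t - s) \<partial>lborel) = (\<integral>\<^sup>+ s. F s \<partial>lborel)"
  using nn_integral_real_affine[OF assms, of 1 "- s"] by (simp add: add.commute)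

lemma nn_conv_commute:
  fixes F G :: "real \<Rightarrow> ennreal"
  assumes [measurable]: "F \<in> borel_measurable borel" "G \<in> borel_measurable borel"
  shows "(\<integral>\<^sup>+ s. F (t - s) * G s \<partial>lborel) = (\<integral>\<^sup>+ s. G (t - s) * F s \<partial>lborel)"
  using nn_integral_reflect[of "\<lambda>s. F (t - s) * G s" t] by (simp add: mult.commute)

text \<open>Cauchy--Schwarz with respect to the measure with density \<open>F (t - s)\<close>.\<close>

lemma Young_nn:
  fixes F G :: "real \<Rightarrow> ennreal"
  assumes [measurable]: "F \<in> borel_measurable borel" "G \<in> borel_measurable borel"
  shows "(\<integral>\<^sup>+ t. (\<integral>\<^sup>+ s. F (t - s) * G s \<partial>lborel)\<^sup>2 \<partial>lborel) \<le> (\<integral>\<^sup>+ s. F s \<partial>lborel)\<^sup>2 * (\<integral>\<^sup>+ s. (G s)\<^sup>2 \<partial>lborel)"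
proof -
  have "(\<integral>\<^sup>+ s. F (t - s) * G s \<partial>lborel)\<^sup>2 \<le> (\<integral>\<^sup>+ s. F s \<partial>lborel) * (\<integral>\<^sup>+ s. F (t - s) * (G s)\<^sup>2 \<partial>lborel)" for t
  proof -
    have "(\<integral>\<^sup>+ s. 1 * G s \<partial>density lborel (\<lambda>s. F (t - s)))\<^sup>2 \<le>
        (\<integral>\<^sup>+ s. 1\<^sup>2 \<partial>density lborel (\<lambda>s. F (t - s))) * (\<integral>\<^sup>+ s. (G s)\<^sup>2 \<partial>density lborel (\<lambda>s. F (t - s)))"
      by (rule Cauchy_Schwarz_nn_integral) measurable
    then show ?thesis by (simp add: nn_integral_density emeasure_density nn_integral_reflect)
  qed
  then have "(\<integral>\<^sup>+ t. (\<integral>\<^sup>+ s. F (t - s) * G s \<partial>lborel)\<^sup>2 \<partial>lborel) \<le>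
      (\<integral>\<^sup>+ t. (\<integral>\<^sup>+ s. F s \<partial>lborel) * (\<integral>\<^sup>+ s. F (t - s) * (G s)\<^sup>2 \<partial>lborel) \<partial>lborel)"
    by (intro nn_integral_mono)
  also have "\<dots> = (\<integral>\<^sup>+ s. F s \<partial>lborel) * (\<integral>\<^sup>+ t. (\<integral>\<^sup>+ s. F (t - s) * (G s)\<^sup>2 \<partial>lborel) \<partial>lborel)"
    by (rule nn_integral_cmult) measurable
  also have "(\<integral>\<^sup>+ t. (\<integral>\<^sup>+ s. F (t - s) * (G s)\<^sup>2 \<partial>lborel) \<partial>lborel) =
      (\<integral>\<^sup>+ s. (\<integral>\<^sup>+ t. F (t - s) * (G s)\<^sup>2 \<partial>lborel) \<partial>lborel)"
    by (rule lborel_pair.Fubini') measurable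
  also have "\<dots> = (\<integral>\<^sup>+ s. (\<integral>\<^sup>+ t. F t \<partial>lborel) * (G s)\<^sup>2 \<partial>lborel)"
    by (intro nn_integral_cong) (simp add: nn_integral_multc nn_integral_shift)
  also have "\<dots> = (\<integral>\<^sup>+ t. F t \<partial>lborel) * (\<integral>\<^sup>+ s. (G s)\<^sup>2 \<partial>lborel)"
    by (rule nn_integral_cmult) measurable
  finally show ?thesis by (simp add: power2_eq_square mult.assoc)
qed

text \<open>No integrability is assumed, because the Bochner integral of a function that is not
  integrable is 0.\<close>

lemma ennreal_norm_integral_le:
  fixes F :: "'b \<Rightarrow> 'a :: {banach, second_countable_topology}"
  shows "ennreal (norm (integral\<^sup>L M F)) \<le> (\<integral>\<^sup>+ x. ennreal (norm (F x)) \<partial>M)"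
proof (cases "integrable M F")
  case True then show ?thesis by (rule integral_norm_bound_ennreal)
qed (simp add: not_integrable_integral_eq)

lemma ennreal_square_add_le: "(x + y)\<^sup>2 \<le> 2 * x\<^sup>2 + 2 * y\<^sup>2" for x y :: ennreal
proof (cases x; cases y)
  fix a b :: real assume "x = ennreal a" "y = ennreal b" and ab: "0 \<le> a" "0 \<le> b"
  moreover have "(a + b)\<^sup>2 \<le> 2 * a\<^sup>2 + 2 * b\<^sup>2"
    using sum_squares_ge_zero[of "a - b" 0] by (simp add: power2_eq_square algebra_simps)
  moreover have "(ennreal a + ennreal b)\<^sup>2 = ennreal ((a + b)\<^sup>2)"
    using ab by (simp add: ennreal_power flip: ennreal_plus)
  moreover have "2 * (ennreal a)\<^sup>2 + 2 * (ennreal b)\<^sup>2 = ennreal (2 * a\<^sup>2 + 2 * b\<^sup>2)"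
    using ab by (simp add: ennreal_power ennreal_mult)
  ultimately show ?thesis by (metis ennreal_leI)
qed (auto simp: ennreal_mult_eq_top_iff top_power_ennreal)

definition acv :: "(real \<Rightarrow> complex) \<Rightarrow> (real \<Rightarrow> complex) \<Rightarrow> real \<Rightarrow> ennreal"
  where "acv F G t = (\<integral>\<^sup>+ s. ennreal (cmod (F (t - s) * G s)) \<partial>lborel)"

lemma acv_measurable [measurable]:
  assumes [measurable]: "F \<in> borel_measurable borel" "G \<in> borel_measurable borel"
  shows "acv F G \<in> borel_measurable borel"
  unfolding acv_def[abs_def] by measurable

lemma cv_le_acv: "ennreal (cmod (cv F G t)) \<le> acv F G t"
  unfolding cv_def acv_def by (rule ennreal_norm_integral_le)

text \<open>The exponent 1/2 makes the square equal to exp(-s), so that the L2 norm on the half-line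
  is exactly 1.\<close>

definition damp :: "real \<Rightarrow> real" where "damp s = indicator {0..} s * exp (- s / 2)"

lemma damp_measurable [measurable]: "damp \<in> borel_measurable borel"
  unfolding damp_def[abs_def] by measurable

lemma damp_nonneg: "0 \<le> damp s"
  by (simp add: damp_def)

lemma nn_integral_damp_sq: "(\<integral>\<^sup>+ s. (ennreal (damp s))\<^sup>2 \<partial>lborel) = 1"
proof -
  have "(\<integral>\<^sup>+ s. ennreal (exp (- s)) * indicator {0..} s \<partial>lborel) = ennreal (0 - (- exp (- 0)))"
  proof (rule nn_integral_FTC_atLeast)
    show "((\<lambda>s. - exp (- s)) has_real_derivative exp (- s)) (at s)" if "0 \<le> s" for s :: real
      by (auto intro!: derivative_eq_intros)
    show "((\<lambda>s::real. - exp (- s)) \<longlongrightarrow> 0) at_top"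
      using tendsto_minus[OF filterlim_compose[OF exp_at_bot filterlim_uminus_at_bot_at_top]] by simp
  qed auto
  moreover have "(ennreal (damp s))\<^sup>2 = ennreal (exp (- s)) * indicator {0..} s" for s
    by (auto simp: damp_def indicator_def power2_eq_square simp flip: exp_add ennreal_mult)
  ultimately show ?thesis by simp
qed

text \<open>Multiplication by \<open>damp\<close> is a contraction from L2 to L1. This supplies the
  integrable factor in Young's inequality, and almost everywhere convergence in the completeness
  proof.\<close>

lemma damp_Cauchy_Schwarz:
  assumes [measurable]: "G \<in> borel_measurable borel"
  shows "(\<integral>\<^sup>+ s. ennreal (damp s) * G s \<partial>lborel)\<^sup>2 \<le> (\<integral>\<^sup>+ s. (G s)\<^sup>2 \<partial>lborel)"
  using Cauchy_Schwarz_nn_integral[of "\<lambda>s. ennreal (damp s)" lborel G] by (simp add: nn_integral_damp_sq)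

text \<open>\<open>chilbert\<close> presupposes a norm, so the Cauchy-Schwarz and the triangle
  inequality have to be derived here from the inner product alone.\<close>

lemma inner_product_normed:
  assumes H: "csubspace H" and ip: "inner_product_on H ip"
    and N: "\<And>x. x \<in> H \<Longrightarrow> N x = sqrt (Re (ip x x))"
  shows "normed_space_on H N"
proof -
  have add: "ip (x + y) z = ip x z + ip y z" if "x \<in> H" "y \<in> H" "z \<in> H" for x y z
    using conjunct1[OF ip[unfolded inner_product_on_def]] that by simp
  have scale: "ip (c *\<^sub>C x) y = c * ip x y" if "x \<in> H" "y \<in> H" for c x y
    using conjunct1[OF conjunct2[OF ip[unfolded inner_product_on_def]]] that by simp
  have com: "ip y x = cnj (ip x y)" if "x \<in> H" "y \<in> H" for x y
    using conjunct1[OF conjunct2[OF conjunct2[OF ip[unfolded inner_product_on_def]]]] that by metis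
  have pos: "0 \<le> Re (ip x x)" "ip x x = 0 \<longleftrightarrow> x = 0" if "x \<in> H" for x
    using conjunct2[OF conjunct2[OF conjunct2[OF ip[unfolded inner_product_on_def]]]] that by auto
  have mem: "x + y \<in> H" "c *\<^sub>C x \<in> H" if "x \<in> H" "y \<in> H" for x y c
    using that complex_vector.subspace_add[OF H] complex_vector.subspace_scale[OF H] by auto
  have addr: "ip z (x + y) = ip z x + ip z y" if "x \<in> H" "y \<in> H" "z \<in> H" for x y z
    using com[of "x + y" z] com[of x z] com[of y z] that by (simp add: add mem)
  have scaler: "ip y (c *\<^sub>C x) = cnj c * ip y x" if "x \<in> H" "y \<in> H" for c x y
    using com[of "c *\<^sub>C x" y] com[of x y] that by (simp add: scale mem)
  have real: "Im (ip x x) = 0" if "x \<in> H" for x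
    using com[OF that that] by (simp add: complex_eq_iff)
  have sq: "(N x)\<^sup>2 = Re (ip x x)" if "x \<in> H" for x using pos that N by simp
  have N0: "N x \<ge> 0" if "x \<in> H" for x using pos that N by simp
  have eq0: "N x = 0 \<longleftrightarrow> x = 0" if "x \<in> H" for x
    using pos[OF that] real[OF that] N[OF that] by (auto simp: complex_eq_iff)
  have expand: "(N (x + y))\<^sup>2 = (N x)\<^sup>2 + (N y)\<^sup>2 + 2 * Re (ip x y)" if "x \<in> H" "y \<in> H" for x y
    using com[of x y] that by (simp add: sq mem add addr)
  have cs: "Re (ip x y) \<le> N x * N y" if "x \<in> H" "y \<in> H" for x y
  proof (cases "y = 0")
    case True
    then have "ip x y = 0" using scaler[of y x 0] that by simp
    then show ?thesis using N0 that by simp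
  next
    case False
    define b where "b = Re (ip x y)"
    have ny: "N y > 0" using False eq0 N0 that by (metis less_eq_real_def)
    \<comment> \<open>The minimiser of \<open>N (x + t y)\<close> over real \<open>t\<close>;
      nonnegativity at this point is the Cauchy-Schwarz inequality for the real part.\<close>
    define t where "t = - b / (N y)\<^sup>2"
    define z where "z = complex_of_real t *\<^sub>C y"
    have z: "z \<in> H" "Re (ip x z) = t * b" using that by (simp_all add: z_def mem scaler b_def)
    have "(N z)\<^sup>2 = t\<^sup>2 * (N y)\<^sup>2"
      unfolding sq[OF z(1)] sq[OF that(2)] using that by (simp add: z_def mem scale scaler power2_eq_square)
    then have "(N (x + z))\<^sup>2 = (N x)\<^sup>2 + t\<^sup>2 * (N y)\<^sup>2 + 2 * t * b"
      using expand[OF that(1) z(1)] z(2) by simp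
    then have "0 \<le> (N x)\<^sup>2 + t\<^sup>2 * (N y)\<^sup>2 + 2 * t * b" by (metis zero_le_power2)
    also have "\<dots> = (N x)\<^sup>2 - b\<^sup>2 / (N y)\<^sup>2"
      using ny by (simp add: t_def power2_eq_square field_simps)
    finally have "b\<^sup>2 \<le> (N x * N y)\<^sup>2" using ny by (simp add: field_simps power_mult_distrib)
    moreover have "0 \<le> N x * N y" using N0 that by simp
    ultimately show ?thesis unfolding b_def[symmetric] by (rule power2_le_imp_le)
  qed
  have tri: "N (x + y) \<le> N x + N y" if "x \<in> H" "y \<in> H" for x y
  proof (rule power2_le_imp_le)
    show "(N (x + y))\<^sup>2 \<le> (N x + N y)\<^sup>2"
      using expand[OF that] cs[OF that] by (simp add: power2_sum)
  qed (use N0 that in simp)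
  have hom: "N (c *\<^sub>C x) = cmod c * N x" if "x \<in> H" for c x
  proof -
    have "(N (c *\<^sub>C x))\<^sup>2 = Re ((c * cnj c) * ip x x)"
      using that scale[OF that mem(2)[OF that that], of c c] scaler[OF that that, of c]
      by (simp only: sq mem mult.assoc)
    also have "\<dots> = (cmod c * N x)\<^sup>2"
      using that real[OF that] unfolding complex_norm_square[symmetric] by (simp add: sq power_mult_distrib)
    finally show ?thesis
      using N0[OF mem(2)[OF that that]] N0[OF that] by (simp add: power2_eq_iff_nonneg)
  qed
  show ?thesis
    unfolding normed_space_on_def using H N0 eq0 tri hom by (intro conjI ballI allI) simp_all
qed

lemma borel_measurable_cnj [measurable]: "cnj \<in> borel_measurable borel"
  by (intro borel_measurable_continuous_onI continuous_intros)



section \<open>The weighted spaces\<close>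

text \<open>\<open>\<omega>\<close> is controlled only on the half-line; \<open>w\<close> is its
  Borel version, extended by 0. \<open>w_sub2\<close> makes L2 an algebra under convolution, and
  \<open>w_exp\<close>, required for every real \<open>q\<close>, puts all exponentials into
  L2.\<close>

locale weight =
  fixes w \<omega> :: "real \<Rightarrow> real" and K :: real
  assumes w_meas [measurable]: "w \<in> borel_measurable borel"
    and w_eq: "0 \<le> t \<Longrightarrow> \<omega> t = w t"
    and w_neg: "t < 0 \<Longrightarrow> w t = 0"
    and w_pos: "0 \<le> t \<Longrightarrow> 0 < w t"
    and w_sub: "0 \<le> r \<Longrightarrow> 0 \<le> s \<Longrightarrow> w (r + s) \<le> w r * w s"
    and w_sub2: "0 \<le> r \<Longrightarrow> 0 \<le> s \<Longrightarrow> w (r + s) \<le> K * (exp (- r / 2) + exp (- s / 2)) * (w r * w s)"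
    and w_exp: "\<exists>C. \<forall>t\<ge>0. w t \<le> C * exp (- q * t)"
begin

lemma w_nonneg: "0 \<le> w t"
  using w_pos[of t] w_neg[of t] by (cases "t < 0") auto

definition n1 :: "(real \<Rightarrow> complex) \<Rightarrow> ennreal"
  where "n1 F = (\<integral>\<^sup>+ t. ennreal (cmod (F t) * w t) \<partial>lborel)"

text \<open>The square of the norm, kept in \<open>ennreal\<close> so that estimates can be made
  before membership in the space is known.\<close>

definition n2 :: "(real \<Rightarrow> complex) \<Rightarrow> ennreal"
  where "n2 F = (\<integral>\<^sup>+ t. (ennreal (cmod (F t) * w t))\<^sup>2 \<partial>lborel)"

lemma Lp_integral_abs:
  assumes "F \<in> borel_measurable borel"
  shows "mfun_Lp_integral \<omega> 1 (abs_mfun F) = n1 F" "mfun_Lp_integral \<omega> 2 (abs_mfun F) = n2 F"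
proof -
  have *: "mfun_Lp_integral \<omega> p (abs_mfun F) =
      (\<integral>\<^sup>+ t. ennreal (cmod (F t) powr p * \<omega> t powr p) * indicator {0..} t \<partial>lborel)" for p
    using mfun_Lp_integral.abs_eq[OF ae_eq_refl[OF assms], of \<omega> p]
    unfolding half_line_def by (simp add: nn_integral_restrict_space)
  show "mfun_Lp_integral \<omega> 1 (abs_mfun F) = n1 F"
    unfolding * n1_def
    by (intro nn_integral_cong) (auto simp: indicator_def w_eq w_neg w_nonneg)
  show "mfun_Lp_integral \<omega> 2 (abs_mfun F) = n2 F"
    unfolding * n2_def
    by (intro nn_integral_cong)
      (auto simp: indicator_def w_eq w_neg w_nonneg ennreal_power power_mult_distrib)
qed

lemma n2_cong:
  assumes "F \<in> borel_measurable borel" "G \<in> borel_measurable borel" "AE t in lborel. 0 \<le> t \<longrightarrow> F t = G t"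
  shows "n2 F = n2 G"
  using Lp_integral_abs(2)[OF assms(1)] Lp_integral_abs(2)[OF assms(2)] abs_mfun_eq_iff[OF assms(1,2)] assms(3)
  by simp

abbreviation H :: "mfun set" where "H \<equiv> Lp_space \<omega> 2"
abbreviation N :: "mfun \<Rightarrow> real" where "N \<equiv> Lp_norm \<omega> 2"

lemma H_abs: "F \<in> borel_measurable borel \<Longrightarrow> abs_mfun F \<in> H \<longleftrightarrow> n2 F < \<infinity>"
  by (simp add: Lp_space_def Lp_integral_abs)

lemma L1_abs: "F \<in> borel_measurable borel \<Longrightarrow> abs_mfun F \<in> Lp_space \<omega> 1 \<longleftrightarrow> n1 F < \<infinity>"
  by (simp add: Lp_space_def Lp_integral_abs)

lemma H_fn: "f \<in> H \<longleftrightarrow> n2 (fn f) < \<infinity>"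
  using H_abs[OF fn_measurable] by (simp add: abs_fn)

lemma N_abs: "F \<in> borel_measurable borel \<Longrightarrow> N (abs_mfun F) = sqrt (enn2real (n2 F))"
  by (simp add: Lp_norm_def Lp_integral_abs powr_half_sqrt)

lemma N_fn: "N f = sqrt (enn2real (n2 (fn f)))"
  using N_abs[OF fn_measurable] by (simp add: abs_fn)

lemma n2_fn: "f \<in> H \<Longrightarrow> n2 (fn f) = ennreal ((N f)\<^sup>2)"
  by (simp add: N_fn H_fn)

lemma N_le:
  assumes "f \<in> H" "n2 (fn f) \<le> ennreal (c\<^sup>2)" "0 \<le> c"
  shows "N f \<le> c"
proof -
  have "(N f)\<^sup>2 \<le> c\<^sup>2" using assms(2) n2_fn[OF assms(1)] by (simp add: ennreal_le_iff)
  then show ?thesis using assms(3) by (rule power2_le_imp_le)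
qed

lemma n2_add:
  assumes [measurable]: "F \<in> borel_measurable borel" "G \<in> borel_measurable borel"
  shows "n2 (\<lambda>t. F t + G t) \<le> 2 * n2 F + 2 * n2 G"
proof -
  have "n2 (\<lambda>t. F t + G t) \<le> (\<integral>\<^sup>+ t. 2 * (ennreal (cmod (F t) * w t))\<^sup>2 + 2 * (ennreal (cmod (G t) * w t))\<^sup>2 \<partial>lborel)"
    unfolding n2_def
  proof (rule nn_integral_mono)
    fix t
    have "cmod (F t + G t) * w t \<le> cmod (F t) * w t + cmod (G t) * w t"
      using mult_right_mono[OF norm_triangle_ineq[of "F t" "G t"] w_nonneg[of t]] by (simp add: algebra_simps)
    then have "ennreal (cmod (F t + G t) * w t) \<le> ennreal (cmod (F t) * w t) + ennreal (cmod (G t) * w t)"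
      using w_nonneg by (simp flip: ennreal_plus add: ennreal_leI)
    then have "(ennreal (cmod (F t + G t) * w t))\<^sup>2 \<le> (ennreal (cmod (F t) * w t) + ennreal (cmod (G t) * w t))\<^sup>2"
      by (simp add: power_mono)
    then show "(ennreal (cmod (F t + G t) * w t))\<^sup>2 \<le>
        2 * (ennreal (cmod (F t) * w t))\<^sup>2 + 2 * (ennreal (cmod (G t) * w t))\<^sup>2"
      using ennreal_square_add_le order_trans by blast
  qed
  also have "\<dots> = 2 * n2 F + 2 * n2 G"
    unfolding n2_def by (subst nn_integral_add) (simp_all add: nn_integral_cmult)
  finally show ?thesis .
qed

lemma n2_scale:
  assumes [measurable]: "F \<in> borel_measurable borel"
  shows "n2 (\<lambda>t. c * F t) = ennreal ((cmod c)\<^sup>2) * n2 F"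
proof -
  have "(ennreal (cmod (c * F t) * w t))\<^sup>2 = ennreal ((cmod c)\<^sup>2) * (ennreal (cmod (F t) * w t))\<^sup>2" for t
    using w_nonneg by (simp add: norm_mult ennreal_power power_mult_distrib mult_ac flip: ennreal_mult)
  then show ?thesis unfolding n2_def by (simp add: nn_integral_cmult)
qed

lemma n2_mono:
  assumes "\<And>t. 0 \<le> t \<Longrightarrow> cmod (F t) \<le> cmod (G t)"
  shows "n2 F \<le> n2 G"
  unfolding n2_def
proof (rule nn_integral_mono)
  fix t
  have "cmod (F t) * w t \<le> cmod (G t) * w t"
    using assms[of t] w_nonneg[of t] w_neg[of t] by (cases "t < 0") (auto intro: mult_right_mono)
  then show "(ennreal (cmod (F t) * w t))\<^sup>2 \<le> (ennreal (cmod (G t) * w t))\<^sup>2"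
    by (intro power_mono ennreal_leI) auto
qed

lemma H_subspace: "csubspace H"
proof (rule complex_vector.subspaceI)
  show "0 \<in> H" using H_abs[of "\<lambda>_. 0"] by (simp add: abs_mfun_0 n2_def)
next
  fix f g assume fg: "f \<in> H" "g \<in> H"
  have "n2 (\<lambda>t. fn f t + fn g t) \<le> 2 * n2 (fn f) + 2 * n2 (fn g)" by (rule n2_add) measurable
  also have "\<dots> < \<infinity>" using fg by (simp add: H_fn ennreal_mult_less_top)
  finally have "abs_mfun (\<lambda>t. fn f t + fn g t) \<in> H" by (simp add: H_abs)
  then show "f + g \<in> H" using abs_mfun_add[of "fn f" "fn g"] by (simp add: abs_fn)
next
  fix c f assume f: "f \<in> H"
  have "abs_mfun (\<lambda>t. c * fn f t) \<in> H"
    by (rule H_abs[THEN iffD2]) (use f in \<open>simp_all add: H_fn n2_scale ennreal_mult_less_top\<close>)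
  then show "c *\<^sub>C f \<in> H" using abs_mfun_scale[of "fn f"] by (simp add: abs_fn)
qed

definition ip :: "mfun \<Rightarrow> mfun \<Rightarrow> complex"
  where "ip f g = (LINT t|lborel. fn f t * cnj (fn g t) * complex_of_real ((w t)\<^sup>2))"

lemma H_integrable:
  assumes "f \<in> H"
  shows "integrable lborel (\<lambda>t. (cmod (fn f t) * w t)\<^sup>2)"
proof (rule integrableI_nonneg)
  show "(\<integral>\<^sup>+ t. ennreal ((cmod (fn f t) * w t)\<^sup>2) \<partial>lborel) < \<infinity>"
    using assms w_nonneg unfolding H_fn n2_def by (simp add: ennreal_power)
qed auto

lemma ip_integrable:
  assumes "f \<in> H" "g \<in> H"
  shows "integrable lborel (\<lambda>t. fn f t * cnj (fn g t) * complex_of_real ((w t)\<^sup>2))"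
proof (rule Bochner_Integration.integrable_bound)
  show "integrable lborel (\<lambda>t. (cmod (fn f t) * w t)\<^sup>2 + (cmod (fn g t) * w t)\<^sup>2)"
    by (intro Bochner_Integration.integrable_add H_integrable assms)
  have "norm (fn f t * cnj (fn g t) * complex_of_real ((w t)\<^sup>2)) \<le>
      norm ((cmod (fn f t) * w t)\<^sup>2 + (cmod (fn g t) * w t)\<^sup>2)" for t
    using sum_squares_bound[of "cmod (fn f t) * w t" "cmod (fn g t) * w t"]
      mult_nonneg_nonneg[OF mult_nonneg_nonneg[OF norm_ge_zero w_nonneg] mult_nonneg_nonneg[OF norm_ge_zero w_nonneg], of "fn f t" t "fn g t" t]
    by (simp add: norm_mult norm_power power2_eq_square mult_ac)
  then show "AE t in lborel. norm (fn f t * cnj (fn g t) * complex_of_real ((w t)\<^sup>2)) \<le>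
      norm ((cmod (fn f t) * w t)\<^sup>2 + (cmod (fn g t) * w t)\<^sup>2)" by simp
qed measurable

lemma ip_self_N:
  assumes "f \<in> H"
  shows "ip f f = complex_of_real ((N f)\<^sup>2)"
proof -
  have "ip f f = (LINT t|lborel. complex_of_real ((cmod (fn f t) * w t)\<^sup>2))"
    unfolding ip_def by (intro Bochner_Integration.integral_cong)
      (simp_all add: power_mult_distrib complex_norm_square[symmetric])
  also have "\<dots> = complex_of_real (LINT t|lborel. (cmod (fn f t) * w t)\<^sup>2)" by (rule integral_complex_of_real)
  also have "(LINT t|lborel. (cmod (fn f t) * w t)\<^sup>2) = enn2real (n2 (fn f))"
    unfolding n2_def using w_nonneg by (subst integral_eq_nn_integral) (auto simp: ennreal_power)
  also have "\<dots> = (N f)\<^sup>2" by (simp add: N_fn)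
  finally show ?thesis .
qed

lemma N_0_iff:
  assumes "f \<in> H" "N f = 0"
  shows "f = 0"
proof -
  have "n2 (fn f) = 0" using assms n2_fn by simp
  then have "AE t in lborel. (ennreal (cmod (fn f t) * w t))\<^sup>2 = 0"
    unfolding n2_def by (subst (asm) nn_integral_0_iff_AE) auto
  then have "AE t in lborel. 0 \<le> t \<longrightarrow> fn f t = 0"
  proof eventually_elim
    fix t assume "(ennreal (cmod (fn f t) * w t))\<^sup>2 = 0"
    then have "cmod (fn f t) * w t = 0" using w_nonneg[of t] by simp
    then show "0 \<le> t \<longrightarrow> fn f t = 0" using w_pos[of t] by auto
  qed
  then have "abs_mfun (fn f) = abs_mfun (\<lambda>_. 0)"
    by (subst abs_mfun_eq_iff) auto
  then show ?thesis by (simp add: abs_fn abs_mfun_0)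
qed

lemma ip_inner: "inner_product_on H ip"
  unfolding inner_product_on_def
proof (intro conjI ballI allI)
  fix f g h assume f: "f \<in> H" and g: "g \<in> H" and h: "h \<in> H"
  have "ip (f + g) h = (LINT t|lborel. fn f t * cnj (fn h t) * complex_of_real ((w t)\<^sup>2) + fn g t * cnj (fn h t) * complex_of_real ((w t)\<^sup>2))"
    unfolding ip_def
  proof (rule integral_cong_AE)
    show "AE t in lborel. fn (f + g) t * cnj (fn h t) * complex_of_real ((w t)\<^sup>2) =
        fn f t * cnj (fn h t) * complex_of_real ((w t)\<^sup>2) + fn g t * cnj (fn h t) * complex_of_real ((w t)\<^sup>2)"
      using fn_add[of f g] by eventually_elim (simp add: algebra_simps)
  qed measurable
  also have "\<dots> = ip f h + ip g h"
    unfolding ip_def by (rule Bochner_Integration.integral_add[OF ip_integrable[OF f h] ip_integrable[OF g h]])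
  finally show "ip (f + g) h = ip f h + ip g h" .
next
  fix c f g assume f: "f \<in> H" and g: "g \<in> H"
  have "ip (c *\<^sub>C f) g = (LINT t|lborel. c * (fn f t * cnj (fn g t) * complex_of_real ((w t)\<^sup>2)))"
    unfolding ip_def
  proof (rule integral_cong_AE)
    show "AE t in lborel. fn (c *\<^sub>C f) t * cnj (fn g t) * complex_of_real ((w t)\<^sup>2) =
        c * (fn f t * cnj (fn g t) * complex_of_real ((w t)\<^sup>2))"
      using fn_scale[of c f] by eventually_elim (simp add: algebra_simps)
  qed measurable
  then show "ip (c *\<^sub>C f) g = c * ip f g" unfolding ip_def by simp
next
  fix f g assume f: "f \<in> H" and g: "g \<in> H"
  show "ip g f = cnj (ip f g)"
    unfolding ip_def by (subst Bochner_Integration.integral_cnj[symmetric]) (simp add: mult_ac)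
next
  fix f assume f: "f \<in> H"
  show "0 \<le> Re (ip f f)" using ip_self_N[OF f] by simp
  show "ip f f = 0 \<longleftrightarrow> f = 0"
  proof
    assume "ip f f = 0" then show "f = 0" using ip_self_N[OF f] N_0_iff[OF f] by simp
  next
    assume "f = 0"
    moreover have "N 0 = 0" using N_abs[of "\<lambda>_. 0"] by (simp add: abs_mfun_0 n2_def)
    ultimately show "ip f f = 0" using ip_self_N[OF f] by simp
  qed
qed

lemma N_ip_eq: "f \<in> H \<Longrightarrow> N f = sqrt (Re (ip f f))"
  using ip_self_N[of f] N_fn[of f] by simp

lemma H_normed: "normed_space_on H N"
  by (rule inner_product_normed[OF H_subspace ip_inner N_ip_eq])

sublocale H: cnormed H N
  by unfold_locales (rule H_normed)

lemma nn_integral_damp_fn: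
  assumes [measurable]: "F \<in> borel_measurable borel"
  shows "(\<integral>\<^sup>+ t. ennreal (damp t) * ennreal (cmod (F t) * w t) \<partial>lborel)\<^sup>2 \<le> n2 F"
  unfolding n2_def by (rule damp_Cauchy_Schwarz) measurable

lemma n2_fn_diff: "n2 (fn (f - g)) = n2 (\<lambda>t. fn f t - fn g t)"
  by (rule n2_cong) (use fn_diff[of f g] in \<open>auto elim: eventually_mono\<close>)

text \<open>Dominated convergence in L2, phrased for classes. Both the density of the monomials and
  the cut-offs of L2 functions are reduced to it.\<close>

lemma H_dominated:
  assumes [measurable]: "\<And>n. F n \<in> borel_measurable borel" "L \<in> borel_measurable borel" "G \<in> borel_measurable borel"
    and G: "n2 G < \<infinity>" and bnd: "\<And>n. AE t in lborel. 0 \<le> t \<longrightarrow> cmod (F n t) \<le> cmod (G t)"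
    and lim: "AE t in lborel. 0 \<le> t \<longrightarrow> (\<lambda>n. F n t) \<longlonglongrightarrow> L t"
  shows "abs_mfun (F n) \<in> H" "abs_mfun L \<in> H" "(\<lambda>n. N (abs_mfun (F n) - abs_mfun L)) \<longlonglongrightarrow> 0"
proof -
  have n2_le: "n2 X \<le> n2 G" if [measurable]: "X \<in> borel_measurable borel" and "AE t in lborel. 0 \<le> t \<longrightarrow> cmod (X t) \<le> cmod (G t)" for X
    unfolding n2_def
  proof (rule nn_integral_mono_AE)
    show "AE t in lborel. (ennreal (cmod (X t) * w t))\<^sup>2 \<le> (ennreal (cmod (G t) * w t))\<^sup>2"
      using that(2)
    proof eventually_elim
      fix t assume "0 \<le> t \<longrightarrow> cmod (X t) \<le> cmod (G t)"
      then have "cmod (X t) * w t \<le> cmod (G t) * w t"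
        using w_nonneg[of t] w_neg[of t] by (cases "t < 0") (auto intro: mult_right_mono)
      then show "(ennreal (cmod (X t) * w t))\<^sup>2 \<le> (ennreal (cmod (G t) * w t))\<^sup>2"
        by (intro power_mono ennreal_leI) auto
    qed
  qed
  have all: "AE t in lborel. \<forall>n. 0 \<le> t \<longrightarrow> cmod (F n t) \<le> cmod (G t)"
    unfolding AE_all_countable using bnd by blast
  have bndL: "AE t in lborel. 0 \<le> t \<longrightarrow> cmod (L t) \<le> cmod (G t)"
    using all lim
  proof eventually_elim
    fix t assume *: "\<forall>n. 0 \<le> t \<longrightarrow> cmod (F n t) \<le> cmod (G t)" "0 \<le> t \<longrightarrow> (\<lambda>n. F n t) \<longlonglongrightarrow> L t"
    show "0 \<le> t \<longrightarrow> cmod (L t) \<le> cmod (G t)"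
    proof
      assume "0 \<le> t"
      then show "cmod (L t) \<le> cmod (G t)"
        using * by (intro LIMSEQ_le_const2[OF tendsto_norm]) auto
    qed
  qed
  show FH: "abs_mfun (F n) \<in> H" for n using le_less_trans[OF n2_le[OF _ bnd] G] by (simp add: H_abs)
  show LH: "abs_mfun L \<in> H" using le_less_trans[OF n2_le[OF _ bndL] G] by (simp add: H_abs)
  have "(\<lambda>n. n2 (\<lambda>t. F n t - L t)) \<longlonglongrightarrow> (\<integral>\<^sup>+ t. (\<lambda>_. 0) t \<partial>(lborel :: real measure))"
    unfolding n2_def
  \<comment> \<open>The limit obeys the same bound as the sequence, so the difference is at most
    twice \<open>G\<close>, whence the factor 4 after squaring.\<close>
  proof (rule nn_integral_dominated_convergence[where w = "\<lambda>t. 4 * (ennreal (cmod (G t) * w t))\<^sup>2"])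
    show "(\<integral>\<^sup>+ t. 4 * (ennreal (cmod (G t) * w t))\<^sup>2 \<partial>lborel) < \<infinity>"
      using G unfolding n2_def by (simp add: nn_integral_cmult ennreal_mult_less_top)
    show "AE t in lborel. (ennreal (cmod (F n t - L t) * w t))\<^sup>2 \<le> 4 * (ennreal (cmod (G t) * w t))\<^sup>2" for n
      using all bndL
    proof eventually_elim
      fix t assume *: "\<forall>n. 0 \<le> t \<longrightarrow> cmod (F n t) \<le> cmod (G t)" "0 \<le> t \<longrightarrow> cmod (L t) \<le> cmod (G t)"
      have "cmod (F n t - L t) * w t \<le> 2 * (cmod (G t) * w t)"
      proof (cases "t < 0")
        case False
        then have "cmod (F n t - L t) \<le> 2 * cmod (G t)"
          using * norm_triangle_ineq4[of "F n t" "L t"] by (smt (verit))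
        then show ?thesis using mult_right_mono[OF _ w_nonneg[of t]] by fastforce
      qed (simp add: w_neg)
      then have "(ennreal (cmod (F n t - L t) * w t))\<^sup>2 \<le> (ennreal (2 * (cmod (G t) * w t)))\<^sup>2"
        by (intro power_mono ennreal_leI) auto
      also have "\<dots> = 4 * (ennreal (cmod (G t) * w t))\<^sup>2"
        using w_nonneg by (simp add: ennreal_mult power_mult_distrib)
      finally show "(ennreal (cmod (F n t - L t) * w t))\<^sup>2 \<le> 4 * (ennreal (cmod (G t) * w t))\<^sup>2" .
    qed
    show "AE t in lborel. (\<lambda>n. (ennreal (cmod (F n t - L t) * w t))\<^sup>2) \<longlonglongrightarrow> 0"
      using lim
    proof eventually_elim
      fix t assume *: "0 \<le> t \<longrightarrow> (\<lambda>n. F n t) \<longlonglongrightarrow> L t"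
      have "(\<lambda>n. (cmod (F n t - L t) * w t)\<^sup>2) \<longlonglongrightarrow> (0 * w t)\<^sup>2"
      proof (cases "t < 0")
        case False
        then have "(\<lambda>n. cmod (F n t - L t)) \<longlonglongrightarrow> 0" using * by (simp add: tendsto_norm_zero_iff LIM_zero_iff)
        then show ?thesis by (intro tendsto_intros)
      qed (simp add: w_neg)
      from tendsto_ennrealI[OF this]
      show "(\<lambda>n. (ennreal (cmod (F n t - L t) * w t))\<^sup>2) \<longlonglongrightarrow> 0"
        using w_nonneg by (simp add: ennreal_power)
    qed
  qed measurable
  then have "(\<lambda>n. sqrt (enn2real (n2 (\<lambda>t. F n t - L t)))) \<longlonglongrightarrow> sqrt (enn2real 0)"
    by (intro tendsto_real_sqrt tendsto_enn2real) auto
  then show "(\<lambda>n. N (abs_mfun (F n) - abs_mfun L)) \<longlonglongrightarrow> 0"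
    by (simp add: abs_mfun_diff N_abs)
qed

end

lemma ennreal_square_le_imp_le:
  assumes "X\<^sup>2 \<le> ennreal (c\<^sup>2)" "0 \<le> c"
  shows "X \<le> ennreal c"
proof (cases X)
  case (real x)
  then have "ennreal (x\<^sup>2) \<le> ennreal (c\<^sup>2)" using assms by (simp add: ennreal_power)
  then have "x\<^sup>2 \<le> c\<^sup>2" using assms(2) by (simp add: ennreal_le_iff)
  then have "x \<le> c" using assms(2) by (rule power2_le_imp_le)
  then show ?thesis using real by (simp add: ennreal_leI)
next
  case top
  then show ?thesis using assms by (simp add: power2_eq_square top_unique)
qed

section \<open>Completeness of the weighted L2 space\<close>

context weight
begin

text \<open>The Riesz-Fischer argument. A rapidly Cauchy subsequence converges almost everywhere
  because its differences, once damped, have summable L1 norms; Fatou's lemma then turns the Cauchy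
  condition into convergence in norm.\<close>

lemma H_banach: "banach_space_on H N"
  unfolding H.banach_iff
proof (intro allI impI, elim conjE)
  fix x :: "nat \<Rightarrow> mfun"
  assume x: "\<forall>n. x n \<in> H" and cau: "\<forall>e>0. \<exists>k. \<forall>m\<ge>k. \<forall>n\<ge>k. N (x m - x n) < e"
  have "\<forall>k. \<exists>j. \<forall>m\<ge>j. \<forall>n\<ge>j. N (x m - x n) < (1 / 2) ^ k"
    using cau by simp
  then obtain j where j: "\<And>k m n. m \<ge> j k \<Longrightarrow> n \<ge> j k \<Longrightarrow> N (x m - x n) < (1 / 2) ^ k" by metis
  \<comment> \<open>The sum makes \<open>r (Suc k)\<close> exceed \<open>j k\<close> as well, so
    that neighbouring terms are within (1/2)^k; the summand \<open>k\<close> pushes the indices to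
    infinity.\<close>
  define r where "r k = (\<Sum>i\<le>k. j i) + k" for k
  have r: "r k \<ge> j k" "r k \<ge> k" "r (Suc k) \<ge> j k" for k
    using member_le_sum[of k "{..k}" j] by (auto simp: r_def)
  define F where "F k = fn (x (r k))" for k
  have [measurable]: "F k \<in> borel_measurable borel" for k by (simp add: F_def)
  define D where "D k t = cmod (F (Suc k) t - F k t)" for k t
  have [measurable]: "D k \<in> borel_measurable borel" for k unfolding D_def[abs_def] by measurable
  have step: "(\<integral>\<^sup>+ t. ennreal (damp t) * ennreal (D k t * w t) \<partial>lborel) \<le> ennreal ((1 / 2) ^ k)" for k
  proof (rule ennreal_square_le_imp_le)
    have "(\<integral>\<^sup>+ t. ennreal (damp t) * ennreal (D k t * w t) \<partial>lborel)\<^sup>2 \<le> n2 (\<lambda>t. F (Suc k) t - F k t)"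
      unfolding D_def by (rule nn_integral_damp_fn) measurable
    also have "\<dots> = ennreal ((N (x (r (Suc k)) - x (r k)))\<^sup>2)"
      using n2_fn[of "x (r (Suc k)) - x (r k)"] x by (simp add: n2_fn_diff F_def)
    also have "\<dots> \<le> ennreal (((1 / 2) ^ k)\<^sup>2)"
      using j[OF r(3) r(1), of k] x by (intro ennreal_leI power_mono) auto
    finally show "(\<integral>\<^sup>+ t. ennreal (damp t) * ennreal (D k t * w t) \<partial>lborel)\<^sup>2 \<le> ennreal (((1 / 2) ^ k)\<^sup>2)" .
  qed simp
  have "(\<integral>\<^sup>+ t. (\<Sum>k. ennreal (damp t) * ennreal (D k t * w t)) \<partial>lborel) =
      (\<Sum>k. \<integral>\<^sup>+ t. ennreal (damp t) * ennreal (D k t * w t) \<partial>lborel)"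
    by (rule nn_integral_suminf) measurable
  also have "\<dots> \<le> (\<Sum>k. ennreal ((1 / 2) ^ k))"
    by (intro suminf_le step) auto
  also have "\<dots> = ennreal (\<Sum>k. (1 / 2) ^ k)"
    by (rule suminf_ennreal2) (auto simp: summable_geometric)
  finally have "(\<integral>\<^sup>+ t. (\<Sum>k. ennreal (damp t) * ennreal (D k t * w t)) \<partial>lborel) \<noteq> \<infinity>"
    by (auto simp: top_unique)
  then have "AE t in lborel. (\<Sum>k. ennreal (damp t) * ennreal (D k t * w t)) \<noteq> \<infinity>"
    by (intro nn_integral_noteq_infinite) measurable
  then have conv: "AE t in lborel. convergent (\<lambda>k. F k t)"
  proof eventually_elim
    fix t assume fin: "(\<Sum>k. ennreal (damp t) * ennreal (D k t * w t)) \<noteq> \<infinity>"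
    show "convergent (\<lambda>k. F k t)"
    proof (cases "t < 0")
      case True
      then show ?thesis by (simp add: F_def fn_neg convergent_const)
    next
      case False
      have pos: "damp t * w t > 0" using False w_pos[of t] by (simp add: damp_def)
      have "summable (\<lambda>k. damp t * w t * D k t)"
      proof (rule summable_suminf_not_top)
        show "0 \<le> damp t * w t * D k t" for k using pos by (simp add: D_def)
        have "ennreal (damp t) * ennreal (D k t * w t) = ennreal (damp t * w t * D k t)" for k
          using w_nonneg[of t] damp_nonneg[of t] by (simp add: D_def ennreal_mult[symmetric] mult_ac)
        then show "(\<Sum>k. ennreal (damp t * w t * D k t)) \<noteq> top" using fin by simp
      qed
      then have "summable (\<lambda>k. D k t)" using pos by (auto simp: summable_cmult_iff)
      then have "summable (\<lambda>k. F (Suc k) t - F k t)"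
        unfolding D_def by (rule summable_norm_cancel)
      then have "convergent (\<lambda>n. F n t - F 0 t)"
        unfolding summable_iff_convergent sum_lessThan_telescope[of "\<lambda>k. F k t"] .
      from convergent_add[OF this convergent_const[of "F 0 t"]] show ?thesis by simp
    qed
  qed
  define G where "G t = lim (\<lambda>k. F k t)" for t
  have [measurable]: "G \<in> borel_measurable borel" unfolding G_def[abs_def] by measurable
  have lim: "AE t in lborel. (\<lambda>k. F k t) \<longlonglongrightarrow> G t"
    using conv by eventually_elim (simp add: G_def convergent_LIMSEQ_iff)
  \<comment> \<open>Fatou's lemma along the subsequence, with \<open>x m\<close> held fixed.\<close>
  have bnd: "n2 (\<lambda>t. fn (x m) t - G t) \<le> ennreal (e\<^sup>2)"
    if e: "e > 0" and k: "\<forall>m\<ge>k0. \<forall>n\<ge>k0. N (x m - x n) < e" and m: "m \<ge> k0" for e m k0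
  proof -
    let ?u = "\<lambda>k t. (ennreal (cmod (fn (x m) t - F k t) * w t))\<^sup>2"
    have "AE t in lborel. (ennreal (cmod (fn (x m) t - G t) * w t))\<^sup>2 = liminf (\<lambda>k. ?u k t)"
      using lim
    proof eventually_elim
      fix t assume "(\<lambda>k. F k t) \<longlonglongrightarrow> G t"
      then have "(\<lambda>k. (cmod (fn (x m) t - F k t) * w t)\<^sup>2) \<longlonglongrightarrow> (cmod (fn (x m) t - G t) * w t)\<^sup>2"
        by (intro tendsto_intros)
      from tendsto_ennrealI[OF this] have "(\<lambda>k. ?u k t) \<longlonglongrightarrow> (ennreal (cmod (fn (x m) t - G t) * w t))\<^sup>2"
        using w_nonneg by (simp add: ennreal_power)
      then show "(ennreal (cmod (fn (x m) t - G t) * w t))\<^sup>2 = liminf (\<lambda>k. ?u k t)"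
        using lim_imp_Liminf[OF sequentially_bot] by metis
    qed
    then have "n2 (\<lambda>t. fn (x m) t - G t) = (\<integral>\<^sup>+ t. liminf (\<lambda>k. ?u k t) \<partial>lborel)"
      unfolding n2_def by (rule nn_integral_cong_AE)
    also have "\<dots> \<le> liminf (\<lambda>k. \<integral>\<^sup>+ t. ?u k t \<partial>lborel)"
      by (rule nn_integral_liminf) measurable
    also have "\<dots> \<le> limsup (\<lambda>k. \<integral>\<^sup>+ t. ?u k t \<partial>lborel)"
      by (rule Liminf_le_Limsup) simp
    also have "\<dots> \<le> ennreal (e\<^sup>2)"
    proof (rule Limsup_bounded)
      have "(\<integral>\<^sup>+ t. ?u n t \<partial>lborel) \<le> ennreal (e\<^sup>2)" if "n \<ge> k0" for n
      proof -
        have "(\<integral>\<^sup>+ t. ?u n t \<partial>lborel) = n2 (fn (x m - x (r n)))"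
          by (subst n2_fn_diff) (simp only: n2_def F_def)
        also have "\<dots> = ennreal ((N (x m - x (r n)))\<^sup>2)" using n2_fn x by simp
        also have "\<dots> \<le> ennreal (e\<^sup>2)"
          using k m r(2)[of n] that x by (intro ennreal_leI power_mono) (auto intro: less_imp_le)
        finally show ?thesis .
      qed
      then show "\<forall>\<^sub>F n in sequentially. (\<integral>\<^sup>+ t. ?u n t \<partial>lborel) \<le> ennreal (e\<^sup>2)"
        by (rule eventually_sequentiallyI)
    qed
    finally show ?thesis .
  qed
  have diff: "x m - abs_mfun G = abs_mfun (\<lambda>t. fn (x m) t - G t)" for m
    using abs_mfun_diff[of "fn (x m)" G] by (simp add: abs_fn)
  obtain k1 where k1: "\<forall>m\<ge>k1. \<forall>n\<ge>k1. N (x m - x n) < 1" using cau by (meson zero_less_one)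
  have "x k1 - abs_mfun G \<in> H"
    unfolding diff using le_less_trans[OF bnd[OF zero_less_one k1 order_refl]] by (subst H_abs) auto
  then have "x k1 - (x k1 - abs_mfun G) \<in> H" using x H.diff_mem by blast
  then have GH: "abs_mfun G \<in> H" by simp
  have "(\<lambda>n. N (x n - abs_mfun G)) \<longlonglongrightarrow> 0"
  proof (rule LIMSEQ_I)
    fix e :: real assume e: "e > 0"
    then obtain k0 where k0: "\<forall>m\<ge>k0. \<forall>n\<ge>k0. N (x m - x n) < e / 2" using cau by (meson half_gt_zero)
    have "N (x m - abs_mfun G) \<le> e / 2" if "m \<ge> k0" for m
    proof -
      have "n2 (\<lambda>t. fn (x m) t - G t) \<le> ennreal ((e / 2)\<^sup>2)"
        by (rule bnd[OF _ k0 that]) (use e in simp)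
      then have "enn2real (n2 (\<lambda>t. fn (x m) t - G t)) \<le> (e / 2)\<^sup>2"
        by (intro enn2real_leI) auto
      moreover have "N (x m - abs_mfun G) = sqrt (enn2real (n2 (\<lambda>t. fn (x m) t - G t)))"
        unfolding diff by (rule N_abs) measurable
      ultimately have "N (x m - abs_mfun G) \<le> sqrt ((e / 2)\<^sup>2)"
        by (metis real_sqrt_le_mono)
      then show ?thesis using e by simp
    qed
    moreover have "N (x m - abs_mfun G) \<ge> 0" for m using x GH by simp
    ultimately have "norm (N (x n - abs_mfun G) - 0) < e" if "n \<ge> k0" for n
      using that e by (smt (verit) field_sum_of_halves real_norm_def)
    then show "\<exists>k. \<forall>n\<ge>k. norm (N (x n - abs_mfun G) - 0) < e" by blast
  qed
  then show "\<exists>l\<in>H. (\<lambda>n. N (x n - l)) \<longlonglongrightarrow> 0" using GH by blast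
qed

sublocale chilbert H N ip
  by unfold_locales (rule H_banach ip_inner N_ip_eq, assumption?)+

subsection \<open>Convolution\<close>

text \<open>Submultiplicativity distributes \<open>w t\<close> over the two factors and leaves an
  unweighted convolution for Young's inequality. Working with \<open>acv\<close> gives existence of
  the convolution integral along with the bound.\<close>

lemma acv_L1:
  assumes [measurable]: "F \<in> borel_measurable borel" "G \<in> borel_measurable borel"
    and neg: "\<And>t. t < 0 \<Longrightarrow> F t = 0" "\<And>t. t < 0 \<Longrightarrow> G t = 0"
  shows "(\<integral>\<^sup>+ t. (acv F G t * ennreal (w t))\<^sup>2 \<partial>lborel) \<le> (n1 F)\<^sup>2 * n2 G"
proof -
  have "(\<integral>\<^sup>+ t. (acv F G t * ennreal (w t))\<^sup>2 \<partial>lborel) \<le>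
      (\<integral>\<^sup>+ t. (\<integral>\<^sup>+ s. ennreal (cmod (F (t - s)) * w (t - s)) * ennreal (cmod (G s) * w s) \<partial>lborel)\<^sup>2 \<partial>lborel)"
  proof (intro nn_integral_mono power_mono)
    fix t
    have "acv F G t * ennreal (w t) = (\<integral>\<^sup>+ s. ennreal (cmod (F (t - s) * G s)) * ennreal (w t) \<partial>lborel)"
      unfolding acv_def by (rule nn_integral_multc[symmetric]) measurable
    also have "\<dots> \<le> (\<integral>\<^sup>+ s. ennreal (cmod (F (t - s)) * w (t - s)) * ennreal (cmod (G s) * w s) \<partial>lborel)"
    proof (rule nn_integral_mono)
      fix s
      have "cmod (F (t - s) * G s) * w t \<le> (cmod (F (t - s)) * w (t - s)) * (cmod (G s) * w s)"
      proof (cases "s < 0 \<or> t - s < 0")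
        case False
        then have "w t \<le> w (t - s) * w s" using w_sub[of "t - s" s] by simp
        from mult_left_mono[OF this, of "cmod (F (t - s) * G s)"]
        show ?thesis by (simp add: norm_mult mult_ac)
      qed (auto simp: neg)
      then show "ennreal (cmod (F (t - s) * G s)) * ennreal (w t) \<le>
          ennreal (cmod (F (t - s)) * w (t - s)) * ennreal (cmod (G s) * w s)"
        using w_nonneg by (simp add: ennreal_leI flip: ennreal_mult)
    qed
    finally show "acv F G t * ennreal (w t) \<le> \<dots>" .
  qed auto
  also have "\<dots> \<le> (n1 F)\<^sup>2 * n2 G"
    unfolding n1_def n2_def by (rule Young_nn) measurable
  finally show ?thesis .
qed

lemma K_pos: "K > 0"
proof -
  have "w 0 \<le> K * 2 * (w 0 * w 0)" using w_sub2[of 0 0] by simp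
  then have "0 < K * 2 * (w 0 * w 0)" using w_pos[of 0] by linarith
  then show ?thesis using w_pos[of 0] by (simp add: zero_less_mult_iff)
qed

text \<open>\<open>w_sub2\<close> dominates the weighted convolution by two unweighted ones, each
  with one factor damped into L1 and the other in L2. The constant is K^2 times the 4 that results
  from squaring the sum of two equal bounds.\<close>

lemma acv_L2:
  assumes [measurable]: "F \<in> borel_measurable borel" "G \<in> borel_measurable borel"
    and neg: "\<And>t. t < 0 \<Longrightarrow> F t = 0" "\<And>t. t < 0 \<Longrightarrow> G t = 0"
  shows "(\<integral>\<^sup>+ t. (acv F G t * ennreal (w t))\<^sup>2 \<partial>lborel) \<le> ennreal ((2 * K)\<^sup>2) * (n2 F * n2 G)"
proof -
  define f where "f s = ennreal (cmod (F s) * w s)" for s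
  define g where "g s = ennreal (cmod (G s) * w s)" for s
  define ef where "ef s = ennreal (damp s) * f s" for s
  define eg where "eg s = ennreal (damp s) * g s" for s
  have [measurable]: "f \<in> borel_measurable borel" "g \<in> borel_measurable borel"
    "ef \<in> borel_measurable borel" "eg \<in> borel_measurable borel"
    unfolding f_def[abs_def] g_def[abs_def] ef_def[abs_def] eg_def[abs_def] by measurable
  define I1 where "I1 t = (\<integral>\<^sup>+ s. ef (t - s) * g s \<partial>lborel)" for t
  define I2 where "I2 t = (\<integral>\<^sup>+ s. eg (t - s) * f s \<partial>lborel)" for t
  have [measurable]: "I1 \<in> borel_measurable borel" "I2 \<in> borel_measurable borel"
    unfolding I1_def[abs_def] I2_def[abs_def] by measurable
  have "acv F G t * ennreal (w t) \<le> ennreal K * (I1 t + I2 t)" for t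
  proof -
    have "acv F G t * ennreal (w t) = (\<integral>\<^sup>+ s. ennreal (cmod (F (t - s) * G s)) * ennreal (w t) \<partial>lborel)"
      unfolding acv_def by (rule nn_integral_multc[symmetric]) measurable
    also have "\<dots> \<le> (\<integral>\<^sup>+ s. ennreal K * (ef (t - s) * g s + f (t - s) * eg s) \<partial>lborel)"
    proof (rule nn_integral_mono)
      fix s
      show "ennreal (cmod (F (t - s) * G s)) * ennreal (w t) \<le> ennreal K * (ef (t - s) * g s + f (t - s) * eg s)"
      proof (cases "s < 0 \<or> t - s < 0")
        case False
        let ?a = "cmod (F (t - s)) * w (t - s)" and ?b = "cmod (G s) * w s"
        have "w t \<le> K * (damp (t - s) + damp s) * (w (t - s) * w s)"
          using False w_sub2[of "t - s" s] by (simp add: damp_def)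
        from mult_left_mono[OF this, of "cmod (F (t - s) * G s)"]
        have le: "cmod (F (t - s) * G s) * w t \<le> K * (damp (t - s) * ?a * ?b + ?a * (damp s * ?b))"
          by (simp add: norm_mult algebra_simps)
        have "ennreal K * (ef (t - s) * g s + f (t - s) * eg s) =
            ennreal (K * (damp (t - s) * ?a * ?b + ?a * (damp s * ?b)))"
          using w_nonneg damp_nonneg K_pos unfolding ef_def eg_def f_def g_def
          by (simp add: ennreal_mult flip: ennreal_plus) (simp add: ennreal_mult ennreal_plus mult_ac)
        then show ?thesis using le w_nonneg by (simp add: ennreal_leI flip: ennreal_mult)
      qed (auto simp: neg)
    qed
    also have "\<dots> = ennreal K * ((\<integral>\<^sup>+ s. ef (t - s) * g s \<partial>lborel) + (\<integral>\<^sup>+ s. f (t - s) * eg s \<partial>lborel))"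
      by (simp add: nn_integral_cmult nn_integral_add)
    \<comment> \<open>The damped factor is moved to the place that \<open>Young_nn\<close> measures
      in L1.\<close>
    also have "(\<integral>\<^sup>+ s. f (t - s) * eg s \<partial>lborel) = I2 t"
      unfolding I2_def by (rule nn_conv_commute) measurable
    finally show ?thesis by (simp add: I1_def)
  qed
  then have "(\<integral>\<^sup>+ t. (acv F G t * ennreal (w t))\<^sup>2 \<partial>lborel) \<le> (\<integral>\<^sup>+ t. (ennreal K * (I1 t + I2 t))\<^sup>2 \<partial>lborel)"
    by (intro nn_integral_mono power_mono) auto
  also have "\<dots> \<le> (\<integral>\<^sup>+ t. ennreal (K\<^sup>2) * (2 * (I1 t)\<^sup>2 + 2 * (I2 t)\<^sup>2) \<partial>lborel)"
    using K_pos by (intro nn_integral_mono) (simp add: power_mult_distrib ennreal_power mult_left_mono ennreal_square_add_le)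
  also have "\<dots> = ennreal (K\<^sup>2) * (2 * (\<integral>\<^sup>+ t. (I1 t)\<^sup>2 \<partial>lborel) + 2 * (\<integral>\<^sup>+ t. (I2 t)\<^sup>2 \<partial>lborel))"
    by (simp add: nn_integral_cmult nn_integral_add)
  also have "\<dots> \<le> ennreal (K\<^sup>2) * (2 * (n2 F * n2 G) + 2 * (n2 G * n2 F))"
  proof (intro mult_left_mono add_mono)
    have "(\<integral>\<^sup>+ t. (I1 t)\<^sup>2 \<partial>lborel) \<le> (\<integral>\<^sup>+ s. ef s \<partial>lborel)\<^sup>2 * (\<integral>\<^sup>+ s. (g s)\<^sup>2 \<partial>lborel)"
      unfolding I1_def by (rule Young_nn) measurable
    also have "\<dots> \<le> n2 F * n2 G"
      unfolding ef_def f_def g_def n2_def by (intro mult_right_mono damp_Cauchy_Schwarz) measurable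
    finally show "(\<integral>\<^sup>+ t. (I1 t)\<^sup>2 \<partial>lborel) \<le> n2 F * n2 G" .
    have "(\<integral>\<^sup>+ t. (I2 t)\<^sup>2 \<partial>lborel) \<le> (\<integral>\<^sup>+ s. eg s \<partial>lborel)\<^sup>2 * (\<integral>\<^sup>+ s. (f s)\<^sup>2 \<partial>lborel)"
      unfolding I2_def by (rule Young_nn) measurable
    also have "\<dots> \<le> n2 G * n2 F"
      unfolding eg_def f_def g_def n2_def by (intro mult_right_mono damp_Cauchy_Schwarz) measurable
    finally show "(\<integral>\<^sup>+ t. (I2 t)\<^sup>2 \<partial>lborel) \<le> n2 G * n2 F" .
  qed auto
  also have "2 * (n2 F * n2 G) + 2 * (n2 G * n2 F) = 4 * (n2 F * n2 G)"
    by (simp add: mult.commute flip: distrib_right)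
  also have "ennreal (K\<^sup>2) * (4 * (n2 F * n2 G)) = ennreal ((2 * K)\<^sup>2) * (n2 F * n2 G)"
    by (simp add: power_mult_distrib ennreal_mult mult_ac)
  finally show ?thesis .
qed

text \<open>The convolution integral defaults to 0 where it does not exist, so additivity may fail
  there; homogeneity never does, and \<open>conv_scale_left\<close> and
  \<open>conv_scale_right\<close> get by without it.\<close>

definition convolvable :: "mfun \<Rightarrow> mfun \<Rightarrow> bool"
  where "convolvable f g \<longleftrightarrow> (AE t in lborel. integrable lborel (\<lambda>s. fn f (t - s) * fn g s))"

lemma convolvableI:
  assumes "(\<integral>\<^sup>+ t. (acv (fn f) (fn g) t * ennreal (w t))\<^sup>2 \<partial>lborel) < \<infinity>"
  shows "convolvable f g"
proof -
  have "AE t in lborel. (acv (fn f) (fn g) t * ennreal (w t))\<^sup>2 \<noteq> \<infinity>"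
    by (rule nn_integral_noteq_infinite) (use assms in auto)
  then show ?thesis unfolding convolvable_def
  proof eventually_elim
    fix t assume *: "(acv (fn f) (fn g) t * ennreal (w t))\<^sup>2 \<noteq> \<infinity>"
    show "integrable lborel (\<lambda>s. fn f (t - s) * fn g s)"
    proof (cases "t < 0")
      case True
      have "(\<lambda>s. fn f (t - s) * fn g s) = (\<lambda>_. 0)"
      proof
        fix s show "fn f (t - s) * fn g s = 0"
          using True fn_neg[of s g] fn_neg[of "t - s" f] by (cases "s < 0") auto
      qed
      then show ?thesis by simp
    next
      case False
      then have "acv (fn f) (fn g) t \<noteq> top"
        using * w_pos[of t] by (auto simp: power2_eq_square ennreal_top_mult)
      then show ?thesis
        unfolding acv_def by (intro integrableI_bounded) (auto simp: less_top)
    qed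
  qed
qed

lemma convolution_fn: "convolution f g = abs_mfun (cv (fn f) (fn g))"
  using abs_mfun_cv[of "fn f" "fn g"] by (simp add: abs_fn fn_neg)

lemma n2_cv_le: "n2 (cv F G) \<le> (\<integral>\<^sup>+ t. (acv F G t * ennreal (w t))\<^sup>2 \<partial>lborel)"
  unfolding n2_def
proof (intro nn_integral_mono power_mono)
  fix t show "ennreal (cmod (cv F G t) * w t) \<le> acv F G t * ennreal (w t)"
    using mult_right_mono[OF cv_le_acv] w_nonneg by (simp add: ennreal_mult)
qed auto

lemma conv_add_left:
  assumes "convolvable f h" "convolvable g h"
  shows "convolution (f + g) h = convolution f h + convolution g h"
proof -
  have "f + g = abs_mfun (\<lambda>t. fn f t + fn g t)" "h = abs_mfun (fn h)"
    using abs_mfun_add[of "fn f" "fn g"] by (simp_all add: abs_fn)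
  then have "convolution (f + g) h = abs_mfun (cv (\<lambda>t. fn f t + fn g t) (fn h))"
    using abs_mfun_cv[of "\<lambda>t. fn f t + fn g t" "fn h"] by (simp add: fn_neg)
  also have "\<dots> = abs_mfun (\<lambda>t. cv (fn f) (fn h) t + cv (fn g) (fn h) t)"
  proof (subst abs_mfun_eq_iff)
    show "AE t in lborel. 0 \<le> t \<longrightarrow> cv (\<lambda>t. fn f t + fn g t) (fn h) t = cv (fn f) (fn h) t + cv (fn g) (fn h) t"
      using assms[unfolded convolvable_def]
      by eventually_elim (simp add: cv_def distrib_right)
  qed measurable
  finally show ?thesis by (simp add: convolution_fn abs_mfun_add)
qed

lemma conv_add_right:
  assumes "convolvable h f" "convolvable h g"
  shows "convolution h (f + g) = convolution h f + convolution h g"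
proof -
  have "f + g = abs_mfun (\<lambda>t. fn f t + fn g t)" "h = abs_mfun (fn h)"
    using abs_mfun_add[of "fn f" "fn g"] by (simp_all add: abs_fn)
  then have "convolution h (f + g) = abs_mfun (cv (fn h) (\<lambda>t. fn f t + fn g t))"
    using abs_mfun_cv[of "fn h" "\<lambda>t. fn f t + fn g t"] by (simp add: fn_neg)
  also have "\<dots> = abs_mfun (\<lambda>t. cv (fn h) (fn f) t + cv (fn h) (fn g) t)"
  proof (subst abs_mfun_eq_iff)
    show "AE t in lborel. 0 \<le> t \<longrightarrow> cv (fn h) (\<lambda>t. fn f t + fn g t) t = cv (fn h) (fn f) t + cv (fn h) (fn g) t"
      using assms[unfolded convolvable_def]
      by eventually_elim (simp add: cv_def distrib_left)
  qed measurable
  finally show ?thesis by (simp add: convolution_fn abs_mfun_add)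
qed

lemma conv_scale_left: "convolution (c *\<^sub>C f) h = c *\<^sub>C convolution f h"
proof -
  have "c *\<^sub>C f = abs_mfun (\<lambda>t. c * fn f t)" "h = abs_mfun (fn h)"
    using abs_mfun_scale[of "fn f"] by (simp_all add: abs_fn)
  then have "convolution (c *\<^sub>C f) h = abs_mfun (cv (\<lambda>t. c * fn f t) (fn h))"
    using abs_mfun_cv[of "\<lambda>t. c * fn f t" "fn h"] by (simp add: fn_neg)
  also have "cv (\<lambda>t. c * fn f t) (fn h) = (\<lambda>t. c * cv (fn f) (fn h) t)"
    by (simp add: cv_def mult.assoc fun_eq_iff)
  finally show ?thesis by (simp add: convolution_fn abs_mfun_scale)
qed

lemma conv_scale_right: "convolution h (c *\<^sub>C f) = c *\<^sub>C convolution h f"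
proof -
  have "c *\<^sub>C f = abs_mfun (\<lambda>t. c * fn f t)" "h = abs_mfun (fn h)"
    using abs_mfun_scale[of "fn f"] by (simp_all add: abs_fn)
  then have "convolution h (c *\<^sub>C f) = abs_mfun (cv (fn h) (\<lambda>t. c * fn f t))"
    using abs_mfun_cv[of "fn h" "\<lambda>t. c * fn f t"] by (simp add: fn_neg)
  also have "cv (fn h) (\<lambda>t. c * fn f t) = (\<lambda>t. c * cv (fn h) (fn f) t)"
    by (simp add: cv_def mult.left_commute fun_eq_iff)
  finally show ?thesis by (simp add: convolution_fn abs_mfun_scale)
qed

section \<open>Multiplication operators by L1 and L2 functions\<close>

abbreviation J :: "mfun \<Rightarrow> mfun \<Rightarrow> mfun" where "J \<equiv> conv_op \<omega>"

sublocale HH: cnormed_pair H N H N ..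

text \<open>A bound on the absolute convolution gives everything at once: finiteness almost
  everywhere yields existence, and \<open>cv\<close> is dominated by \<open>acv\<close>.\<close>

lemma conv_H_bound:
  assumes "(\<integral>\<^sup>+ t. (acv (fn f) (fn g) t * ennreal (w t))\<^sup>2 \<partial>lborel) \<le> ennreal (c\<^sup>2)" "0 \<le> c"
  shows "convolvable f g" "convolution f g \<in> H" "N (convolution f g) \<le> c"
proof -
  have "(\<integral>\<^sup>+ t. (acv (fn f) (fn g) t * ennreal (w t))\<^sup>2 \<partial>lborel) < \<infinity>"
    using le_less_trans[OF assms(1)] by simp
  then show "convolvable f g" by (rule convolvableI)
  have le: "n2 (cv (fn f) (fn g)) \<le> ennreal (c\<^sup>2)" using n2_cv_le assms(1) order_trans by blast
  then show "convolution f g \<in> H"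
    unfolding convolution_fn by (subst H_abs) (auto intro: le_less_trans)
  have "enn2real (n2 (cv (fn f) (fn g))) \<le> c\<^sup>2" using le by (intro enn2real_leI) auto
  then have "N (convolution f g) \<le> sqrt (c\<^sup>2)"
    unfolding convolution_fn using N_abs[OF cv_measurable[OF fn_measurable fn_measurable], of f g]
    by (metis real_sqrt_le_mono)
  then show "N (convolution f g) \<le> c" using assms(2) by simp
qed

lemma conv_L2:
  assumes "f \<in> H" "g \<in> H"
  shows "convolvable f g" "convolution f g \<in> H" "N (convolution f g) \<le> 2 * K * N f * N g"
proof -
  have "(\<integral>\<^sup>+ t. (acv (fn f) (fn g) t * ennreal (w t))\<^sup>2 \<partial>lborel) \<le> ennreal ((2 * K)\<^sup>2) * (n2 (fn f) * n2 (fn g))"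
    by (rule acv_L2) (auto simp: fn_neg)
  also have "\<dots> = ennreal ((2 * K * N f * N g)\<^sup>2)"
    using assms by (simp add: n2_fn ennreal_mult[symmetric] power_mult_distrib mult_ac)
  finally have *: "(\<integral>\<^sup>+ t. (acv (fn f) (fn g) t * ennreal (w t))\<^sup>2 \<partial>lborel) \<le> ennreal ((2 * K * N f * N g)\<^sup>2)" .
  have "0 \<le> 2 * K * N f * N g" using K_pos assms by simp
  from conv_H_bound[OF * this] show "convolvable f g" "convolution f g \<in> H" "N (convolution f g) \<le> 2 * K * N f * N g" .
qed

lemma conv_L1:
  assumes "n1 (fn f) \<le> ennreal c" "0 \<le> c" "g \<in> H"
  shows "convolvable f g" "convolution f g \<in> H" "N (convolution f g) \<le> c * N g"
proof -
  have "(\<integral>\<^sup>+ t. (acv (fn f) (fn g) t * ennreal (w t))\<^sup>2 \<partial>lborel) \<le> (n1 (fn f))\<^sup>2 * n2 (fn g)"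
    by (rule acv_L1) (auto simp: fn_neg)
  also have "\<dots> \<le> (ennreal c)\<^sup>2 * n2 (fn g)"
    using assms(1) by (intro mult_right_mono power_mono) auto
  also have "\<dots> = ennreal ((c * N g)\<^sup>2)"
    using assms by (simp add: n2_fn ennreal_power ennreal_mult[symmetric] power_mult_distrib)
  finally have *: "(\<integral>\<^sup>+ t. (acv (fn f) (fn g) t * ennreal (w t))\<^sup>2 \<partial>lborel) \<le> ennreal ((c * N g)\<^sup>2)" .
  have "0 \<le> c * N g" using assms by simp
  from conv_H_bound[OF * this] show "convolvable f g" "convolution f g \<in> H" "N (convolution f g) \<le> c * N g" .
qed

lemma J_op:
  assumes "\<And>g. g \<in> H \<Longrightarrow> convolvable f g" "\<And>g. g \<in> H \<Longrightarrow> convolution f g \<in> H"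
    "\<And>g. g \<in> H \<Longrightarrow> N (convolution f g) \<le> c * N g" "0 \<le> c"
  shows "J f \<in> bounded_ops H N H N" "op_norm H N N (J f) \<le> c"
proof -
  show "J f \<in> bounded_ops H N H N"
    by (rule HH.bounded_opsI[of _ c]) (use assms in \<open>simp_all add: conv_op_def conv_add_right conv_scale_right\<close>)
  show "op_norm H N N (J f) \<le> c"
    by (rule HH.op_norm_le) (use assms in \<open>simp_all add: conv_op_def\<close>)
qed

lemma J_L2: "f \<in> H \<Longrightarrow> J f \<in> bounded_ops H N H N" "f \<in> H \<Longrightarrow> op_norm H N N (J f) \<le> 2 * K * N f"
  using J_op[of f "2 * K * N f"] conv_L2[of f] K_pos by simp_all

lemma J_L1:
  assumes "n1 (fn f) \<le> ennreal c" "0 \<le> c"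
  shows "J f \<in> bounded_ops H N H N" "op_norm H N N (J f) \<le> c"
  using J_op[of f c] conv_L1[OF assms] assms by simp_all

end

section \<open>Convolution of monomials and approximation of step functions\<close>

lemma DERIV_power_fact:
  fixes s :: real
  shows "((\<lambda>s. s ^ Suc m / fact (Suc m)) has_real_derivative s ^ m / fact m) (at s within S)"
proof -
  have "((\<lambda>s. s ^ Suc m / fact (Suc m)) has_real_derivative real (Suc m) * s ^ m / fact (Suc m)) (at s within S)"
    using DERIV_pow[of "Suc m" s S] by (intro DERIV_cdivide) simp
  moreover have "real (Suc m) * s ^ m / fact (Suc m) = s ^ m / fact m"
    unfolding fact_Suc by (simp del: of_nat_Suc)
  ultimately show ?thesis by simp
qed

text \<open>The beta integral. Integration by parts lowers the degree of t - s and raises that of s,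
  so the induction needs \<open>m\<close> arbitrary.\<close>

lemma monomial_convolution:
  fixes t :: real
  assumes "0 \<le> t"
  shows "((\<lambda>s. (t - s) ^ n / fact n * (s ^ m / fact m)) has_integral t ^ (n + m + 1) / fact (n + m + 1)) {0..t}"
proof (induction n arbitrary: m)
  case 0
  have "((\<lambda>s. s ^ m / fact m) has_integral (t ^ Suc m / fact (Suc m) - 0 ^ Suc m / fact (Suc m))) {0..t}"
  proof (rule fundamental_theorem_of_calculus[OF assms])
    fix s :: real
    show "((\<lambda>s. s ^ Suc m / fact (Suc m)) has_vector_derivative s ^ m / fact m) (at s within {0..t})"
      using DERIV_power_fact unfolding has_real_derivative_iff_has_vector_derivative .
  qed
  then show ?case by simp
next
  case (Suc n)
  let ?G = "\<lambda>s. (t - s) ^ Suc n / fact (Suc n) * (s ^ Suc m / fact (Suc m))"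
  let ?g = "\<lambda>s. (t - s) ^ Suc n / fact (Suc n) * (s ^ m / fact m) - (t - s) ^ n / fact n * (s ^ Suc m / fact (Suc m))"
  have "(?g has_integral (?G t - ?G 0)) {0..t}"
  proof (rule fundamental_theorem_of_calculus[OF assms])
    fix s :: real
    have 1: "((\<lambda>s. (t - s) ^ Suc n / fact (Suc n)) has_real_derivative - ((t - s) ^ n / fact n)) (at s within {0..t})"
      by (rule DERIV_cong[OF DERIV_chain2[OF DERIV_power_fact]]) (auto intro!: derivative_eq_intros)
    have "(?G has_real_derivative ?g s) (at s within {0..t})"
      by (rule DERIV_cong[OF DERIV_mult[OF 1 DERIV_power_fact]]) (simp only: mult.commute mult_minus_left diff_conv_add_uminus add.commute)
    then show "(?G has_vector_derivative ?g s) (at s within {0..t})"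
      unfolding has_real_derivative_iff_has_vector_derivative .
  qed
  \<comment> \<open>The boundary terms vanish: at \<open>t\<close> because of the power of
    \<open>t - s\<close>, at 0 because of the power of \<open>s\<close>.\<close>
  then have "(?g has_integral 0) {0..t}" by simp
  from has_integral_add[OF this Suc[of "Suc m"]] show ?case by simp
qed

lemma power_fact_le_exp:
  fixes x :: real
  assumes "0 \<le> x"
  shows "(\<Sum>k<n. x ^ k / fact k) \<le> exp x" "x ^ n / fact n \<le> exp x"
proof -
  have s: "(\<lambda>k. x ^ k / fact k) sums exp x"
    using exp_converges[of x] by (simp add: divide_inverse mult.commute)
  show "(\<Sum>k<n. x ^ k / fact k) \<le> exp x"
    using sum_le_suminf[OF sums_summable[OF s], of "{..<n}"] assms sums_unique[OF s] by simp
  show "x ^ n / fact n \<le> exp x"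
    using sum_le_suminf[OF sums_summable[OF s], of "{n}"] assms sums_unique[OF s] by simp
qed

text \<open>The sequence \<open>1 - (1 - y\<^sup>n)\<^bsup>2^n\<^esup>\<close> tends to 0 or 1 according as \<open>y < 1/2\<close> or \<open>y > 1/2\<close>.\<close>

lemma step_limit:
  fixes c t :: real
  assumes c: "c > 0" and t: "0 \<le> t" "t \<noteq> c"
  defines "y \<equiv> exp (- (ln 2 / c) * t)"
  shows "(\<lambda>n. 1 - (1 - y ^ n) ^ (2 ^ n)) \<longlonglongrightarrow> indicator {..<c} t"
proof -
  have y: "0 < y" "y \<le> 1" using c t by (auto simp: y_def)
  have yn: "0 \<le> 1 - y ^ n" "1 - y ^ n \<le> 1" for n using y by (auto simp: power_le_one)
  have half: "exp (- ln 2 :: real) = 1 / 2" by (simp add: exp_minus)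
  show ?thesis
  proof (cases "t < c")
    case True
    \<comment> \<open>The rate \<open>ln 2 / c\<close> places the threshold y = 1/2 at t =
      c.\<close>
    have "- ln 2 < - (ln 2 / c) * t" using True c by (simp add: field_simps)
    then have y2: "1 / 2 < y" unfolding y_def half[symmetric] by simp
    have "(\<lambda>n. (1 - y ^ n) ^ (2 ^ n)) \<longlonglongrightarrow> 0"
    proof (rule Lim_null_comparison)
      show "(\<lambda>n. (1 / (2 * y)) ^ n) \<longlonglongrightarrow> 0"
        using y2 by (intro LIMSEQ_power_zero) simp
      have "norm ((1 - y ^ n) ^ (2 ^ n)) \<le> (1 / (2 * y)) ^ n" for n
      proof -
        have "(1 - y ^ n) ^ (2 ^ n) \<le> exp (- (y ^ n)) ^ (2 ^ n)"
          using yn exp_ge_add_one_self[of "- (y ^ n)"] by (intro power_mono) auto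
        also have "\<dots> = exp (- ((2 * y) ^ n))"
          by (simp add: exp_of_nat_mult[symmetric] power_mult_distrib)
        finally have le: "(1 - y ^ n) ^ (2 ^ n) \<le> exp (- ((2 * y) ^ n))" .
        have "(2 * y) ^ n \<le> exp ((2 * y) ^ n)"
          using exp_ge_add_one_self[of "(2 * y) ^ n"] by linarith
        then have "exp (- ((2 * y) ^ n)) \<le> 1 / (2 * y) ^ n"
          unfolding exp_minus inverse_eq_divide using y by (intro divide_left_mono) auto
        with le show ?thesis using yn by (simp add: power_divide)
      qed
      then show "\<forall>\<^sub>F n in sequentially. norm ((1 - y ^ n) ^ (2 ^ n)) \<le> (1 / (2 * y)) ^ n" by simp
    qed
    then show ?thesis using True tendsto_diff[OF tendsto_const] by fastforce
  next
    case False
    then have "- (ln 2 / c) * t < - ln 2" using t c by (simp add: field_simps)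
    then have y2: "y < 1 / 2" unfolding y_def half[symmetric] by simp
    have "(\<lambda>n. 1 - (1 - y ^ n) ^ (2 ^ n)) \<longlonglongrightarrow> 0"
    proof (rule Lim_null_comparison)
      show "(\<lambda>n. (2 * y) ^ n) \<longlonglongrightarrow> 0"
        using y y2 by (intro LIMSEQ_power_zero) simp
      have "norm (1 - (1 - y ^ n) ^ (2 ^ n)) \<le> (2 * y) ^ n" for n
      proof -
        have "1 + real (2 ^ n) * (- (y ^ n)) \<le> (1 + - (y ^ n)) ^ (2 ^ n)"
          using yn[of n] by (intro Bernoulli_inequality) simp
        moreover have "(1 - y ^ n) ^ (2 ^ n) \<le> 1" using yn by (intro power_le_one) auto
        ultimately show ?thesis by (simp add: power_mult_distrib)
      qed
      then show "\<forall>\<^sub>F n in sequentially. norm (1 - (1 - y ^ n) ^ (2 ^ n)) \<le> (2 * y) ^ n" by simp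
    qed
    then show ?thesis using False by simp
  qed
qed

section \<open>Monomials in the weighted space and their density\<close>

context weight
begin

lemma n2_exp: "n2 (\<lambda>t. complex_of_real (exp (q * t))) < \<infinity>"
proof -
  \<comment> \<open>Decay at rate \<open>q + 1\<close> leaves exp(-t) after the multiplication by
    exp(q t), which is at most \<open>damp t\<close>.\<close>
  obtain C where C: "\<And>t. t \<ge> 0 \<Longrightarrow> w t \<le> C * exp (- (q + 1) * t)" using w_exp[of "q + 1"] by blast
  have "n2 (\<lambda>t. complex_of_real (exp (q * t))) \<le> (\<integral>\<^sup>+ t. ennreal (C\<^sup>2) * (ennreal (damp t))\<^sup>2 \<partial>lborel)"
    unfolding n2_def
  proof (rule nn_integral_mono)
    fix t
    show "(ennreal (cmod (complex_of_real (exp (q * t))) * w t))\<^sup>2 \<le> ennreal (C\<^sup>2) * (ennreal (damp t))\<^sup>2"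
    proof (cases "t < 0")
      case False
      then have t: "t \<ge> 0" by simp
      have C0: "C \<ge> 0" using C[of 0] w_pos[of 0] by simp
      have "exp (q * t) * w t \<le> exp (q * t) * (C * exp (- (q + 1) * t))"
        using C[OF t] by (intro mult_left_mono) auto
      also have "\<dots> = C * exp (- t)" by (simp add: exp_add[symmetric] algebra_simps)
      also have "\<dots> \<le> C * damp t" using t C0 by (intro mult_left_mono) (auto simp: damp_def)
      finally have "ennreal (exp (q * t) * w t) \<le> ennreal C * ennreal (damp t)"
        using C0 damp_nonneg by (simp add: ennreal_leI flip: ennreal_mult)
      then have "(ennreal (exp (q * t) * w t))\<^sup>2 \<le> (ennreal C * ennreal (damp t))\<^sup>2"
        by (intro power_mono) auto
      then show ?thesis using C0 by (simp add: power_mult_distrib ennreal_power)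
    qed (simp add: w_neg)
  qed
  also have "\<dots> = ennreal (C\<^sup>2)" by (simp add: nn_integral_cmult nn_integral_damp_sq)
  finally show ?thesis by (simp add: le_less_trans)
qed

definition pw :: "nat \<Rightarrow> real \<Rightarrow> complex" where "pw n t = complex_of_real (t ^ n / fact n)"

definition p :: "nat \<Rightarrow> mfun" where "p n = abs_mfun (pw n)"

lemma pw_measurable [measurable]: "pw n \<in> borel_measurable borel"
  unfolding pw_def[abs_def] by measurable

lemma p_H: "p n \<in> H"
  unfolding p_def
proof (subst H_abs)
  have "n2 (pw n) \<le> n2 (\<lambda>t. complex_of_real (exp (1 * t)))"
    by (rule n2_mono) (use power_fact_le_exp(2)[of _ n] in \<open>simp add: pw_def norm_divide norm_power\<close>)
  then show "n2 (pw n) < \<infinity>" using n2_exp[of 1] le_less_trans by blast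
qed measurable

lemma J_abs:
  assumes "F \<in> borel_measurable borel" "G \<in> borel_measurable borel" "abs_mfun G \<in> H"
  shows "J (abs_mfun F) (abs_mfun G) = abs_mfun (\<lambda>t. LINT s:{0..t}|lborel. F (t - s) * G s)"
  using abs_mfun_conv[OF assms(1,2)] assms(3) by (simp add: conv_op_def)

text \<open>The functions, for example \<open>pw n\<close>, need not vanish on the negatives, so the
  integral is not \<open>cv\<close>. The moving domain is rewritten as the indicator of one fixed
  Borel set of pairs.\<close>

lemma set_conv_measurable [measurable]:
  fixes F G :: "real \<Rightarrow> complex"
  assumes [measurable]: "F \<in> borel_measurable borel" "G \<in> borel_measurable borel"
  shows "(\<lambda>t. LINT s:{0..t}|lborel. F (t - s) * G s) \<in> borel_measurable borel"
proof -
  have "(\<lambda>t. LINT s:{0..t}|lborel. F (t - s) * G s) =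
      (\<lambda>t. LINT s|lborel. indicator {x :: real \<times> real. 0 \<le> snd x \<and> snd x \<le> fst x} (t, s) *\<^sub>R (F (t - s) * G s))"
    unfolding set_lebesgue_integral_def by (intro ext Bochner_Integration.integral_cong) (auto simp: indicator_def)
  also have "\<dots> \<in> borel_measurable borel" by measurable
  finally show ?thesis .
qed

lemma p_conv: "J (p n) (p m) = p (n + m + 1)"
proof -
  have "(LINT s:{0..t}|lborel. pw n (t - s) * pw m s) = pw (n + m + 1) t" if "0 \<le> t" for t
  proof -
    let ?f = "\<lambda>s. (t - s) ^ n / fact n * (s ^ m / fact m)"
    have "set_integrable lborel {0..t} ?f"
      by (intro borel_integrable_atLeastAtMost') (auto intro!: continuous_intros)
    from set_borel_integral_eq_integral(2)[OF this]
    have "(LINT s:{0..t}|lborel. ?f s) = t ^ (n + m + 1) / fact (n + m + 1)"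
      unfolding integral_unique[OF monomial_convolution[OF that, of n m]] .
    moreover have "(LINT s:{0..t}|lborel. pw n (t - s) * pw m s) = complex_of_real (LINT s:{0..t}|lborel. ?f s)"
      unfolding set_integral_complex_of_real[symmetric] by (simp add: pw_def)
    ultimately show ?thesis by (simp add: pw_def)
  qed
  then show ?thesis
    unfolding p_def by (subst J_abs) (use p_H[of m] in \<open>simp_all add: p_def abs_mfun_eq_iff\<close>)
qed

text \<open>The exponential series at t / d gives t^n / n! <= d^n exp(t / d), and the norm of exp(t
  / d) does not depend on \<open>n\<close>.\<close>

lemma p_bound:
  assumes d: "d > 0"
  shows "\<exists>K. \<forall>n. N (p n) \<le> K * d ^ n"
proof (intro exI allI)
  fix n
  let ?E = "\<lambda>t. complex_of_real (exp (1 / d * t))"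
  have E: "abs_mfun ?E \<in> H" by (rule H_abs[THEN iffD2, OF _ n2_exp]) measurable
  have "n2 (pw n) \<le> n2 (\<lambda>t. complex_of_real (d ^ n) * ?E t)"
  proof (rule n2_mono)
    fix t :: real assume t: "0 \<le> t"
    have "t ^ n / fact n = d ^ n * ((1 / d * t) ^ n / fact n)" using d by (simp add: power_mult_distrib power_divide)
    also have "\<dots> \<le> d ^ n * exp (1 / d * t)"
      using d t by (intro mult_left_mono power_fact_le_exp) auto
    finally show "cmod (pw n t) \<le> cmod (complex_of_real (d ^ n) * ?E t)"
      using t d by (simp add: pw_def norm_mult norm_divide norm_power)
  qed
  also have "\<dots> = ennreal ((d ^ n)\<^sup>2) * n2 ?E" using d by (subst n2_scale) (auto simp: norm_power)
  also have "n2 ?E = ennreal ((N (abs_mfun ?E))\<^sup>2)"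
    using N_abs[of ?E] n2_exp[of "1 / d"] by simp
  also have "ennreal ((d ^ n)\<^sup>2) * ennreal ((N (abs_mfun ?E))\<^sup>2) = ennreal ((N (abs_mfun ?E) * d ^ n)\<^sup>2)"
    by (simp add: ennreal_mult[symmetric] power_mult_distrib mult.commute)
  finally have le: "n2 (pw n) \<le> ennreal ((N (abs_mfun ?E) * d ^ n)\<^sup>2)" .
  have "n2 (fn (p n)) = n2 (pw n)"
    unfolding p_def by (rule n2_cong[OF _ _ fn_abs]) measurable
  then show "N (p n) \<le> N (abs_mfun ?E) * d ^ n"
    using le d E by (intro N_le[OF p_H]) auto
qed

lemma abs_mfun_sum_mem:
  assumes "csubspace Z" "finite I" "\<And>i. i \<in> I \<Longrightarrow> F i \<in> borel_measurable borel"
    "\<And>i. i \<in> I \<Longrightarrow> abs_mfun (F i) \<in> Z"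
  shows "abs_mfun (\<lambda>t. \<Sum>i\<in>I. c i * F i t) \<in> Z"
proof -
  have "abs_mfun (\<lambda>t. \<Sum>i\<in>I. c i * F i t) = (\<Sum>i\<in>I. c i *\<^sub>C abs_mfun (F i))"
    using assms by (subst abs_mfun_sum[symmetric]) (auto simp: abs_mfun_scale)
  then show ?thesis
    using assms by (auto intro!: complex_vector.subspace_sum complex_vector.subspace_scale)
qed

text \<open>Dominated limits lead from monomials to exponentials by Taylor series, from exponentials
  to half-lines, by a Dynkin argument to Borel sets, and by simple functions to all of L2.
  Exponentials and constants may dominate because \<open>w\<close> decays faster than every
  exponential.\<close>

lemma closed_subspace_dense:
  assumes Z: "csubspace Z" "closedin (norm_topology H N) Z" "range p \<subseteq> Z"
  shows "Z = H"
proof -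
  have limZ: "abs_mfun L \<in> Z"
    if "\<And>n. F n \<in> borel_measurable borel" "L \<in> borel_measurable borel" "G \<in> borel_measurable borel"
      "n2 G < \<infinity>" "\<And>n. AE t in lborel. 0 \<le> t \<longrightarrow> cmod (F n t) \<le> cmod (G t)"
      "AE t in lborel. 0 \<le> t \<longrightarrow> (\<lambda>n. F n t) \<longlonglongrightarrow> L t" "\<And>n. abs_mfun (F n) \<in> Z" for F L G
    by (rule H.closed_lim[where x = "\<lambda>n. abs_mfun (F n)", OF Z(2) that(7) H_dominated(2,3)[OF that(1-6)]])
  note sumZ = abs_mfun_sum_mem[OF Z(1)]
  have pZ: "abs_mfun (pw k) \<in> Z" for k using Z(3) by (auto simp: p_def)
  \<comment> \<open>The Taylor sums of exp(-q t) are dominated by exp(|q| t), whose norm is finite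
    by \<open>n2_exp\<close>.\<close>
  have expZ: "abs_mfun (\<lambda>t. complex_of_real (exp (- q * t))) \<in> Z" for q
  proof (rule limZ)
    let ?F = "\<lambda>n t. \<Sum>k<n. complex_of_real ((- q) ^ k) * pw k t"
    show "abs_mfun (?F n) \<in> Z" for n by (rule sumZ) (use pZ in auto)
    show "n2 (\<lambda>t. complex_of_real (exp (\<bar>q\<bar> * t))) < \<infinity>" by (rule n2_exp)
    have eq: "?F n t = complex_of_real (\<Sum>k<n. (- q * t) ^ k / fact k)" for n t
      by (simp add: pw_def power_mult_distrib[symmetric])
    show "AE t in lborel. 0 \<le> t \<longrightarrow> cmod (?F n t) \<le> cmod (complex_of_real (exp (\<bar>q\<bar> * t)))" for n
    proof (intro always_eventually allI impI)
      fix t :: real assume "0 \<le> t"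
      have "cmod (?F n t) = \<bar>\<Sum>k<n. (- q * t) ^ k / fact k\<bar>" unfolding eq norm_of_real ..
      also have "\<dots> \<le> (\<Sum>k<n. \<bar>(- q * t) ^ k / fact k\<bar>)" by (rule sum_abs)
      also have "\<dots> = (\<Sum>k<n. (\<bar>q\<bar> * t) ^ k / fact k)" using \<open>0 \<le> t\<close> by (simp add: power_abs abs_mult)
      also have "\<dots> \<le> exp (\<bar>q\<bar> * t)" using \<open>0 \<le> t\<close> by (intro power_fact_le_exp) auto
      finally show "cmod (?F n t) \<le> cmod (complex_of_real (exp (\<bar>q\<bar> * t)))" by simp
    qed
    have "(\<lambda>n. ?F n t) \<longlonglongrightarrow> complex_of_real (exp (- q * t))" for t
    proof -
      have "(\<lambda>k. (- q * t) ^ k / fact k) sums exp (- q * t)"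
        using exp_converges[of "- q * t"] by (simp add: divide_inverse mult.commute)
      then show ?thesis unfolding eq sums_def by (rule tendsto_of_real)
    qed
    then show "AE t in lborel. 0 \<le> t \<longrightarrow> (\<lambda>n. ?F n t) \<longlonglongrightarrow> complex_of_real (exp (- q * t))" by simp
  qed measurable
  have n2_1: "n2 (\<lambda>_. 1) < \<infinity>" using n2_exp[of 0] by simp
  have iioZ: "abs_mfun (\<lambda>t. complex_of_real (indicator {..<c} t)) \<in> Z" for c :: real
  proof (cases "c > 0")
    case False
    have "abs_mfun (\<lambda>t. complex_of_real (indicator {..<c} t)) = abs_mfun (\<lambda>_. 0)"
      using False by (subst abs_mfun_eq_iff) (auto simp: indicator_def)
    then show ?thesis using complex_vector.subspace_0[OF Z(1)] by (simp add: abs_mfun_0)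
  next
    case True
    define l where "l = ln 2 / c"
    have l: "l > 0" using True by (simp add: l_def)
    define F where "F n t = complex_of_real (1 - (1 - exp (- l * t) ^ n) ^ (2 ^ n))" for n :: nat and t
    show ?thesis
    proof (rule limZ)
      show "F n \<in> borel_measurable borel" for n unfolding F_def[abs_def] by measurable
      show "n2 (\<lambda>_. 1) < \<infinity>" by (rule n2_1)
      show "abs_mfun (F n) \<in> Z" for n
      proof -
        \<comment> \<open>Coefficients of 1 - (1 - Y)^(2^n), where \<open>Y\<close> is the n-th
          power of exp(-l t): each power of \<open>Y\<close> is again an exponential, so
          \<open>expZ\<close> covers every term.\<close>
        define d where "d j = (if j = 0 then 1 else 0) - real (2 ^ n choose j) * (- 1) ^ j" for j
        have pow: "(1 - exp (- l * t) ^ n) ^ (2 ^ n) = (\<Sum>j\<le>2 ^ n. real (2 ^ n choose j) * (- 1) ^ j * exp (- (l * n * real j) * t))" for t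
        proof -
          have "(1 - exp (- l * t) ^ n) ^ (2 ^ n) = (- (exp (- l * t) ^ n) + 1) ^ (2 ^ n)" by simp
          also have "\<dots> = (\<Sum>j\<le>2 ^ n. real (2 ^ n choose j) * (- (exp (- l * t) ^ n)) ^ j)"
            by (subst binomial_ring) simp
          also have "\<dots> = (\<Sum>j\<le>2 ^ n. real (2 ^ n choose j) * (- 1) ^ j * exp (- (l * n * real j) * t))"
          proof (intro sum.cong refl)
            fix j
            have "(- (exp (- l * t) ^ n)) ^ j = (- 1) ^ j * exp (- (l * n * real j) * t)"
              by (subst power_minus) (simp add: exp_of_nat_mult[symmetric] mult_ac)
            then show "real (2 ^ n choose j) * (- (exp (- l * t) ^ n)) ^ j = real (2 ^ n choose j) * (- 1) ^ j * exp (- (l * n * real j) * t)"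
              by simp
          qed
          finally show ?thesis .
        qed
        have one: "(1 :: real) = (\<Sum>j\<le>2 ^ n. (if j = 0 then 1 else 0) * exp (- (l * n * real j) * t))" for t
          by (subst sum.remove[of _ 0]) auto
        have "1 - (1 - exp (- l * t) ^ n) ^ (2 ^ n) = (\<Sum>j\<le>2 ^ n. d j * exp (- (l * n * real j) * t))" for t
          unfolding d_def left_diff_distrib sum_subtractf pow one[of t, symmetric] ..
        then have "F n t = (\<Sum>j\<le>2 ^ n. complex_of_real (d j) * complex_of_real (exp (- (l * n * real j) * t)))" for t
          unfolding F_def by simp
        then have "F n = (\<lambda>t. \<Sum>j\<le>2 ^ n. complex_of_real (d j) * complex_of_real (exp (- (l * n * real j) * t)))" by (rule ext)
        then show ?thesis using sumZ[of "{..2 ^ n}" "\<lambda>j t. complex_of_real (exp (- (l * n * real j) * t))" "\<lambda>j. complex_of_real (d j)"] expZ by simp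
      qed
      show "AE t in lborel. 0 \<le> t \<longrightarrow> cmod (F n t) \<le> cmod 1" for n
      proof (intro always_eventually allI impI)
        fix t :: real assume "0 \<le> t"
        then have "exp (- l * t) ^ n \<le> 1" using l by (intro power_le_one) auto
        then have "0 \<le> (1 - exp (- l * t) ^ n) ^ (2 ^ n)" "(1 - exp (- l * t) ^ n) ^ (2 ^ n) \<le> 1"
          by (auto intro!: power_le_one)
        then show "cmod (F n t) \<le> cmod 1" unfolding F_def norm_of_real by simp
      qed
      show "AE t in lborel. 0 \<le> t \<longrightarrow> (\<lambda>n. F n t) \<longlonglongrightarrow> complex_of_real (indicator {..<c} t)"
        using AE_lborel_singleton[of c]
      proof eventually_elim
        fix t assume "t \<noteq> c"
        then show "0 \<le> t \<longrightarrow> (\<lambda>n. F n t) \<longlonglongrightarrow> complex_of_real (indicator {..<c} t)"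
          unfolding F_def l_def using tendsto_of_real[OF step_limit[OF True _ \<open>t \<noteq> c\<close>]] by blast
      qed
    qed measurable
  qed
  \<comment> \<open>Half-lines \<open>{..<c}\<close> are stable under intersection and generate the
    Borel sets; complements use the constant 1, which is exp(-q t) with q = 0.\<close>
  have indZ: "abs_mfun (\<lambda>t. complex_of_real (indicator E t)) \<in> Z" if "E \<in> sets borel" for E :: "real set"
  proof -
    have sb: "sets borel = sigma_sets UNIV (range (lessThan :: real \<Rightarrow> real set))"
      by (simp add: borel_Iio)
    have IS: "Int_stable (range (lessThan :: real \<Rightarrow> real set))"
    proof -
      have "{..<u} \<inter> {..<v} = {..<min u v}" for u v :: real by auto
      then show ?thesis by (auto simp: Int_stable_def)
    qed
    have E: "E \<in> sigma_sets UNIV (range lessThan)" using that sb by simp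
    have sub: "range (lessThan :: real \<Rightarrow> real set) \<subseteq> Pow UNIV" by simp
    from IS sub E show ?thesis
    proof (induction rule: sigma_sets_induct_disjoint)
      case (basic A)
      then show ?case using iioZ by auto
    next
      case empty
      then show ?case using complex_vector.subspace_0[OF Z(1)] by (simp add: abs_mfun_0)
    next
      case (compl A)
      then have [measurable]: "A \<in> sets borel" using sb by simp
      have one: "abs_mfun (\<lambda>t. 1) \<in> Z" using expZ[of 0] by simp
      have "(\<lambda>t. complex_of_real (indicator (UNIV - A) t)) = (\<lambda>t. 1 - complex_of_real (indicator A t))"
        by (auto simp: indicator_def fun_eq_iff)
      then have "abs_mfun (\<lambda>t. complex_of_real (indicator (UNIV - A) t)) = abs_mfun (\<lambda>t. 1) - abs_mfun (\<lambda>t. complex_of_real (indicator A t))"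
        by (simp add: abs_mfun_diff)
      then show ?case using complex_vector.subspace_diff[OF Z(1) one compl(2)] by simp
    next
      case (union A)
      then have [measurable]: "A i \<in> sets borel" for i using sb by auto
      let ?F = "\<lambda>n t. \<Sum>i<n. 1 * complex_of_real (indicator (A i) t)"
      have eq: "?F n t = complex_of_real (indicator (\<Union>i<n. A i) t)" for n t
        using union(1) by (subst indicator_UN_disjoint) (auto simp: disjoint_family_on_def)
      show ?case
      proof (rule limZ)
        show "abs_mfun (?F n) \<in> Z" for n using union(3) by (intro sumZ) auto
        show "n2 (\<lambda>_. 1) < \<infinity>" by (rule n2_1)
        show "AE t in lborel. 0 \<le> t \<longrightarrow> cmod (?F n t) \<le> cmod 1" for n
          unfolding eq by (simp add: indicator_def)
        show "AE t in lborel. 0 \<le> t \<longrightarrow> (\<lambda>n. ?F n t) \<longlonglongrightarrow> complex_of_real (indicator (\<Union> (range A)) t)"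
          unfolding eq by (intro always_eventually allI impI tendsto_of_real LIMSEQ_indicator_UN)
      qed measurable
    qed
  qed
  have "h \<in> Z" if h: "h \<in> H" for h
  proof -
    obtain S where S: "\<And>i. simple_function borel (S i)" "\<And>t. (\<lambda>i. S i t) \<longlonglongrightarrow> fn h t"
        "\<And>i t. cmod (S i t) \<le> 2 * cmod (fn h t)"
      using borel_measurable_implies_sequence_metric[OF fn_measurable[of h], of 0] by auto
    have "abs_mfun (fn h) \<in> Z"
    proof (rule limZ)
      show [measurable]: "S i \<in> borel_measurable borel" for i using S(1) by (rule borel_measurable_simple_function)
      show "n2 (\<lambda>t. 2 * fn h t) < \<infinity>" using h by (subst n2_scale) (auto simp: H_fn ennreal_mult_less_top)
      show "AE t in lborel. 0 \<le> t \<longrightarrow> cmod (S i t) \<le> cmod (2 * fn h t)" for i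
        using S(3) by (simp add: norm_mult)
      show "AE t in lborel. 0 \<le> t \<longrightarrow> (\<lambda>i. S i t) \<longlonglongrightarrow> fn h t" using S(2) by simp
      show "abs_mfun (S i) \<in> Z" for i
      proof -
        have fin: "finite (range (S i))" using simple_functionD(1)[OF S(1)[of i]] by simp
        have "S i = (\<lambda>t. \<Sum>y\<in>range (S i). y * complex_of_real (indicator (S i -` {y}) t))"
        proof
          fix t
          have "(\<Sum>y\<in>range (S i). y * complex_of_real (indicator (S i -` {y}) t)) =
              (\<Sum>y\<in>range (S i). if y = S i t then y else 0)"
            by (intro sum.cong) (auto simp: indicator_def)
          then show "S i t = (\<Sum>y\<in>range (S i). y * complex_of_real (indicator (S i -` {y}) t))"
            using fin by simp
        qed
        moreover have "S i -` {y} \<in> sets borel" for y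
          using simple_functionD(2)[OF S(1)[of i], of "{y}"] by simp
        ultimately show ?thesis
          using sumZ[OF fin, of "\<lambda>y t. complex_of_real (indicator (S i -` {y}) t)" "\<lambda>y. y"] indZ by simp
      qed
    qed measurable
    then show ?thesis by (simp add: abs_fn)
  qed
  moreover have "Z \<subseteq> H" using Z(2) H.closedin_iff by blast
  ultimately show ?thesis by blast
qed

sublocale hilbert_algebra H N ip J "2 * K" p
proof
  show "J (h + k) = J h + J k" if "h \<in> H" "k \<in> H" for h k
    using that by (intro ext) (simp add: conv_op_def conv_add_left conv_L2)
  show "J (c *\<^sub>C h) = c *\<^sub>C J h" for c h
    by (intro ext) (simp add: conv_op_def conv_scale_left scaleC_fun_def)
  show "Z = H" if "csubspace Z" "closedin (norm_topology H N) Z" "range p \<subseteq> Z" for Z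
    using closed_subspace_dense that by blast
qed (use J_L2 p_H p_conv p_bound in auto)

end

section \<open>L1 and L2 multipliers have the same closure\<close>

context weight
begin

lemma n1_fn_abs:
  assumes "F \<in> borel_measurable borel"
  shows "n1 (fn (abs_mfun F)) = n1 F"
  using Lp_integral_abs(1)[OF assms] Lp_integral_abs(1)[OF fn_measurable, of "abs_mfun F"] by (simp add: abs_fn)

lemma L1_fn: "f \<in> Lp_space \<omega> 1 \<longleftrightarrow> n1 (fn f) < \<infinity>"
  using L1_abs[OF fn_measurable, of f] by (simp add: abs_fn)

text \<open>Cutting \<open>f\<close> off in height puts it into L2, because w is bounded and |F n|^2
  w^2 <= n C |f| w for a bound C of w. The error tends to 0 in L1, where \<open>J_L1\<close> bounds
  the operator norm.\<close>

lemma J_L1_A: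
  assumes f: "f \<in> Lp_space \<omega> 1"
  shows "J f \<in> A"
proof -
  have f1: "n1 (fn f) < \<infinity>" using f by (simp add: L1_fn)
  obtain C where C: "\<And>t. t \<ge> 0 \<Longrightarrow> w t \<le> C" using w_exp[of 0] by auto
  have wC: "w t \<le> \<bar>C\<bar>" for t using C[of t] w_neg[of t] by (cases "t < 0") auto
  define F where "F n t = (if cmod (fn f t) \<le> real n then fn f t else 0)" for n :: nat and t
  have [measurable]: "F n \<in> borel_measurable borel" for n unfolding F_def[abs_def] by measurable
  have FH: "abs_mfun (F n) \<in> H" for n
  proof (rule H_abs[THEN iffD2])
    have "n2 (F n) \<le> (\<integral>\<^sup>+ t. ennreal (real n * \<bar>C\<bar>) * ennreal (cmod (fn f t) * w t) \<partial>lborel)"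
      unfolding n2_def
    proof (rule nn_integral_mono)
      fix t
      have "cmod (F n t) * w t \<le> real n * \<bar>C\<bar>"
        by (rule mult_mono) (auto simp: F_def wC w_nonneg)
      moreover have "cmod (F n t) * w t \<le> cmod (fn f t) * w t"
        by (rule mult_right_mono) (auto simp: F_def w_nonneg)
      ultimately have "(cmod (F n t) * w t) * (cmod (F n t) * w t) \<le> (real n * \<bar>C\<bar>) * (cmod (fn f t) * w t)"
        by (rule mult_mono) (auto simp: w_nonneg)
      then show "(ennreal (cmod (F n t) * w t))\<^sup>2 \<le> ennreal (real n * \<bar>C\<bar>) * ennreal (cmod (fn f t) * w t)"
        using w_nonneg by (simp add: power2_eq_square ennreal_leI flip: ennreal_mult)
    qed
    also have "\<dots> < \<infinity>" using f1 by (simp add: nn_integral_cmult n1_def ennreal_mult_less_top)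
    finally show "n2 (F n) < \<infinity>" .
  qed measurable
  have "(\<lambda>n. n1 (\<lambda>t. F n t - fn f t)) \<longlonglongrightarrow> (\<integral>\<^sup>+ t. (\<lambda>_. 0) t \<partial>(lborel :: real measure))"
    unfolding n1_def
  proof (rule nn_integral_dominated_convergence[where w = "\<lambda>t. ennreal (cmod (fn f t) * w t)"])
    show "(\<integral>\<^sup>+ t. ennreal (cmod (fn f t) * w t) \<partial>lborel) < \<infinity>" using f1 by (simp add: n1_def)
    show "AE t in lborel. ennreal (cmod (F n t - fn f t) * w t) \<le> ennreal (cmod (fn f t) * w t)" for n
      by (intro always_eventually allI ennreal_leI mult_right_mono) (auto simp: F_def w_nonneg)
    show "AE t in lborel. (\<lambda>n. ennreal (cmod (F n t - fn f t) * w t)) \<longlonglongrightarrow> 0"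
    proof (intro always_eventually allI)
      fix t
      obtain n0 :: nat where "cmod (fn f t) \<le> real n0" using real_arch_simple by blast
      then have "ennreal (cmod (F n t - fn f t) * w t) = 0" if "n \<ge> n0" for n
        using that by (auto simp: F_def)
      then show "(\<lambda>n. ennreal (cmod (F n t - fn f t) * w t)) \<longlonglongrightarrow> 0"
        by (intro tendsto_eventually eventually_sequentiallyI)
    qed
  qed measurable
  then have lim: "(\<lambda>n. n1 (\<lambda>t. F n t - fn f t)) \<longlonglongrightarrow> 0" by simp
  have fin: "n1 (\<lambda>t. F n t - fn f t) \<le> n1 (fn f)" for n
    unfolding n1_def by (intro nn_integral_mono ennreal_leI mult_right_mono) (auto simp: F_def w_nonneg)
  define c where "c n = enn2real (n1 (\<lambda>t. F n t - fn f t))" for n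
  have c: "n1 (\<lambda>t. F n t - fn f t) = ennreal (c n)" for n
    unfolding c_def using le_less_trans[OF fin f1] by simp
  have clim: "c \<longlonglongrightarrow> 0"
    unfolding c_def by (rule tendsto_enn2real) (use lim in simp_all)
  define D where "D n = abs_mfun (\<lambda>t. F n t - fn f t)" for n
  have D1: "n1 (fn (D n)) \<le> ennreal (c n)" for n
    unfolding D_def by (simp add: n1_fn_abs c)
  have c0: "0 \<le> c n" for n by (simp add: c_def)
  have f1': "n1 (fn f) \<le> ennreal (enn2real (n1 (fn f)))" using f1 by simp
  have Jf: "J f \<in> Op" by (rule J_L1(1)[OF f1']) simp
  have split: "J (abs_mfun (F n)) = J (D n) + J f" for n
  proof
    fix g
    have "abs_mfun (F n) = D n + f"
      using abs_mfun_add[of "\<lambda>t. F n t - fn f t" "fn f"] by (simp add: D_def abs_fn)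
    then show "J (abs_mfun (F n)) g = (J (D n) + J f) g"
      using conv_add_left[OF conv_L1(1)[OF D1 c0] conv_L1(1)[OF f1' enn2real_nonneg], of g n] by (simp add: conv_op_def)
  qed
  show ?thesis
  proof (rule HH.ops.closed_lim[OF A_closed, where x = "\<lambda>n. J (abs_mfun (F n))"])
    show "J (abs_mfun (F n)) \<in> A" for n using FH J_A by blast
    show "(\<lambda>n. nrm (J (abs_mfun (F n)) - J f)) \<longlonglongrightarrow> 0"
    proof (rule Lim_null_comparison[OF _ clim])
      have "nrm (J (abs_mfun (F n)) - J f) \<le> c n" for n
        unfolding split using J_L1(2)[OF D1 c0, of n] by simp
      then show "\<forall>\<^sub>F n in sequentially. norm (nrm (J (abs_mfun (F n)) - J f)) \<le> c n"
        using HH.ops.N_nonneg[OF HH.ops.diff_mem[OF A_op[OF J_A[OF FH]] Jf]] by simp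
    qed
  qed (rule Jf)
qed

lemma J_L1_image: "J ` Lp_space \<omega> 1 \<subseteq> Op"
  using J_L1_A A_op by blast

text \<open>Cutting \<open>h\<close> off in time puts it into L1: on \<open>{0..n}\<close> the
  function \<open>damp\<close> is at least exp(-n/2), and a damped L2 function is integrable against
  \<open>w\<close>.\<close>

lemma J_L2_closure:
  assumes h: "h \<in> H"
  shows "J h \<in> norm_topology Op nrm closure_of (J ` Lp_space \<omega> 1)"
proof -
  define F where "F n t = complex_of_real (indicator {..real n} t) * fn h t" for n :: nat and t
  have [measurable]: "F n \<in> borel_measurable borel" for n unfolding F_def[abs_def] by measurable
  have h2: "n2 (fn h) < \<infinity>" using h by (simp add: H_fn)
  have bnd: "AE t in lborel. 0 \<le> t \<longrightarrow> cmod (F n t) \<le> cmod (fn h t)" for n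
    by (simp add: F_def norm_mult indicator_def)
  have "(\<lambda>n. F n t) \<longlonglongrightarrow> fn h t" for t
  proof -
    obtain n0 :: nat where "t \<le> real n0" using real_arch_simple by blast
    then have "F n t = fn h t" if "n \<ge> n0" for n using that by (auto simp: F_def indicator_def)
    then show ?thesis by (intro tendsto_eventually eventually_sequentiallyI)
  qed
  then have lim: "AE t in lborel. 0 \<le> t \<longrightarrow> (\<lambda>n. F n t) \<longlonglongrightarrow> fn h t" by simp
  have FH: "abs_mfun (F n) \<in> H" for n
    by (rule H_dominated(1)[OF _ _ _ h2 bnd lim]) measurable
  have Nlim: "(\<lambda>n. N (abs_mfun (F n) - h)) \<longlonglongrightarrow> 0"
    using H_dominated(3)[OF _ _ _ h2 bnd lim] by (simp add: abs_fn)
  have F1: "abs_mfun (F n) \<in> Lp_space \<omega> 1" for n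
  proof (rule L1_abs[THEN iffD2])
    have "n1 (F n) \<le> (\<integral>\<^sup>+ t. ennreal (exp (real n / 2)) * (ennreal (damp t) * ennreal (cmod (fn h t) * w t)) \<partial>lborel)"
      unfolding n1_def
    proof (rule nn_integral_mono)
      fix t
      have "cmod (F n t) * w t \<le> exp (real n / 2) * (damp t * (cmod (fn h t) * w t))"
      proof (cases "0 \<le> t \<and> t \<le> real n")
        case True
        have "1 \<le> exp (real n / 2) * damp t" using True by (simp add: damp_def exp_add[symmetric])
        from mult_right_mono[OF this, of "cmod (fn h t) * w t"] show ?thesis
          using True w_nonneg by (simp add: F_def mult_ac)
      qed (auto simp: F_def w_nonneg damp_nonneg w_neg not_le)
      then show "ennreal (cmod (F n t) * w t) \<le> ennreal (exp (real n / 2)) * (ennreal (damp t) * ennreal (cmod (fn h t) * w t))"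
        using w_nonneg damp_nonneg by (simp add: ennreal_leI flip: ennreal_mult)
    qed
    also have "\<dots> = ennreal (exp (real n / 2)) * (\<integral>\<^sup>+ t. ennreal (damp t) * ennreal (cmod (fn h t) * w t) \<partial>lborel)"
      by (rule nn_integral_cmult) measurable
    also have "\<dots> < \<infinity>"
    proof -
      have "(\<integral>\<^sup>+ t. ennreal (damp t) * ennreal (cmod (fn h t) * w t) \<partial>lborel)\<^sup>2 < \<infinity>"
        using nn_integral_damp_fn[OF fn_measurable, of h] h2 by (rule le_less_trans)
      then have "(\<integral>\<^sup>+ t. ennreal (damp t) * ennreal (cmod (fn h t) * w t) \<partial>lborel) < \<infinity>"
        by (simp add: power_less_top_ennreal)
      then show ?thesis by (simp add: ennreal_mult_less_top)
    qed
    finally show "n1 (F n) < \<infinity>" .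
  qed measurable
  show ?thesis
  proof (rule HH.ops.closed_lim[OF closedin_closure_of _ _ J_lim[OF FH h Nlim]])
    show "J (abs_mfun (F n)) \<in> norm_topology Op nrm closure_of J ` Lp_space \<omega> 1" for n
      using F1 closure_of_subset[of "J ` Lp_space \<omega> 1" "norm_topology Op nrm"] J_L1_image by auto
  qed (use h J_mem in blast)
qed

lemma conv_algebra_eq: "conv_algebra \<omega> = A"
proof
  show "conv_algebra \<omega> \<subseteq> A"
    unfolding conv_algebra_def L2_ops_def L2_op_norm_def
    by (rule closure_of_minimal[OF _ A_closed]) (use J_L1_A in blast)
  show "A \<subseteq> conv_algebra \<omega>"
    unfolding conv_algebra_def L2_ops_def L2_op_norm_def A_def
    by (rule closure_of_minimal[OF _ closedin_closure_of]) (use J_L2_closure in blast)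
qed

end

section \<open>The approximate unit\<close>

locale staircase_weight = weight +
  assumes w_0: "w 0 = 1" and w_step: "real n \<le> t \<Longrightarrow> t < real n + 1 \<Longrightarrow> w t = w (real n)"
begin

text \<open>With n + 2 the interval always lies in [0, 1), where the weight is 1; the L1 norm is
  then exactly 1 and the approximate unit is contractive.\<close>

definition bump_fn :: "nat \<Rightarrow> real \<Rightarrow> complex"
  where "bump_fn n t = complex_of_real ((real n + 2) * indicator {0..1 / (real n + 2)} t)"

definition bump :: "nat \<Rightarrow> mfun" where "bump n = abs_mfun (bump_fn n)"

lemma bump_fn_measurable [measurable]: "bump_fn n \<in> borel_measurable borel"
  unfolding bump_fn_def[abs_def] by measurable

lemma n2_const: "n2 (\<lambda>_. c) < \<infinity>"
proof -
  have "n2 (\<lambda>t. c * complex_of_real (exp (0 * t))) < \<infinity>"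
    using n2_exp[of 0] by (subst n2_scale) (auto simp: ennreal_mult_less_top)
  then show ?thesis by simp
qed

lemma bump_H: "bump n \<in> H"
  unfolding bump_def
proof (rule H_abs[THEN iffD2])
  have "n2 (bump_fn n) \<le> n2 (\<lambda>_. complex_of_real (real n + 2))"
    by (rule n2_mono) (simp add: bump_fn_def indicator_def)
  then show "n2 (bump_fn n) < \<infinity>" using n2_const le_less_trans by blast
qed measurable

lemma bump_norm: "nrm (J (bump n)) \<le> 1"
proof (rule J_L1(2))
  have "n1 (bump_fn n) = (\<integral>\<^sup>+ t. ennreal (real n + 2) * indicator {0..1 / (real n + 2)} t \<partial>lborel)"
    unfolding n1_def
  proof (rule nn_integral_cong)
    fix t
    have "w t = 1" if "0 \<le> t" "t \<le> 1 / (real n + 2)"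
    proof -
      have "1 / (real n + 2) < 1" by (simp add: divide_less_eq_1)
      then have "t < 1" using that by linarith
      then show ?thesis using w_step[of 0 t] w_0 that by simp
    qed
    then show "ennreal (cmod (bump_fn n t) * w t) = ennreal (real n + 2) * indicator {0..1 / (real n + 2)} t"
      unfolding bump_fn_def norm_of_real by (auto simp: indicator_def)
  qed
  also have "\<dots> = ennreal (real n + 2) * ennreal (1 / (real n + 2))"
    by (simp add: nn_integral_cmult_indicator)
  also have "\<dots> = ennreal ((real n + 2) * (1 / (real n + 2)))"
    by (rule ennreal_mult[symmetric]) simp_all
  also have "\<dots> = 1" by simp
  finally show "n1 (fn (bump n)) \<le> ennreal 1" unfolding bump_def by (simp add: n1_fn_abs)
qed simp

lemma bump_lim: "(\<lambda>n. N (J (bump n) (p 0) - p 0)) \<longlonglongrightarrow> 0"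
proof -
  define F where "F n t = complex_of_real ((real n + 2) * min t (1 / (real n + 2)))" for n :: nat and t
  have [measurable]: "F n \<in> borel_measurable borel" for n unfolding F_def[abs_def] by measurable
  have eq: "J (bump n) (p 0) = abs_mfun (F n)" for n
  proof -
    let ?r = "1 / (real n + 2)"
    have "(LINT s:{0..t}|lborel. pw 0 (t - s) * bump_fn n s) = F n t" if t: "0 \<le> t" for t
    proof -
      have "(LINT s:{0..t}|lborel. pw 0 (t - s) * bump_fn n s) = (LINT s|lborel. complex_of_real ((real n + 2) * indicator {0..min t ?r} s))"
        unfolding set_lebesgue_integral_def
        by (intro Bochner_Integration.integral_cong) (auto simp: pw_def bump_fn_def indicator_def)
      also have "\<dots> = complex_of_real ((real n + 2) * min t ?r)"
        unfolding integral_complex_of_real using t by (simp add: min_def)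
      finally show ?thesis by (simp add: F_def)
    qed
    \<comment> \<open>The product is computed with \<open>p 0\<close> on the left, where it is the
      integral of the bump over \<open>{0..t}\<close>; commutativity restores the order.\<close>
    then have "J (p 0) (bump n) = abs_mfun (F n)"
      unfolding p_def bump_def using bump_H[of n]
      by (subst J_abs) (auto simp: bump_def abs_mfun_eq_iff)
    then show ?thesis using J_commute[OF bump_H p_H] by simp
  qed
  show ?thesis
    unfolding eq unfolding p_def
  proof (rule H_dominated(3)[OF _ _ _ n2_const[of 1]])
    show "AE t in lborel. 0 \<le> t \<longrightarrow> cmod (F n t) \<le> cmod 1" for n
    proof (intro always_eventually allI impI)
      fix t :: real assume "0 \<le> t"
      have "(real n + 2) * min t (1 / (real n + 2)) \<le> (real n + 2) * (1 / (real n + 2))"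
        by (intro mult_left_mono) auto
      also have "\<dots> = 1" by simp
      finally show "cmod (F n t) \<le> cmod 1" using \<open>0 \<le> t\<close> unfolding F_def norm_of_real by simp
    qed
    \<comment> \<open>Every \<open>F n\<close> is 0 at 0, so this one point has to be left
      out.\<close>
    show "AE t in lborel. 0 \<le> t \<longrightarrow> (\<lambda>n. F n t) \<longlonglongrightarrow> pw 0 t"
      using AE_lborel_singleton[of 0]
    proof eventually_elim
      fix t :: real assume "t \<noteq> 0"
      show "0 \<le> t \<longrightarrow> (\<lambda>n. F n t) \<longlonglongrightarrow> pw 0 t"
      proof
        assume "0 \<le> t"
        then have t: "t > 0" using \<open>t \<noteq> 0\<close> by simp
        obtain n0 :: nat where n0: "1 / t \<le> real n0" using real_arch_simple by blast
        have "F n t = pw 0 t" if "n \<ge> n0" for n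
        proof -
          have "1 / t \<le> real n + 2" using n0 that by simp
          then have "1 / (real n + 2) \<le> t" using t by (simp add: field_simps)
          then have "(real n + 2) * min t (1 / (real n + 2)) = 1" by (simp add: min_def)
          then show ?thesis unfolding F_def by (simp add: pw_def)
        qed
        then show "(\<lambda>n. F n t) \<longlonglongrightarrow> pw 0 t" by (intro tendsto_eventually eventually_sequentiallyI)
      qed
    qed
  qed measurable
qed

section \<open>Normalised windows and their separation\<close>

definition window_fn :: "nat \<Rightarrow> real \<Rightarrow> complex"
  where "window_fn n t = complex_of_real (indicator {real n..<real n + 1} t / w (real n))"

definition window :: "nat \<Rightarrow> mfun" where "window n = abs_mfun (window_fn n)"

lemma window_fn_measurable [measurable]: "window_fn n \<in> borel_measurable borel"
  unfolding window_fn_def[abs_def] by measurable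

lemma window_H: "window n \<in> H"
  unfolding window_def
proof (rule H_abs[THEN iffD2])
  have "n2 (window_fn n) \<le> n2 (\<lambda>_. complex_of_real (1 / w (real n)))"
    by (rule n2_mono) (simp add: window_fn_def indicator_def)
  then show "n2 (window_fn n) < \<infinity>" using n2_const le_less_trans by blast
qed measurable

lemma window_norm: "nrm (J (window n)) \<le> 1"
proof (rule J_L1(2))
  have "n1 (window_fn n) = (\<integral>\<^sup>+ t. indicator {real n..<real n + 1} t \<partial>lborel)"
    unfolding n1_def
  proof (rule nn_integral_cong)
    fix t show "ennreal (cmod (window_fn n t) * w t) = indicator {real n..<real n + 1} t"
      using w_step[of n t] w_pos[of "real n"] by (auto simp: window_fn_def indicator_def norm_divide)
  qed
  also have "\<dots> = 1" by simp
  finally show "n1 (fn (window n)) \<le> ennreal 1" unfolding window_def by (simp add: n1_fn_abs)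
qed simp

definition ramp :: "nat \<Rightarrow> real \<Rightarrow> complex"
  where "ramp n t = (LINT s:{0..t}|lborel. pw 2 (t - s) * window_fn n s)"

lemma ramp_measurable [measurable]: "ramp n \<in> borel_measurable borel"
  unfolding ramp_def[abs_def] by measurable

lemma J_p2_win: "J (p 2) (window n) = abs_mfun (ramp n)"
  unfolding p_def window_def ramp_def[abs_def]
  by (rule J_abs) (use window_H[of n] in \<open>auto simp: window_def\<close>)

lemma ramp_0: "t < real n \<Longrightarrow> ramp n t = 0"
  unfolding ramp_def set_lebesgue_integral_def
  by (rule integral_eq_zero_AE) (auto simp: window_fn_def indicator_def)

lemma ramp_window:
  assumes "real n \<le> t" "t < real n + 1"
  shows "ramp n t = complex_of_real ((t - real n) ^ 3 / 6 / w (real n))"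
proof -
  have i: "((\<lambda>s. (t - s)\<^sup>2 / 2) has_integral (- ((t - t) ^ 3) / 6 - (- ((t - real n) ^ 3) / 6))) {real n..t}"
  proof (rule fundamental_theorem_of_calculus[OF assms(1)])
    fix s
    have "((\<lambda>s. - ((t - s) ^ 3) / 6) has_real_derivative (t - s)\<^sup>2 / 2) (at s within {real n..t})"
      by (auto intro!: derivative_eq_intros simp: power2_eq_square field_simps)
    then show "((\<lambda>s. - ((t - s) ^ 3) / 6) has_vector_derivative (t - s)\<^sup>2 / 2) (at s within {real n..t})"
      unfolding has_real_derivative_iff_has_vector_derivative .
  qed
  have "set_integrable lborel {real n..t} (\<lambda>s. (t - s)\<^sup>2 / 2)"
    by (intro borel_integrable_atLeastAtMost') (auto intro!: continuous_intros)
  from set_borel_integral_eq_integral(2)[OF this]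
  have I: "(LINT s:{real n..t}|lborel. (t - s)\<^sup>2 / 2) = (t - real n) ^ 3 / 6"
    unfolding integral_unique[OF i] by simp
  have "ramp n t = (LINT s|lborel. complex_of_real (indicator {real n..t} s *\<^sub>R ((t - s)\<^sup>2 / 2) / w (real n)))"
    unfolding ramp_def set_lebesgue_integral_def
    by (intro Bochner_Integration.integral_cong)
      (use assms in \<open>auto simp: pw_def window_fn_def indicator_def\<close>)
  also have "\<dots> = complex_of_real ((LINT s:{real n..t}|lborel. (t - s)\<^sup>2 / 2) / w (real n))"
    unfolding integral_complex_of_real set_lebesgue_integral_def by simp
  finally show ?thesis unfolding I .
qed

text \<open>For m < n the second product vanishes before time \<open>n\<close>, so on the second
  half of [m, m + 1) only the first is seen. There the weight cancels the normalisation, whatever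
  \<open>m\<close> is, and leaves at least (1/2)^3 / 6 = 1/48; its square over length 1/2 is
  1/4608.\<close>

lemma window_separated:
  assumes "m < n"
  shows "1 / 100 \<le> N (J (p 2) (window m) - J (p 2) (window n))"
proof -
  let ?D = "J (p 2) (window m) - J (p 2) (window n)"
  have DH: "?D \<in> H" using J_app_mem[OF p_H window_H] by simp
  have "ennreal (1 / 4608) = (\<integral>\<^sup>+ t. ennreal ((1 / 48)\<^sup>2) * indicator {real m + 1 / 2..<real m + 1} t \<partial>lborel)"
  proof -
    have e: "emeasure lborel {real m + 1 / 2..<real m + 1} = ennreal (1 / 2)"
      using emeasure_lborel_Ico[of "real m + 1 / 2" "real m + 1"] by simp
    have "ennreal ((1 / 48)\<^sup>2) * ennreal (1 / 2) = ennreal ((1 / 48)\<^sup>2 * (1 / 2))"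
      by (rule ennreal_mult[symmetric]) simp_all
    also have "(1 / 48)\<^sup>2 * (1 / 2) = (1 / 4608 :: real)" by (simp add: power2_eq_square)
    finally show ?thesis
      by (subst nn_integral_cmult_indicator) (simp, simp only: e)
  qed
  also have "\<dots> \<le> n2 (\<lambda>t. ramp m t - ramp n t)"
    unfolding n2_def
  proof (rule nn_integral_mono)
    fix t
    show "ennreal ((1 / 48)\<^sup>2) * indicator {real m + 1 / 2..<real m + 1} t \<le> (ennreal (cmod (ramp m t - ramp n t) * w t))\<^sup>2"
    proof (cases "t \<in> {real m + 1 / 2..<real m + 1}")
      case True
      then have t: "real m \<le> t" "t < real m + 1" "t < real n" "1 / 2 \<le> t - real m" using assms by auto
      have wt: "w t = w (real m)" "w (real m) > 0" using w_step[OF t(1,2)] w_pos by auto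
      have "cmod (ramp m t - ramp n t) * w t = (t - real m) ^ 3 / 6"
        unfolding ramp_0[OF t(3)] ramp_window[OF t(1,2)] diff_zero norm_of_real using wt t by simp
      also have "\<dots> \<ge> (1 / 2) ^ 3 / 6" using t by (intro divide_right_mono power_mono) auto
      finally have "1 / 48 \<le> cmod (ramp m t - ramp n t) * w t" by (simp add: power3_eq_cube)
      then have "(ennreal (1 / 48))\<^sup>2 \<le> (ennreal (cmod (ramp m t - ramp n t) * w t))\<^sup>2"
        by (intro power_mono ennreal_leI) auto
      then show ?thesis using True by (simp add: ennreal_power)
    qed simp
  qed
  also have "n2 (\<lambda>t. ramp m t - ramp n t) = ennreal ((N ?D)\<^sup>2)"
  proof -
    have D: "?D = abs_mfun (\<lambda>t. ramp m t - ramp n t)"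
      unfolding J_p2_win by (rule abs_mfun_diff) measurable
    have "n2 (fn ?D) = n2 (\<lambda>t. ramp m t - ramp n t)"
      unfolding D by (rule n2_cong[OF _ _ fn_abs]) measurable
    then show ?thesis using n2_fn[OF DH] by simp
  qed
  finally have "1 / 4608 \<le> (N ?D)\<^sup>2" by (simp add: ennreal_le_iff)
  \<comment> \<open>A round lower bound for the square root of 1/4608.\<close>
  then have "(1 / 100)\<^sup>2 \<le> (N ?D)\<^sup>2" by (simp add: power2_eq_square)
  then show ?thesis by (rule power2_le_imp_le) (use DH in simp)
qed

text \<open>Otherwise the factorisation of \<open>p 2\<close> through \<open>p 0\<close> would make
  \<open>J (p 2)\<close> vanish, and the window products would coincide.\<close>

lemma p0_nonzero: "p 0 \<noteq> 0"
proof
  assume "p 0 = 0"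
  then have "J (p 2) = 0"
    using J_p_comp[of 0 1] J_scale[OF H.zero_mem, of 0] by (simp add: fun_eq_iff numeral_2_eq_2)
  then have "N (J (p 2) (window 0) - J (p 2) (window 1)) = 0" by simp
  then show False using window_separated[of 0 1] by simp
qed

theorem conv_algebra_properties:
  "\<not> compact_algebra (conv_algebra \<omega>) (L2_op_norm \<omega>) (\<circ>) \<and>
    weakly_compact_algebra (conv_algebra \<omega>) (L2_op_norm \<omega>) (\<circ>) \<and>
    ideal_in_bidual (conv_algebra \<omega>) (L2_op_norm \<omega>) (\<circ>) \<and>
    operator_algebra_on (Lp_space \<omega> 2) (Lp_norm \<omega> 2) (conv_algebra \<omega>) \<and>
    commutative_algebra (conv_algebra \<omega>) (\<circ>) \<and>
    approximately_unital (conv_algebra \<omega>) (L2_op_norm \<omega>) (\<circ>) \<and>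
    radical_algebra (conv_algebra \<omega>) (\<circ>) \<and>
    \<not> reflexive_space (conv_algebra \<omega>) (L2_op_norm \<omega>) \<and>
    topologically_singly_generated (conv_algebra \<omega>) (L2_op_norm \<omega>) (\<circ>)"
  unfolding conv_algebra_eq L2_op_norm_def
  using not_compact[OF window_H window_norm _ window_separated] weakly_compact ideal_in_bidual
    operator_algebra commutative approx_unital[OF bump_H bump_norm bump_lim] radical
    not_reflexive[OF bump_H bump_norm bump_lim p0_nonzero] singly_generated
  by simp

end

section \<open>The staircase weight\<close>

locale staircase =
  fixes \<epsilon> :: "nat \<Rightarrow> real" and a :: "nat \<Rightarrow> nat" and \<omega> :: "real \<Rightarrow> real"
  assumes eps_pos: "\<And>n. n \<ge> 1 \<Longrightarrow> \<epsilon> n > 0"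
    and eps_decr: "\<And>m n. m \<ge> 1 \<Longrightarrow> n \<ge> m \<Longrightarrow> \<epsilon> n \<le> \<epsilon> m"
    and a_mono: "strict_mono a" and a_pos: "\<And>n. a n > 0"
    and a_mult: "\<And>n m. a (n + m) \<ge> a n * a m" and a_0: "a 0 = 1"
    and a_Max: "\<And>n. n \<ge> 2 \<Longrightarrow> real (a n) \<ge>
      Max ((\<lambda>k. 2 ^ k / \<epsilon> (n - k) * real (a k) * real (a (n - k))) ` {1..n - 1})"
    and omega: "\<And>n t. t \<in> {real n..<real n + 1} \<Longrightarrow> \<omega> t = 1 / real (a n)"
begin

text \<open>The growth condition at index n + k. Since \<epsilon> decreases, \<epsilon> n may be
  replaced by \<epsilon> 1, which removes the dependence of the factor on \<open>n\<close>.\<close>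

lemma a_growth:
  assumes "k \<ge> 1" "n \<ge> 1"
  shows "2 ^ k / \<epsilon> 1 * (real (a k) * real (a n)) \<le> real (a (n + k))"
proof -
  have "2 ^ k / \<epsilon> 1 * (real (a k) * real (a n)) \<le> 2 ^ k / \<epsilon> n * (real (a k) * real (a n))"
    using eps_decr[of 1 n] eps_pos[of n] eps_pos[of 1] assms
    by (intro mult_right_mono divide_left_mono) auto
  also have "\<dots> = (\<lambda>k. 2 ^ k / \<epsilon> (n + k - k) * real (a k) * real (a (n + k - k))) k" by simp
  also have "(\<lambda>k'. 2 ^ k' / \<epsilon> (n + k - k') * real (a k') * real (a (n + k - k'))) k \<le>
      Max ((\<lambda>k'. 2 ^ k' / \<epsilon> (n + k - k') * real (a k') * real (a (n + k - k'))) ` {1..n + k - 1})"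
    using assms by (intro Max_ge imageI) auto
  also have "\<dots> \<le> real (a (n + k))" using assms by (intro a_Max) auto
  finally show ?thesis by simp
qed

definition w :: "real \<Rightarrow> real" where "w t = (if t < 0 then 0 else 1 / real (a (nat \<lfloor>t\<rfloor>)))"

lemma w_nat: "real n \<le> t \<Longrightarrow> t < real n + 1 \<Longrightarrow> w t = 1 / real (a n)"
proof -
  assume t: "real n \<le> t" "t < real n + 1"
  then have "\<lfloor>t\<rfloor> = int n" by (simp add: floor_unique)
  then show ?thesis using t by (simp add: w_def)
qed

lemma floor_window:
  assumes "0 \<le> t"
  obtains n :: nat where "real n \<le> t" "t < real n + 1"
proof
  show "real (nat \<lfloor>t\<rfloor>) \<le> t" using assms by simp
  show "t < real (nat \<lfloor>t\<rfloor>) + 1" using assms by simp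
qed

text \<open>The integer part of r + s is n + k or n + k + 1; monotonicity of \<open>a\<close>
  absorbs the carry.\<close>

lemma w_add_le:
  assumes "real k \<le> r" "r < real k + 1" "real n \<le> s" "s < real n + 1"
  shows "w (r + s) \<le> 1 / real (a (n + k))"
proof -
  obtain j :: nat where j: "real j \<le> r + s" "r + s < real j + 1" using floor_window[of "r + s"] assms by auto
  have "n + k \<le> j" using j assms by linarith
  then have "a (n + k) \<le> a j" using a_mono by (simp add: strict_mono_less_eq)
  then show ?thesis using w_nat[OF j] a_pos[of "n + k"] by (simp add: frac_le)
qed



lemma two_power_ge_exp: "exp (real k / 2) \<le> 2 ^ k"
proof -
  have "exp (real k / 2) = exp (1 / 2) ^ k" by (simp add: exp_of_nat_mult[symmetric])
  also have "\<dots> \<le> 2 ^ k" using exp_half_le2 by (intro power_mono) auto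
  finally show ?thesis .
qed

text \<open>In the constant, the 2 serves the case where an argument is below 1: the sum of
  exponentials is then at least 1/2 and submultiplicativity suffices. The summand 2 \<epsilon> 1
  serves the remaining case, where \<open>a_growth\<close> gains \<epsilon> 1 / 2^k.\<close>

lemma w_submult:
  assumes "0 \<le> r" "0 \<le> s"
  shows "w (r + s) \<le> w r * w s"
    and "w (r + s) \<le> (2 + 2 * \<epsilon> 1) * (exp (- r / 2) + exp (- s / 2)) * (w r * w s)"
proof -
  obtain k :: nat where k: "real k \<le> r" "r < real k + 1" using floor_window[OF assms(1)] .
  obtain n :: nat where n: "real n \<le> s" "s < real n + 1" using floor_window[OF assms(2)] .
  have wr: "w r = 1 / real (a k)" "w s = 1 / real (a n)" using w_nat k n by auto
  have pos: "0 < w r * w s" using a_pos by (simp add: wr)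
  have "real (a n * a k) \<le> real (a (n + k))" using a_mult of_nat_mono by blast
  then have "1 / real (a (n + k)) \<le> w r * w s"
    unfolding wr using a_pos[of n] a_pos[of k] by (simp add: frac_le mult.commute)
  then show sub: "w (r + s) \<le> w r * w s" using w_add_le[OF k n] by linarith
  have e1: "\<epsilon> 1 > 0" using eps_pos by simp
  have near: "1 / 2 \<le> exp (- x / 2)" if "x < 1" for x :: real
  proof -
    have "exp (x / 2) \<le> exp (1 / 2)" using that by simp
    then have "exp (x / 2) \<le> 2" using exp_half_le2 by linarith
    then show ?thesis by (simp add: exp_minus field_simps)
  qed
  show "w (r + s) \<le> (2 + 2 * \<epsilon> 1) * (exp (- r / 2) + exp (- s / 2)) * (w r * w s)"
  proof (cases "k = 0 \<or> n = 0")
    case True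
    then have "1 / 2 \<le> exp (- r / 2) \<or> 1 / 2 \<le> exp (- s / 2)" using near k n by auto
    then have "1 / 2 \<le> exp (- r / 2) + exp (- s / 2)"
      using exp_ge_zero[of "- r / 2"] exp_ge_zero[of "- s / 2"] by linarith
    then have "2 * (1 / 2) \<le> (2 + 2 * \<epsilon> 1) * (exp (- r / 2) + exp (- s / 2))"
      using e1 by (intro mult_mono) auto
    from mult_right_mono[OF this less_imp_le[OF pos]] sub show ?thesis by simp
  next
    case False
    have "w (r + s) \<le> 1 / real (a (n + k))" by (rule w_add_le[OF k n])
    also have "\<dots> \<le> 1 / (2 ^ k / \<epsilon> 1 * (real (a k) * real (a n)))"
      using a_growth[of k n] False e1 a_pos by (intro divide_left_mono) auto
    also have "\<dots> = \<epsilon> 1 * (1 / 2 ^ k) * (w r * w s)" using e1 by (simp add: wr field_simps)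
    \<comment> \<open>The 2 pays for rounding \<open>r\<close> down to \<open>k\<close>: exp(r/2) <=
      exp((k+1)/2) <= 2 * 2^k.\<close>
    also have "\<dots> \<le> \<epsilon> 1 * (2 * exp (- r / 2)) * (w r * w s)"
    proof -
      have "exp (r / 2) \<le> exp (real (Suc k) / 2)" using k by simp
      also have "\<dots> \<le> 2 * 2 ^ k" using two_power_ge_exp[of "Suc k"] by simp
      finally have "1 / 2 ^ k \<le> 2 * exp (- r / 2)" by (simp add: exp_minus field_simps)
      then show ?thesis using e1 pos by (intro mult_right_mono mult_left_mono) auto
    qed
    also have "\<dots> \<le> (2 + 2 * \<epsilon> 1) * (exp (- r / 2) + exp (- s / 2)) * (w r * w s)"
    proof (intro mult_right_mono)
      have "\<epsilon> 1 * (2 * exp (- r / 2)) = 2 * \<epsilon> 1 * exp (- r / 2)" by simp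
      also have "\<dots> \<le> (2 + 2 * \<epsilon> 1) * (exp (- r / 2) + exp (- s / 2))"
        using e1 by (intro mult_mono) auto
      finally show "\<epsilon> 1 * (2 * exp (- r / 2)) \<le> (2 + 2 * \<epsilon> 1) * (exp (- r / 2) + exp (- s / 2))" .
    qed (use pos in simp)
    finally show ?thesis .
  qed
qed

text \<open>The ratios of consecutive \<open>a n\<close> grow at least like 2^n / \<epsilon> 1 and
  eventually exceed exp(|q|). From there on exp(|q| n) / a(n) decreases, so it is bounded.\<close>

lemma w_decay: "\<exists>C. \<forall>t\<ge>0. w t \<le> C * exp (- q * t)"
proof -
  define b where "b n = exp (\<bar>q\<bar> * real n) / real (a n)" for n
  have e1: "\<epsilon> 1 > 0" using eps_pos by simp
  obtain n1 where n1: "exp \<bar>q\<bar> * \<epsilon> 1 < 2 ^ n1" using real_arch_pow[of 2 "exp \<bar>q\<bar> * \<epsilon> 1"] by auto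
  define n0 where "n0 = Suc n1"
  have step: "b (Suc n) \<le> b n" if "n \<ge> n0" for n
  proof -
    have n: "n \<ge> 1" using that by (simp add: n0_def)
    have "a 0 < a 1" using a_mono by (simp add: strict_mono_def)
    then have a1: "1 \<le> real (a 1)" by simp
    have "exp \<bar>q\<bar> * \<epsilon> 1 \<le> 2 ^ n"
      using n1 power_increasing[of n1 n "2 :: real"] that unfolding n0_def by linarith
    then have "exp \<bar>q\<bar> \<le> 2 ^ n / \<epsilon> 1" using e1 by (simp add: field_simps)
    then have "exp \<bar>q\<bar> * real (a n) \<le> 2 ^ n / \<epsilon> 1 * real (a n)" by (rule mult_right_mono) simp
    also have "\<dots> = 2 ^ n / \<epsilon> 1 * (real (a n) * 1)" by simp
    also have "\<dots> \<le> 2 ^ n / \<epsilon> 1 * (real (a n) * real (a 1))"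
      using a1 e1 by (intro mult_left_mono) auto
    \<comment> \<open>\<open>a_growth\<close> is used with k = n and second index 1, so that the
      large factor is 2^n.\<close>
    also have "\<dots> \<le> real (a (1 + n))" using a_growth[of n 1] n by simp
    finally have le: "exp \<bar>q\<bar> * real (a n) \<le> real (a (Suc n))" by simp
    have "b (Suc n) = exp (\<bar>q\<bar> * real n) * exp \<bar>q\<bar> / real (a (Suc n))"
      by (simp add: b_def exp_add[symmetric] algebra_simps)
    also have "\<dots> \<le> exp (\<bar>q\<bar> * real n) / real (a n)"
      using mult_left_mono[OF le, of "exp (\<bar>q\<bar> * real n)"] a_pos[of n] a_pos[of "Suc n"]
      by (simp add: field_simps)
    finally show ?thesis by (simp add: b_def)
  qed
  define B where "B = Max (b ` {..n0})"
  have bB: "b n \<le> B" for n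
  proof (cases "n \<le> n0")
    case True then show ?thesis unfolding B_def by (intro Max_ge) auto
  next
    case False
    then have "n0 \<le> n" by simp
    then have "b n \<le> b n0"
      by (induction rule: dec_induct) (auto intro: order_trans[OF step])
    also have "\<dots> \<le> B" unfolding B_def by (intro Max_ge) auto
    finally show ?thesis .
  qed
  have "w t \<le> (B * exp \<bar>q\<bar>) * exp (- q * t)" if t: "t \<ge> 0" for t
  proof -
    obtain n :: nat where n: "real n \<le> t" "t < real n + 1" using floor_window[OF t] .
    \<comment> \<open>The extra factor exp(|q|) in the constant accounts for \<open>t\<close> lying
      up to one unit beyond \<open>n\<close>.\<close>
    have "q * t \<le> \<bar>q\<bar> * (real n + 1)" using n t by (intro mult_mono) auto
    then have "exp (q * t) \<le> exp (\<bar>q\<bar> * real n) * exp \<bar>q\<bar>" by (simp add: exp_add[symmetric] algebra_simps)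
    from divide_right_mono[OF this, of "real (a n)"] have "exp (q * t) * w t \<le> b n * exp \<bar>q\<bar>"
      using w_nat[OF n] by (simp add: b_def)
    also have "\<dots> \<le> B * exp \<bar>q\<bar>" using bB by (intro mult_right_mono) auto
    finally show ?thesis by (simp add: exp_minus field_simps)
  qed
  then show ?thesis by blast
qed

sublocale staircase_weight w \<omega> "2 + 2 * \<epsilon> 1"
proof
  show "w \<in> borel_measurable borel" unfolding w_def[abs_def] by measurable
  show "\<omega> t = w t" if "0 \<le> t" for t
    using that floor_window[OF that] omega w_nat by (metis atLeastLessThan_iff)
  show "w t = 0" if "t < 0" for t using that by (simp add: w_def)
  show "0 < w t" if "0 \<le> t" for t using that a_pos by (simp add: w_def)
  show "w 0 = 1" by (simp add: w_def a_0)
  show "w t = w (real n)" if "real n \<le> t" "t < real n + 1" for n t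
    using w_nat[OF that] w_nat[of n "real n"] by simp
qed (use w_submult w_decay in auto)

end

theorem theorem6p4:
  fixes \<epsilon> :: "nat \<Rightarrow> real" and a :: "nat \<Rightarrow> nat" and \<omega> :: "real \<Rightarrow> real"
  assumes "\<forall>n\<ge>1. \<epsilon> n > 0"
    and "\<forall>m\<ge>1. \<forall>n\<ge>m. \<epsilon> n \<le> \<epsilon> m"
    and "\<epsilon> \<longlonglongrightarrow> 0"
    and "strict_mono a"
    and "\<forall>n. a n > 0"
    and "\<forall>n m. a (n + m) \<ge> a n * a m"
    and "a 0 = 1"
    and "\<forall>n\<ge>2. real (a n) \<ge>
      Max ((\<lambda>k. 2 ^ k / \<epsilon> (n - k) * real (a k) * real (a (n - k))) ` {1..n - 1})"
    and "\<forall>n. \<forall>t\<in>{real n..<real n + 1}. \<omega> t = 1 / real (a n)"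
  shows "\<not> compact_algebra (conv_algebra \<omega>) (L2_op_norm \<omega>) (\<circ>) \<and>
    weakly_compact_algebra (conv_algebra \<omega>) (L2_op_norm \<omega>) (\<circ>) \<and>
    ideal_in_bidual (conv_algebra \<omega>) (L2_op_norm \<omega>) (\<circ>) \<and>
    operator_algebra_on (Lp_space \<omega> 2) (Lp_norm \<omega> 2) (conv_algebra \<omega>) \<and>
    commutative_algebra (conv_algebra \<omega>) (\<circ>) \<and>
    approximately_unital (conv_algebra \<omega>) (L2_op_norm \<omega>) (\<circ>) \<and>
    radical_algebra (conv_algebra \<omega>) (\<circ>) \<and>
    \<not> reflexive_space (conv_algebra \<omega>) (L2_op_norm \<omega>) \<and>
    topologically_singly_generated (conv_algebra \<omega>) (L2_op_norm \<omega>) (\<circ>)"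
proof -
  interpret staircase \<epsilon> a \<omega>
    by unfold_locales (use assms in auto)
  show ?thesis by (rule conv_algebra_properties)
qed

end
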